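(* Assume $|\omega(\alpha,\beta)|=1$ for all $\alpha,\beta\in\Gamma$, and let $V$ be a finite dimensional $\Gamma$-graded vector space. For all integers $r\ge0$, the tensor power $V^{\otimes r}$ of the natural $\mathfrak{gl}(V)$-module is unitarisable for the type I compact $\ast$-structure of $\mathrm U(\mathfrak{gl}(V))$. Also, for all $r\ge0$, the tensor power $(V^* )^{\otimes r}$ of the dual module $V^*$ of $V$ is unitarisable for the type II compact $\ast$-structure.
   Context: All vector spaces are over $\mathbb C$. $\Gamma$ is an additive abelian group with a commutative factor $\omega:\Gamma\times\Gamma\to\mathbb C^*$, i.e. $\omega(\alpha,\beta)=\omega(\beta,\alpha)^{-1}$ and $\omega$ is multiplicative in each argument (so $\omega(\alpha,\alpha)=\pm1$). $d(x)$ is the degree of a homogeneous element; formulas with $d$ are extended linearly. $V=\bigoplus_\alpha V_\alpha$; $\mathfrak{gl}(V)=\mathrm{End}_{\mathbb C}(V)$ graded by $\mathfrak{gl}(V)_\alpha=\bigoplus_\beta\mathrm{Hom}(V_\beta,V_{\alpha+\beta})$ with bracket $[X,Y]=XY-\omega(d(X),d(Y))YX$. $\mathrm U(\mathfrak{gl}(V))$ is the tensor algebra modulo $XY-\omega(d(X),d(Y))YX=[X,Y]$. $X\in\mathfrak{gl}(V)$ acts on tensor products by $X(v\otimes w)=Xv\otimes w+\omega(d(X),d(v))v\otimes Xw$, and on $V^*$ (graded by $(V^* )_{-\alpha}=(V_\alpha)^*$) by $(X\cdot f)(v)=-\omega(d(X),d(f))f(Xv)$. Let $(b_a)$ be a homogeneous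 basis of $V$, $\gamma_a=d(b_a)$, and $E_{ab}$ the matrix units ($E_{ab}b_c=\delta_{bc}b_a$). The compact $\ast$-structures of $\mathrm U(\mathfrak{gl}(V))$ are the conjugate-linear involutive maps with $(xy)^\ast=y^\ast x^\ast$ determined by: type I: $\ast(E_{ab})=E_{ba}$; type II: $\ast'(E_{ab})=\omega(\gamma_a,\gamma_a)\omega(\gamma_b,\gamma_b)E_{ba}$. A module $M$ is unitarisable for a $\ast$-structure if there is a positive definite sesquilinear form $\langle\ ,\ \rangle$ on $M$ (conjugate-linear in the first argument) with $\langle xv,v'\rangle=\langle v,\ast(x)v'\rangle$ for all $x\in\mathrm U(\mathfrak{gl}(V))$, $v,v'\in M$. *)

theory Defs
  imports
    Complex_Main
    "HOL-Library.FuncSet"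
    "HOL-Library.Function_Algebras"
    "HOL-Library.Poly_Mapping"
    "HOL-Algebra.QuotRing"
    "HOL-Algebra.Module"
begin

section \<open>Quotients of complex algebras and the tensor algebra\<close>

text \<open>
  Associative complex algebras are given by HOL-Algebra records of type
  \<open>(complex, 'a) module\<close>: the ring fields together with the scalar multiplication \<open>smult\<close>.
\<close>

text \<open>The ring \<open>A Quot I\<close> with the induced scalar multiplication. Adding \<open>I\<close> to the image
  \<open>c \<odot> X\<close> is needed for \<open>c = 0\<close> only, where the image is the singleton zero.\<close>

definition quot_algebra ::
  "(complex, 'a) module \<Rightarrow> 'a set \<Rightarrow> (complex, 'a set) module" where
  "quot_algebra A I =
    \<lparr>carrier = carrier (A Quot I), mult = mult (A Quot I), one = one (A Quot I),
     zero = zero (A Quot I), add = add (A Quot I),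
     smult = (\<lambda>c X. I <+>\<^bsub>A\<^esub> ((\<lambda>x. c \<odot>\<^bsub>A\<^esub> x) ` X))\<rparr>"

text \<open>The free monoid, written additively so that \<open>'a word \<Rightarrow>\<^sub>0 complex\<close> with the
  convolution product of Poly_Mapping is the free associative unital algebra on \<open>'a\<close>.\<close>

datatype 'a word = Word (letters: "'a list")

instantiation word :: (type) monoid_add
begin
definition zero_word :: "'a word" where "zero_word = Word []"
definition plus_word :: "'a word \<Rightarrow> 'a word \<Rightarrow> 'a word" where
  "plus_word u v = Word (letters u @ letters v)"
instance by standard (simp_all add: zero_word_def plus_word_def)
end

definition free_algebra :: "'w set \<Rightarrow> (complex, 'w word \<Rightarrow>\<^sub>0 complex) module" where
  "free_algebra S =
    \<lparr>carrier = {p. \<forall>w\<in>Poly_Mapping.keys p. set (letters w) \<subseteq> S}, mult = (*), one = 1,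
     zero = 0, add = (+), smult = (\<lambda>c p. Poly_Mapping.single 0 c * p)\<rparr>"

definition letter :: "'w \<Rightarrow> ('w word \<Rightarrow>\<^sub>0 complex)" where
  "letter x = Poly_Mapping.single (Word [x]) 1"

text \<open>
  The tensor algebra of a complex vector space \<open>S\<close> (a subspace of the ambient type \<open>'w\<close> with
  scalar multiplication \<open>s\<close>): the free algebra on the set \<open>S\<close> modulo linearity of \<open>letter\<close>.
\<close>

definition tensor_ideal ::
  "(complex \<Rightarrow> 'w::ab_group_add \<Rightarrow> 'w) \<Rightarrow> 'w set \<Rightarrow> ('w word \<Rightarrow>\<^sub>0 complex) set" where
  "tensor_ideal s S = Idl\<^bsub>free_algebra S\<^esub>
    ({letter (x + y) - letter x - letter y | x y. x \<in> S \<and> y \<in> S} \<union>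
     {letter (s c x) - Poly_Mapping.single 0 c * letter x | c x. x \<in> S})"

definition tensor_algebra ::
  "(complex \<Rightarrow> 'w::ab_group_add \<Rightarrow> 'w) \<Rightarrow> 'w set \<Rightarrow>
   (complex, ('w word \<Rightarrow>\<^sub>0 complex) set) module" where
  "tensor_algebra s S = quot_algebra (free_algebra S) (tensor_ideal s S)"

definition tensor_incl ::
  "(complex \<Rightarrow> 'w::ab_group_add \<Rightarrow> 'w) \<Rightarrow> 'w set \<Rightarrow> 'w \<Rightarrow> ('w word \<Rightarrow>\<^sub>0 complex) set" where
  "tensor_incl s S x = tensor_ideal s S +>\<^bsub>free_algebra S\<^esub> letter x"

text \<open>The \<open>r\<close>-fold tensor power of \<open>S\<close> is the component of degree \<open>r\<close> of the tensor algebra.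
  Only the vector space part of the resulting record is meaningful.\<close>

definition tensor_power ::
  "(complex \<Rightarrow> 'w::ab_group_add \<Rightarrow> 'w) \<Rightarrow> 'w set \<Rightarrow> nat \<Rightarrow>
   (complex, ('w word \<Rightarrow>\<^sub>0 complex) set) module" where
  "tensor_power s S r = (tensor_algebra s S)
    \<lparr>carrier := {tensor_ideal s S +>\<^bsub>free_algebra S\<^esub> p | p.
       p \<in> carrier (free_algebra S) \<and> (\<forall>w\<in>Poly_Mapping.keys p. length (letters w) = r)}\<rparr>"


section \<open>Star structures and unitarisable modules\<close>

definition star_structure :: "(complex, 'u) module \<Rightarrow> ('u \<Rightarrow> 'u) \<Rightarrow> bool" where
  "star_structure A \<tau> \<longleftrightarrow>
    \<tau> \<in> carrier A \<rightarrow>\<^sub>E carrier A \<and>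
    (\<forall>x\<in>carrier A. \<forall>y\<in>carrier A. \<tau> (x \<oplus>\<^bsub>A\<^esub> y) = \<tau> x \<oplus>\<^bsub>A\<^esub> \<tau> y) \<and>
    (\<forall>c. \<forall>x\<in>carrier A. \<tau> (c \<odot>\<^bsub>A\<^esub> x) = cnj c \<odot>\<^bsub>A\<^esub> \<tau> x) \<and>
    (\<forall>x\<in>carrier A. \<forall>y\<in>carrier A. \<tau> (x \<otimes>\<^bsub>A\<^esub> y) = \<tau> y \<otimes>\<^bsub>A\<^esub> \<tau> x) \<and>
    (\<forall>x\<in>carrier A. \<tau> (\<tau> x) = x)"

definition sesquilinear_form :: "(complex, 'm) module \<Rightarrow> ('m \<Rightarrow> 'm \<Rightarrow> complex) \<Rightarrow> bool" where
  "sesquilinear_form M f \<longleftrightarrow>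
    (\<forall>x\<in>carrier M. \<forall>y\<in>carrier M. \<forall>z\<in>carrier M.
       f (x \<oplus>\<^bsub>M\<^esub> y) z = f x z + f y z \<and> f x (y \<oplus>\<^bsub>M\<^esub> z) = f x y + f x z) \<and>
    (\<forall>c. \<forall>x\<in>carrier M. \<forall>y\<in>carrier M.
       f (c \<odot>\<^bsub>M\<^esub> x) y = cnj c * f x y \<and> f x (c \<odot>\<^bsub>M\<^esub> y) = c * f x y)"

definition positive_definite :: "(complex, 'm) module \<Rightarrow> ('m \<Rightarrow> 'm \<Rightarrow> complex) \<Rightarrow> bool" where
  "positive_definite M f \<longleftrightarrow>
    (\<forall>x\<in>carrier M. x \<noteq> \<zero>\<^bsub>M\<^esub> \<longrightarrow> f x x \<in> \<real> \<and> 0 < Re (f x x))"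

text \<open>\<open>\<sigma> x v\<close> is the action of \<open>x \<in> A\<close> on \<open>v \<in> M\<close>.\<close>

definition unitarisable ::
  "(complex, 'u) module \<Rightarrow> ('u \<Rightarrow> 'u) \<Rightarrow> (complex, 'm) module \<Rightarrow> ('u \<Rightarrow> 'm \<Rightarrow> 'm) \<Rightarrow> bool" where
  "unitarisable A \<tau> M \<sigma> \<longleftrightarrow>
    (\<exists>f. sesquilinear_form M f \<and> positive_definite M f \<and>
      (\<forall>x\<in>carrier A. \<forall>v\<in>carrier M. \<forall>v'\<in>carrier M. f (\<sigma> x v) v' = f v (\<sigma> (\<tau> x) v')))"

definition algebra_action ::
  "(complex, 'u) module \<Rightarrow> (complex, 'm) module \<Rightarrow> ('u \<Rightarrow> 'm \<Rightarrow> 'm) \<Rightarrow> bool" where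
  "algebra_action A M \<sigma> \<longleftrightarrow>
    \<sigma> \<in> carrier A \<rightarrow>\<^sub>E (carrier M \<rightarrow>\<^sub>E carrier M) \<and>
    (\<forall>x\<in>carrier A. \<forall>v\<in>carrier M. \<forall>v'\<in>carrier M. \<sigma> x (v \<oplus>\<^bsub>M\<^esub> v') = \<sigma> x v \<oplus>\<^bsub>M\<^esub> \<sigma> x v') \<and>
    (\<forall>x\<in>carrier A. \<forall>y\<in>carrier A. \<forall>v\<in>carrier M.
       \<sigma> (x \<oplus>\<^bsub>A\<^esub> y) v = \<sigma> x v \<oplus>\<^bsub>M\<^esub> \<sigma> y v \<and> \<sigma> (x \<otimes>\<^bsub>A\<^esub> y) v = \<sigma> x (\<sigma> y v)) \<and>
    (\<forall>c. \<forall>x\<in>carrier A. \<forall>v\<in>carrier M.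
       \<sigma> (c \<odot>\<^bsub>A\<^esub> x) v = c \<odot>\<^bsub>M\<^esub> \<sigma> x v \<and> \<sigma> x (c \<odot>\<^bsub>M\<^esub> v) = c \<odot>\<^bsub>M\<^esub> \<sigma> x v) \<and>
    (\<forall>v\<in>carrier M. \<sigma> \<one>\<^bsub>A\<^esub> v = v)"


section \<open>Graded vector spaces and the general linear colour Lie algebra\<close>

definition commutative_factor :: "('g::ab_group_add \<Rightarrow> 'g \<Rightarrow> complex) \<Rightarrow> bool" where
  "commutative_factor \<omega> \<longleftrightarrow>
    (\<forall>\<alpha> \<beta>. \<omega> \<alpha> \<beta> \<noteq> 0) \<and>
    (\<forall>\<alpha> \<beta>. \<omega> \<alpha> \<beta> = inverse (\<omega> \<beta> \<alpha>)) \<and>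
    (\<forall>\<alpha> \<beta> \<gamma>. \<omega> (\<alpha> + \<beta>) \<gamma> = \<omega> \<alpha> \<gamma> * \<omega> \<beta> \<gamma>) \<and>
    (\<forall>\<alpha> \<beta> \<gamma>. \<omega> \<alpha> (\<beta> + \<gamma>) = \<omega> \<alpha> \<beta> * \<omega> \<alpha> \<gamma>)"

definition fun_scale :: "(complex \<Rightarrow> 'b \<Rightarrow> 'b) \<Rightarrow> complex \<Rightarrow> ('a \<Rightarrow> 'b) \<Rightarrow> ('a \<Rightarrow> 'b)" where
  "fun_scale s c f = (\<lambda>x. s c (f x))"

text \<open>A finite-dimensional graded vector space (with \<open>V \<alpha>\<close> the component of degree \<open>\<alpha>\<close>, and the
  whole type \<open>'v\<close> as underlying space) together with a homogeneous basis \<open>B\<close>.\<close>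

locale graded_space = finite_dimensional_vector_space scale B
  for scale :: "complex \<Rightarrow> 'v::ab_group_add \<Rightarrow> 'v" (infixr \<open>*s\<close> 75)
    and B :: "'v set" +
  fixes \<omega> :: "'g::ab_group_add \<Rightarrow> 'g \<Rightarrow> complex"
    and V :: "'g \<Rightarrow> 'v set"
  assumes factor: "commutative_factor \<omega>"
    and subspace_part: "subspace (V \<alpha>)"
    and direct_sum:
      "\<exists>!f. finite {\<alpha>. f \<alpha> \<noteq> 0} \<and> (\<forall>\<alpha>. f \<alpha> \<in> V \<alpha>) \<and> v = (\<Sum>\<alpha> | f \<alpha> \<noteq> 0. f \<alpha>)"
    and homogeneous_basis: "b \<in> B \<Longrightarrow> \<exists>\<alpha>. b \<in> V \<alpha>"
begin

definition degree :: "'v \<Rightarrow> 'g" where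
  "degree b = (THE \<alpha>. b \<in> V \<alpha>)"

definition gl :: "('v \<Rightarrow> 'v) set" where
  "gl = {X. Vector_Spaces.linear scale scale X}"

definition gl_part :: "'g \<Rightarrow> ('v \<Rightarrow> 'v) set" where
  "gl_part \<alpha> = {X \<in> gl. \<forall>\<beta>. X ` V \<beta> \<subseteq> V (\<alpha> + \<beta>)}"

text \<open>The bracket of \<open>X\<close> of degree \<open>\<alpha>\<close> and \<open>Y\<close> of degree \<open>\<beta>\<close>. The degrees are arguments because
  the zero map has every degree; the value does not depend on the choice.\<close>

definition bracket :: "'g \<Rightarrow> 'g \<Rightarrow> ('v \<Rightarrow> 'v) \<Rightarrow> ('v \<Rightarrow> 'v) \<Rightarrow> ('v \<Rightarrow> 'v)" where
  "bracket \<alpha> \<beta> X Y = (\<lambda>v. X (Y v) - \<omega> \<alpha> \<beta> *s Y (X v))"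

definition E :: "'v \<Rightarrow> 'v \<Rightarrow> ('v \<Rightarrow> 'v)" where
  "E a b = (\<lambda>v. representation B v b *s a)"

abbreviation TA :: "(complex, (('v \<Rightarrow> 'v) word \<Rightarrow>\<^sub>0 complex) set) module" where
  "TA \<equiv> tensor_algebra (fun_scale scale) gl"

abbreviation \<iota> :: "('v \<Rightarrow> 'v) \<Rightarrow> (('v \<Rightarrow> 'v) word \<Rightarrow>\<^sub>0 complex) set" where
  "\<iota> \<equiv> tensor_incl (fun_scale scale) gl"

definition U_ideal :: "(('v \<Rightarrow> 'v) word \<Rightarrow>\<^sub>0 complex) set set" where
  "U_ideal = Idl\<^bsub>TA\<^esub>
    {((\<iota> X \<otimes>\<^bsub>TA\<^esub> \<iota> Y) \<ominus>\<^bsub>TA\<^esub> (\<omega> \<alpha> \<beta> \<odot>\<^bsub>TA\<^esub> (\<iota> Y \<otimes>\<^bsub>TA\<^esub> \<iota> X))) \<ominus>\<^bsub>TA\<^esub> \<iota> (bracket \<alpha> \<beta> X Y) | X Y \<alpha> \<beta>.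
       X \<in> gl_part \<alpha> \<and> Y \<in> gl_part \<beta>}"

definition U :: "(complex, (('v \<Rightarrow> 'v) word \<Rightarrow>\<^sub>0 complex) set set) module" where
  "U = quot_algebra TA U_ideal"

definition U_incl :: "('v \<Rightarrow> 'v) \<Rightarrow> (('v \<Rightarrow> 'v) word \<Rightarrow>\<^sub>0 complex) set set" where
  "U_incl X = U_ideal +>\<^bsub>TA\<^esub> \<iota> X"

definition star_I ::
  "(('v \<Rightarrow> 'v) word \<Rightarrow>\<^sub>0 complex) set set \<Rightarrow> (('v \<Rightarrow> 'v) word \<Rightarrow>\<^sub>0 complex) set set" where
  "star_I = (THE \<tau>. star_structure U \<tau> \<and>
     (\<forall>a\<in>B. \<forall>b\<in>B. \<tau> (U_incl (E a b)) = U_incl (E b a)))"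

definition star_II ::
  "(('v \<Rightarrow> 'v) word \<Rightarrow>\<^sub>0 complex) set set \<Rightarrow> (('v \<Rightarrow> 'v) word \<Rightarrow>\<^sub>0 complex) set set" where
  "star_II = (THE \<tau>. star_structure U \<tau> \<and>
     (\<forall>a\<in>B. \<forall>b\<in>B. \<tau> (U_incl (E a b)) =
        (\<omega> (degree a) (degree a) * \<omega> (degree b) (degree b)) \<odot>\<^bsub>U\<^esub> U_incl (E b a)))"

text \<open>The dual space; a functional on \<open>V \<alpha>\<close> is extended by zero to the other components.\<close>

definition dual :: "('v \<Rightarrow> complex) set" where
  "dual = {f. Vector_Spaces.linear scale (*) f}"

definition dual_part :: "'g \<Rightarrow> ('v \<Rightarrow> complex) set" where
  "dual_part \<alpha> = {f \<in> dual. \<forall>\<beta>. \<beta> \<noteq> - \<alpha> \<longrightarrow> (\<forall>v\<in>V \<beta>. f v = 0)}"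

text \<open>Here and below, a formula given for homogeneous elements is extended linearly by taking the
  unique bilinear map satisfying it.\<close>

definition dual_action :: "('v \<Rightarrow> 'v) \<Rightarrow> ('v \<Rightarrow> complex) \<Rightarrow> ('v \<Rightarrow> complex)" where
  "dual_action = (THE \<rho>. \<rho> \<in> gl \<rightarrow>\<^sub>E (dual \<rightarrow>\<^sub>E dual) \<and>
     (\<forall>X\<in>gl. \<forall>Y\<in>gl. \<forall>f\<in>dual. \<rho> (X + Y) f = \<rho> X f + \<rho> Y f) \<and>
     (\<forall>X\<in>gl. \<forall>f\<in>dual. \<forall>g\<in>dual. \<rho> X (f + g) = \<rho> X f + \<rho> X g) \<and>
     (\<forall>c. \<forall>X\<in>gl. \<forall>f\<in>dual.
        \<rho> (fun_scale scale c X) f = fun_scale (*) c (\<rho> X f) \<and>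
        \<rho> X (fun_scale (*) c f) = fun_scale (*) c (\<rho> X f)) \<and>
     (\<forall>\<alpha> \<beta>. \<forall>X\<in>gl_part \<alpha>. \<forall>f\<in>dual_part \<beta>. \<rho> X f = (\<lambda>v. - \<omega> \<alpha> \<beta> * f (X v))))"

text \<open>
  The action on all tensor powers of \<open>S\<close>, for a graded \<open>gl\<close>-module \<open>S\<close> with components \<open>P \<beta>\<close>, scalar
  multiplication \<open>s\<close> and action \<open>act\<close>. The power of exponent \<open>r + 1\<close> is the tensor product of \<open>S\<close> with
  the power of exponent \<open>r\<close>; the power of exponent 0 is the trivial module, spanned by the unit.
\<close>

definition tensor_action ::
  "(complex \<Rightarrow> 'w::ab_group_add \<Rightarrow> 'w) \<Rightarrow> 'w set \<Rightarrow> ('g \<Rightarrow> 'w set) \<Rightarrow>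
   (('v \<Rightarrow> 'v) \<Rightarrow> 'w \<Rightarrow> 'w) \<Rightarrow>
   ('v \<Rightarrow> 'v) \<Rightarrow> ('w word \<Rightarrow>\<^sub>0 complex) set \<Rightarrow> ('w word \<Rightarrow>\<^sub>0 complex) set" where
  "tensor_action s S P act =
    (let T = tensor_algebra s S; j = tensor_incl s S in
     THE \<rho>. \<rho> \<in> gl \<rightarrow>\<^sub>E (carrier T \<rightarrow>\<^sub>E carrier T) \<and>
      (\<forall>X\<in>gl. \<forall>Y\<in>gl. \<forall>t\<in>carrier T. \<rho> (X + Y) t = \<rho> X t \<oplus>\<^bsub>T\<^esub> \<rho> Y t) \<and>
      (\<forall>X\<in>gl. \<forall>t\<in>carrier T. \<forall>t'\<in>carrier T. \<rho> X (t \<oplus>\<^bsub>T\<^esub> t') = \<rho> X t \<oplus>\<^bsub>T\<^esub> \<rho> X t') \<and>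
      (\<forall>c. \<forall>X\<in>gl. \<forall>t\<in>carrier T.
         \<rho> (fun_scale scale c X) t = c \<odot>\<^bsub>T\<^esub> \<rho> X t \<and>
         \<rho> X (c \<odot>\<^bsub>T\<^esub> t) = c \<odot>\<^bsub>T\<^esub> \<rho> X t) \<and>
      (\<forall>X\<in>gl. \<rho> X \<one>\<^bsub>T\<^esub> = \<zero>\<^bsub>T\<^esub>) \<and>
      (\<forall>\<alpha> \<beta>. \<forall>X\<in>gl_part \<alpha>. \<forall>v\<in>P \<beta>. \<forall>t\<in>carrier T.
         \<rho> X (j v \<otimes>\<^bsub>T\<^esub> t) = (j (act X v) \<otimes>\<^bsub>T\<^esub> t) \<oplus>\<^bsub>T\<^esub> (\<omega> \<alpha> \<beta> \<odot>\<^bsub>T\<^esub> (j v \<otimes>\<^bsub>T\<^esub> \<rho> X t))))"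

text \<open>The \<open>U\<close>-module structure of a \<open>gl\<close>-module \<open>M\<close> with action \<open>\<rho>\<close>.\<close>

definition U_action ::
  "(complex, 'm) module \<Rightarrow> (('v \<Rightarrow> 'v) \<Rightarrow> 'm \<Rightarrow> 'm) \<Rightarrow>
   (('v \<Rightarrow> 'v) word \<Rightarrow>\<^sub>0 complex) set set \<Rightarrow> 'm \<Rightarrow> 'm" where
  "U_action M \<rho> = (THE \<sigma>. algebra_action U M \<sigma> \<and>
     (\<forall>X\<in>gl. \<forall>v\<in>carrier M. \<sigma> (U_incl X) v = \<rho> X v))"

definition natural_power :: "nat \<Rightarrow> (complex, ('v word \<Rightarrow>\<^sub>0 complex) set) module" where
  "natural_power r = tensor_power scale UNIV r"

definition natural_power_action ::
  "nat \<Rightarrow> (('v \<Rightarrow> 'v) word \<Rightarrow>\<^sub>0 complex) set set \<Rightarrow>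
   ('v word \<Rightarrow>\<^sub>0 complex) set \<Rightarrow> ('v word \<Rightarrow>\<^sub>0 complex) set" where
  "natural_power_action r =
     U_action (natural_power r) (tensor_action scale UNIV V (\<lambda>X v. X v))"

definition dual_power :: "nat \<Rightarrow> (complex, (('v \<Rightarrow> complex) word \<Rightarrow>\<^sub>0 complex) set) module" where
  "dual_power r = tensor_power (fun_scale (*)) dual r"

definition dual_power_action ::
  "nat \<Rightarrow> (('v \<Rightarrow> 'v) word \<Rightarrow>\<^sub>0 complex) set set \<Rightarrow>
   (('v \<Rightarrow> complex) word \<Rightarrow>\<^sub>0 complex) set \<Rightarrow> (('v \<Rightarrow> complex) word \<Rightarrow>\<^sub>0 complex) set" where
  "dual_power_action r =
     U_action (dual_power r) (tensor_action (fun_scale (*)) dual dual_part dual_action)"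

end

end

(*
Choosing the homogeneous basis b_a identifies the tensor algebra of V (or of its dual) with the free
algebra on the index set: rewriting every vector in the basis is a normal form whose kernel is the
tensor ideal. On words X acts by
  X (b w) = (X b) w + b (T X T^-1) w,   T b_c = omega(gamma_c, deg b) b_c,
which for homogeneous X is the colour Leibniz rule but makes sense, and is linear in X, for all X.
Let words be orthonormal. Since T is unitary when |omega| = 1, conjugation by T commutes with the
adjoint, and an induction on words shows that X and its adjoint act by adjoint operators on tensor
powers as soon as they do on the module itself. For the dual this last point reads
conj(omega(x - y, -x)) = omega(y - x, -y) omega(x, x) omega(y, y) for degrees x, y, which is where
the signs of the type II structure come from.
*)

theory Submission
  imports Defs
begin

section \<open>Free algebras and their quotients\<close>

text \<open>The star structures and all actions in the theorem are definite descriptions, so each of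
  them needs an explicit candidate and a proof that nothing else satisfies the description. The
  candidates are built on free algebras and must descend to \<open>U\<close>, a quotient of a
  quotient; \<open>proj_kernel_least\<close> collapses this to one check per map, on the linear
  relations between letters and on the colour commutator relations. Unimodularity enters as cnj
  (\<omega> \<alpha> \<beta>) = \<omega> (- \<beta>) (- \<alpha>). Taking adjoints reverses products
  and negates degrees, and this identity carries the relation for X, Y to the relation for the
  adjoints of Y, X. A sign function \<open>sg\<close> as parameter treats both star structures at
  once, and the locale \<open>graded_module\<close> treats V and its dual at once. Among the
  assumptions on the module, \<open>act_adj\<close> is the one that ties it to the choice of
  signs.\<close>

lemma poly_mapping_keys_induct [consumes 1, case_names zero single add]:
  fixes p :: "'x \<Rightarrow>\<^sub>0 'c::comm_monoid_add"
  assumes "Poly_Mapping.keys p \<subseteq> W"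
    and "P 0"
    and "\<And>w c. w \<in> W \<Longrightarrow> P (Poly_Mapping.single w c)"
    and "\<And>p q. Poly_Mapping.keys p \<subseteq> W \<Longrightarrow> Poly_Mapping.keys q \<subseteq> W \<Longrightarrow> P p \<Longrightarrow> P q \<Longrightarrow> P (p + q)"
  shows "P p"
proof -
  \<comment> \<open>Partial sums of the monomial expansion. Their supports are tracked because the
    closure of \<open>P\<close> under sums is only assumed for summands supported in
    \<open>W\<close>.\<close>
  have *: "finite K \<Longrightarrow> K \<subseteq> W \<Longrightarrow>
      Poly_Mapping.keys (\<Sum>w\<in>K. Poly_Mapping.single w (Poly_Mapping.lookup p w)) \<subseteq> W \<and>
      P (\<Sum>w\<in>K. Poly_Mapping.single w (Poly_Mapping.lookup p w))" for K
  proof (induction K rule: finite_induct)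
    case empty
    then show ?case using assms(2) by simp
  next
    case (insert w K)
    have "Poly_Mapping.keys (Poly_Mapping.single w (Poly_Mapping.lookup p w)) \<subseteq> W"
      using insert.prems by simp
    moreover have "P (Poly_Mapping.single w (Poly_Mapping.lookup p w))"
      using assms(3) insert.prems by blast
    ultimately show ?case
      using insert assms(4) keys_add[of "Poly_Mapping.single w (Poly_Mapping.lookup p w)"
        "\<Sum>w\<in>K. Poly_Mapping.single w (Poly_Mapping.lookup p w)"] by auto
  qed
  have "(\<Sum>w\<in>Poly_Mapping.keys p. Poly_Mapping.single w (Poly_Mapping.lookup p w)) = p"
    by (rule poly_mapping_eqI)
      (auto simp: lookup_sum lookup_single when_def sum.delta in_keys_iff)
  then show ?thesis using *[of "Poly_Mapping.keys p"] assms(1) by simp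
qed

text \<open>\<open>h\<close> receives the coefficient as an argument instead of being rescaled by
  it, so that conjugate-linear maps such as \<open>star_poly\<close> are extensions of this kind
  too.\<close>

definition linear_extension :: "('x \<Rightarrow> complex \<Rightarrow> 'm::comm_monoid_add) \<Rightarrow> ('x \<Rightarrow>\<^sub>0 complex) \<Rightarrow> 'm" where
  "linear_extension h p = (\<Sum>w\<in>Poly_Mapping.keys p. h w (Poly_Mapping.lookup p w))"

lemma linear_extension_add:
  assumes "\<And>w. h w 0 = 0" "\<And>w c d. h w (c + d) = h w c + h w d"
  shows "linear_extension h (p + q) = linear_extension h p + linear_extension h q"
  unfolding linear_extension_def
  by (rule setsum_keys_plus_distrib) (use assms in auto)

lemma linear_extension_single [simp]:
  assumes "h w 0 = 0"
  shows "linear_extension h (Poly_Mapping.single w c) = h w c"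
  using assms by (auto simp: linear_extension_def)

lemma linear_extension_0 [simp]: "linear_extension h 0 = 0"
  by (simp add: linear_extension_def)

abbreviation scalar :: "complex \<Rightarrow> ('a word \<Rightarrow>\<^sub>0 complex)" where
  "scalar c \<equiv> Poly_Mapping.single 0 c"

lemma letters_0 [simp]: "letters 0 = []"
  by (simp add: zero_word_def)

lemma letters_plus [simp]: "letters (u + v) = letters u @ letters v"
  by (simp add: plus_word_def)

lemma Word_Nil: "Word [] = 0"
  by (simp add: zero_word_def)

lemma Word_Cons: "Word (x # xs) = Word [x] + Word xs"
  by (simp add: plus_word_def)

lemma lookup_scalar_mult [simp]:
  "Poly_Mapping.lookup (scalar c * p) w = c * Poly_Mapping.lookup p w"
  by (simp add: map.rep_eq when_def flip: mult_map_scale_conv_mult)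

lemma scalar_commute: "p * scalar c = scalar c * p"
proof -
  have "Poly_Mapping.keys p \<subseteq> UNIV" by simp
  then show ?thesis
    by (induction p rule: poly_mapping_keys_induct)
      (auto simp: mult_single distrib_left distrib_right mult.commute)
qed

lemma scalar_left_commute: "p * (scalar c * q) = scalar c * (p * q)"
  by (metis mult.assoc scalar_commute)

lemma scalar_add: "scalar (c + d) = scalar c + scalar d"
  by (rule single_add)

lemma scalar_mult: "scalar (c * d) = scalar c * scalar d"
  by (simp add: mult_single)

lemma scalar_scalar: "scalar c * (scalar d * p) = scalar (c * d) * p"
  by (simp add: scalar_mult mult.assoc)

lemma keys_uminus_poly [simp]: "Poly_Mapping.keys (- p) = Poly_Mapping.keys (p :: 'x \<Rightarrow>\<^sub>0 complex)"
  by (auto simp: in_keys_iff)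

lemma keys_scalar_mult: "Poly_Mapping.keys (scalar c * p) \<subseteq> Poly_Mapping.keys p"
  by (auto simp: in_keys_iff)

lemma keys_diff_subset: "Poly_Mapping.keys (p -
    q) \<subseteq> Poly_Mapping.keys p \<union> Poly_Mapping.keys (q :: 'x \<Rightarrow>\<^sub>0 complex)"
  by (auto simp: in_keys_iff lookup_minus)

definition words :: "'a set \<Rightarrow> 'a word set" where
  "words S = {w. set (letters w) \<subseteq> S}"

lemma free_algebra_simps [simp]:
  "mult (free_algebra S) = (*)" "one (free_algebra S) = 1"
  "zero (free_algebra S) = 0" "add (free_algebra S) = (+)"
  "smult (free_algebra S) = (\<lambda>c p. scalar c * p)"
  by (simp_all add: free_algebra_def)

lemma carrier_free_algebra: "p \<in> carrier (free_algebra S) \<longleftrightarrow> Poly_Mapping.keys p \<subseteq> words S"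
  by (auto simp: free_algebra_def words_def)

lemma mult_free_algebra_closed:
  assumes "p \<in> carrier (free_algebra S)" "q \<in> carrier (free_algebra S)"
  shows "p * q \<in> carrier (free_algebra S)"
  unfolding carrier_free_algebra
proof
  fix w assume "w \<in> Poly_Mapping.keys (p * q)"
  then obtain u v where "w = u + v" "u \<in> Poly_Mapping.keys p" "v \<in> Poly_Mapping.keys q"
    using keys_mult[of p q] by blast
  then show "w \<in> words S"
    using assms by (auto simp: carrier_free_algebra words_def)
qed

lemma free_algebra_closed:
  shows "p \<in> carrier (free_algebra S) \<Longrightarrow> q \<in> carrier (free_algebra S) \<Longrightarrow> p + q \<in> carrier (free_algebra S)"
    and "p \<in> carrier (free_algebra S) \<Longrightarrow> q \<in> carrier (free_algebra S) \<Longrightarrow> p * q \<in> carrier (free_algebra S)"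
    and "p \<in> carrier (free_algebra S) \<Longrightarrow> - p \<in> carrier (free_algebra S)"
    and "p \<in> carrier (free_algebra S) \<Longrightarrow> q \<in> carrier (free_algebra S) \<Longrightarrow> p - q \<in> carrier (free_algebra S)"
    and "p \<in> carrier (free_algebra S) \<Longrightarrow> scalar c * p \<in> carrier (free_algebra S)"
  using mult_free_algebra_closed keys_add[of p q] keys_diff_subset[of p q] keys_scalar_mult[of c p]
  unfolding carrier_free_algebra keys_uminus_poly by blast+

lemma zero_in_words [simp]: "0 \<in> words S"
  by (simp add: words_def)

lemma free_algebra_closed' [simp]:
  "0 \<in> carrier (free_algebra S)" "1 \<in> carrier (free_algebra S)"
  "scalar c \<in> carrier (free_algebra S)"
  "x \<in> S \<Longrightarrow> letter x \<in> carrier (free_algebra S)"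
  "Poly_Mapping.single w c \<in> carrier (free_algebra S) \<longleftrightarrow> c = 0 \<or> w \<in> words S"
  by (auto simp: carrier_free_algebra words_def letter_def)

lemma single_Cons:
  "Poly_Mapping.single (Word (x # xs)) c = letter x * Poly_Mapping.single (Word xs) c"
  by (simp add: letter_def mult_single Word_Cons[symmetric])

text \<open>Peeling off the first letter on the left matches the recursion of the Leibniz rule and
  the order in which words of operators act.\<close>

lemma free_algebra_induct [consumes 1, case_names scalar letter add]:
  assumes "p \<in> carrier (free_algebra S)"
    and "\<And>c. P (scalar c)"
    and "\<And>x p. x \<in> S \<Longrightarrow> p \<in> carrier (free_algebra S) \<Longrightarrow> P p \<Longrightarrow> P (letter x * p)"
    and "\<And>p q. p \<in> carrier (free_algebra S) \<Longrightarrow> q \<in> carrier (free_algebra S) \<Longrightarrow>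
      P p \<Longrightarrow> P q \<Longrightarrow> P (p + q)"
  shows "P p"
proof -
  have "set xs \<subseteq> S \<Longrightarrow> P (Poly_Mapping.single (Word xs) c)" for xs c
  proof (induction xs)
    case Nil
    then show ?case using assms(2) by (simp add: Word_Nil)
  next
    case (Cons x xs)
    then show ?case
      unfolding single_Cons by (intro assms(3)) (auto simp: words_def)
  qed
  then have *: "w \<in> words S \<Longrightarrow> P (Poly_Mapping.single w c)" for w c
    by (cases w) (auto simp: words_def)
  show ?thesis
    using assms(1) unfolding carrier_free_algebra
  proof (induction p rule: poly_mapping_keys_induct)
    case zero
    then show ?case using assms(2)[of 0] by simp
  next
    case (single w c)
    then show ?case by (rule *)
  next
    case (add p q)
    then show ?case by (intro assms(4)) (simp_all add: carrier_free_algebra)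
  qed
qed

section \<open>Complex algebras and their quotients by ideals\<close>

locale complex_algebra = ring A for A :: "(complex, 'a) module" (structure) +
  assumes smult_closed [simp]: "x \<in> carrier A \<Longrightarrow> c \<odot> x \<in> carrier A"
    and smult_add: "x \<in> carrier A \<Longrightarrow> y \<in> carrier A \<Longrightarrow> c \<odot> (x \<oplus> y) = c \<odot> x \<oplus> c \<odot> y"
    and smult_mult: "x \<in> carrier A \<Longrightarrow> y \<in> carrier A \<Longrightarrow> (c \<odot> x) \<otimes> y = c \<odot> (x \<otimes> y)"
begin

text \<open>Since c x = (c 1) x, a ring ideal is automatically a subspace, and the ring quotient
  inherits the scalar multiplication.\<close>

lemma smult_ideal: "ideal I A \<Longrightarrow> x \<in> I \<Longrightarrow> c \<odot> x \<in> I"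
  using ideal.I_l_closed[of I A x "c \<odot> \<one>"] by (simp add: smult_mult ideal.Icarr)

end

lemma complex_algebra_free_algebra: "complex_algebra (free_algebra S)"
proof -
  have "abelian_group (free_algebra S)"
  proof (rule abelian_groupI)
    fix x assume "x \<in> carrier (free_algebra S)"
    then show "\<exists>y\<in>carrier (free_algebra S). y \<oplus>\<^bsub>free_algebra S\<^esub> x = \<zero>\<^bsub>free_algebra S\<^esub>"
      by (intro bexI[of _ "- x"]) (auto intro: free_algebra_closed)
  qed (simp_all add: ac_simps free_algebra_closed)
  moreover have "Group.monoid (free_algebra S)"
    by (rule monoidI) (simp_all add: mult.assoc free_algebra_closed)
  ultimately have "ring (free_algebra S)"
    by (rule ringI) (simp_all add: distrib_left distrib_right)
  then show ?thesis
    by (rule complex_algebra.intro)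
      (simp add: complex_algebra_axioms_def distrib_left mult.assoc free_algebra_closed)
qed

lemma a_inv_free_algebra:
  assumes "p \<in> carrier (free_algebra S)"
  shows "a_inv (free_algebra S) p = - p"
proof -
  interpret complex_algebra "free_algebra S" by (rule complex_algebra_free_algebra)
  show ?thesis
    using assms minus_equality[of "- p" p] free_algebra_closed(3)[OF assms] by simp
qed

lemma quot_algebra_simps [simp]:
  "carrier (quot_algebra A I) = carrier (A Quot I)" "mult (quot_algebra A I) = mult (A Quot I)"
  "one (quot_algebra A I) = one (A Quot I)" "zero (quot_algebra A I) = zero (A Quot I)"
  "add (quot_algebra A I) = add (A Quot I)"
  by (simp_all add: quot_algebra_def)

text \<open>Closure under negation comes from -x = (-1) x, so for the kernels below only zero, sums
  and products have to be checked.\<close>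

lemma (in ring) ideal_if_closed:
  assumes "J \<subseteq> carrier R" "\<zero> \<in> J" "\<And>x y. x \<in> J \<Longrightarrow> y \<in> J \<Longrightarrow> x \<oplus> y \<in> J"
    and l: "\<And>x y. x \<in> J \<Longrightarrow> y \<in> carrier R \<Longrightarrow> y \<otimes> x \<in> J"
    and r: "\<And>x y. x \<in> J \<Longrightarrow> y \<in> carrier R \<Longrightarrow> x \<otimes> y \<in> J"
  shows "ideal J R"
proof (rule idealI[OF ring_axioms _ l r])
  show "subgroup J (add_monoid R)"
  proof (rule add.subgroupI)
    fix x assume x: "x \<in> J"
    then have "(\<ominus> \<one>) \<otimes> x = \<ominus> x"
      using assms(1) by (simp add: l_minus subsetD)
    then show "\<ominus> x \<in> J" using l[OF x, of "\<ominus> \<one>"] by simp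
  qed (use assms in auto)
qed

locale algebra_quotient = complex_algebra A + ideal I A
  for A :: "(complex, 'a) module" (structure) and I
begin

abbreviation "Q \<equiv> quot_algebra A I"

lemma quot_carrier: "carrier Q = (+>) I ` carrier A"
  by (auto simp: FactRing_def A_RCOSETS_def')

lemma quot_ring: "ring Q"
proof -
  interpret R: ring "A Quot I" by (rule quotient_is_ring)
  have "abelian_group Q"
  proof (rule abelian_groupI)
    fix x y assume "x \<in> carrier Q" "y \<in> carrier Q"
    then show "x \<oplus>\<^bsub>Q\<^esub> y = y \<oplus>\<^bsub>Q\<^esub> x" by (simp add: R.a_comm)
  next
    fix x assume "x \<in> carrier Q"
    then show "\<exists>y\<in>carrier Q. y \<oplus>\<^bsub>Q\<^esub> x = \<zero>\<^bsub>Q\<^esub>"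
      using R.l_neg R.a_inv_closed by auto
  qed (simp_all add: R.a_assoc)
  moreover have "Group.monoid Q"
    by (rule monoidI) (auto simp: R.m_assoc)
  ultimately show ?thesis
    by (rule ringI) (auto simp: R.l_distr R.r_distr)
qed

lemma quot_hom: "(+>) I \<in> ring_hom A Q"
  using rcos_ring_hom by (simp add: ring_hom_def)

lemma quot_add: "x \<in> carrier A \<Longrightarrow> y \<in> carrier A \<Longrightarrow> (I +> x) \<oplus>\<^bsub>Q\<^esub> (I +> y) = I +> (x \<oplus> y)"
  using quot_hom by (simp add: ring_hom_def)

lemma quot_mult: "x \<in> carrier A \<Longrightarrow> y \<in> carrier A \<Longrightarrow> (I +> x) \<otimes>\<^bsub>Q\<^esub> (I +> y) = I +> (x \<otimes> y)"
  using quot_hom by (simp add: ring_hom_def)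

lemma quot_one: "\<one>\<^bsub>Q\<^esub> = I +> \<one>"
  by (simp add: FactRing_def)

lemma quot_zero: "\<zero>\<^bsub>Q\<^esub> = I +> \<zero>"
  by (simp add: FactRing_def a_rcos_zero[OF is_ideal])

text \<open>An element of the left-hand side is i + c (j + x) with i, j in \<open>I\<close>, and c j
  lies in \<open>I\<close> again. Conversely the summand \<open>I\<close> supplies every i at the
  single representative x, which also covers c = 0.\<close>

lemma quot_smult:
  assumes x: "x \<in> carrier A"
  shows "c \<odot>\<^bsub>Q\<^esub> (I +> x) = I +> (c \<odot> x)"
proof -
  have "z \<in> I +> (c \<odot> x)" if z: "z \<in> I <+>\<^bsub>A\<^esub> ((\<lambda>x. c \<odot> x) ` (I +> x))" for z
  proof -
    obtain i j where "i \<in> I" "j \<in> I" "z = i \<oplus> c \<odot> (j \<oplus> x)"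
      using z by (auto simp: set_add_def' a_r_coset_def')
    moreover have "c \<odot> j \<in> I" using \<open>j \<in> I\<close> smult_ideal is_ideal by blast
    ultimately have "z = (i \<oplus> c \<odot> j) \<oplus> c \<odot> x" "i \<oplus> c \<odot> j \<in> I"
      using x by (auto simp: smult_add a_assoc)
    then show ?thesis by (auto simp: a_r_coset_def')
  qed
  moreover have "z \<in> I <+>\<^bsub>A\<^esub> ((\<lambda>x. c \<odot> x) ` (I +> x))" if z: "z \<in> I +> (c \<odot> x)" for z
  proof -
    obtain i where "i \<in> I" "z = i \<oplus> c \<odot> x"
      using z by (auto simp: a_r_coset_def')
    then show ?thesis
      using a_rcos_self[OF x] by (auto simp: set_add_def')
  qed
  ultimately show ?thesis
    by (auto simp: quot_algebra_def)
qed

lemma quot_complex_algebra: "complex_algebra Q"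
proof (rule complex_algebra.intro[OF quot_ring], rule complex_algebra_axioms.intro)
  show "c \<odot>\<^bsub>Q\<^esub> x \<in> carrier Q" if "x \<in> carrier Q" for x c
    using that by (auto simp only: quot_carrier quot_smult smult_closed image_iff)
  show "c \<odot>\<^bsub>Q\<^esub> (x \<oplus>\<^bsub>Q\<^esub> y) = c \<odot>\<^bsub>Q\<^esub> x \<oplus>\<^bsub>Q\<^esub> c \<odot>\<^bsub>Q\<^esub> y" if "x \<in> carrier Q" "y \<in> carrier Q" for x y c
    using that unfolding quot_carrier
    by (auto simp: quot_add quot_smult smult_add simp del: quot_algebra_simps)
  show "(c \<odot>\<^bsub>Q\<^esub> x) \<otimes>\<^bsub>Q\<^esub> y = c \<odot>\<^bsub>Q\<^esub> (x \<otimes>\<^bsub>Q\<^esub> y)" if "x \<in> carrier Q" "y \<in> carrier Q" for x y c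
    using that unfolding quot_carrier
    by (auto simp: quot_mult quot_smult smult_mult simp del: quot_algebra_simps)
qed

lemma quot_eq_iff: "x \<in> carrier A \<Longrightarrow> y \<in> carrier A \<Longrightarrow> I +> x = I +> y \<longleftrightarrow> x \<ominus> y \<in> I"
  by (metis a_rcos_module_minus a_rcos_self a_repr_independence a_subgroup local.ring_axioms)

text \<open>Serves \<open>proj_kernel_least\<close>: an ideal of the free algebra that contains all
  relators has as its image an ideal of \<open>TA\<close> that contains the generators of
  \<open>U_ideal\<close>.\<close>

lemma quot_ideal:
  assumes "ideal J A"
  shows "ideal ((+>) I ` J) Q"
proof -
  interpret Q: ring Q by (rule quot_ring)
  interpret J: ideal J A by fact
  show ?thesis
  proof (rule Q.ideal_if_closed)
    show "(+>) I ` J \<subseteq> carrier Q"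
      unfolding quot_carrier using J.a_subset by blast
    show "\<zero>\<^bsub>Q\<^esub> \<in> (+>) I ` J"
      unfolding quot_zero by simp
  next
    fix x y assume "x \<in> (+>) I ` J" "y \<in> (+>) I ` J"
    then show "x \<oplus>\<^bsub>Q\<^esub> y \<in> (+>) I ` J"
      by (auto simp: quot_add J.Icarr simp del: quot_algebra_simps)
  next
    fix x y assume "x \<in> (+>) I ` J" "y \<in> carrier Q"
    then obtain a b where "a \<in> J" "x = I +> a" "b \<in> carrier A" "y = I +> b"
      unfolding quot_carrier by auto
    then show "y \<otimes>\<^bsub>Q\<^esub> x \<in> (+>) I ` J" "x \<otimes>\<^bsub>Q\<^esub> y \<in> (+>) I ` J"
      using J.I_l_closed[of a b] J.I_r_closed[of a b]
      by (auto simp: quot_mult J.Icarr simp del: quot_algebra_simps)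
  qed
qed

lemma quot_minus:
  assumes "x \<in> carrier A" "y \<in> carrier A"
  shows "(I +> x) \<ominus>\<^bsub>Q\<^esub> (I +> y) = I +> (x \<ominus> y)"
proof -
  interpret ring_hom_ring A Q "(+>) I"
    using quot_hom quot_ring local.ring_axioms by (intro ring_hom_ringI2)
  show ?thesis using assms by (simp add: a_minus_def del: quot_algebra_simps)
qed

end

section \<open>Normal forms in the tensor algebra\<close>

text \<open>The substitution homomorphism of the universal property of the free algebra.\<close>

definition evaluate :: "('x \<Rightarrow> ('y word \<Rightarrow>\<^sub>0 complex)) \<Rightarrow> ('x word \<Rightarrow>\<^sub>0 complex) \<Rightarrow>
    ('y word \<Rightarrow>\<^sub>0 complex)" where
  "evaluate f = linear_extension (\<lambda>w c. scalar c * prod_list (map f (letters w)))"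

lemma evaluate_single: "evaluate f (Poly_Mapping.single w c) = scalar c * prod_list (map f (letters w))"
  by (simp add: evaluate_def)

lemma evaluate_add: "evaluate f (p + q) = evaluate f p + evaluate f q"
  unfolding evaluate_def
  by (rule linear_extension_add) (auto simp: scalar_add distrib_right)

lemma evaluate_0 [simp]: "evaluate f 0 = 0"
  by (simp add: evaluate_def)

lemma evaluate_uminus: "evaluate f (- p) = - evaluate f p"
  using evaluate_add[of f p "- p"] by (simp add: eq_neg_iff_add_eq_0 add.commute)

lemma evaluate_diff: "evaluate f (p - q) = evaluate f p - evaluate f q"
  using evaluate_add[of f p "- q"] by (simp add: evaluate_uminus)

lemma evaluate_mult: "evaluate f (p * q) = evaluate f p * evaluate f q"
proof -
  have "evaluate f (Poly_Mapping.single w c * q) =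
      evaluate f (Poly_Mapping.single w c) * evaluate f q" for w c
  proof -
    have "Poly_Mapping.keys q \<subseteq> UNIV" by simp
    then show ?thesis
    proof (induction q rule: poly_mapping_keys_induct)
      case (single v d)
      then show ?case
        by (simp add: mult_single evaluate_single mult.assoc)
          (simp add: scalar_left_commute[of "prod_list (map f (letters w))" d] scalar_mult mult.assoc)
    qed (auto simp: distrib_left evaluate_add)
  qed
  moreover have "Poly_Mapping.keys p \<subseteq> UNIV" by simp
  then show ?thesis
    by (induction p rule: poly_mapping_keys_induct)
      (auto simp: distrib_right evaluate_add calculation)
qed

lemma evaluate_scalar [simp]: "evaluate f (scalar c) = scalar c"
  by (simp add: evaluate_single)

lemma evaluate_letter [simp]: "evaluate f (letter x) = f x"
  by (simp add: evaluate_single letter_def)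

lemma evaluate_sum: "evaluate f (sum g A) = (\<Sum>x\<in>A. evaluate f (g x))"
  by (induction A rule: infinite_finite_induct) (auto simp: evaluate_add)

section \<open>Grading of the free algebra by word length\<close>

definition words_of_length :: "'a set \<Rightarrow> nat \<Rightarrow> 'a word set" where
  "words_of_length S r = {w \<in> words S. length (letters w) = r}"

definition homogeneous_part :: "'a set \<Rightarrow> nat \<Rightarrow> ('a word \<Rightarrow>\<^sub>0 complex) set" where
  "homogeneous_part S r = {p. Poly_Mapping.keys p \<subseteq> words_of_length S r}"

lemma homogeneous_part_closed:
  shows "p \<in> homogeneous_part S r \<Longrightarrow> q \<in> homogeneous_part S r \<Longrightarrow> p + q \<in> homogeneous_part S r"
    and "p \<in> homogeneous_part S r \<Longrightarrow> scalar c * p \<in> homogeneous_part S r"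
    and "0 \<in> homogeneous_part S r" "1 \<in> homogeneous_part S 0"
  using keys_add[of p q] keys_scalar_mult[of c p]
  unfolding homogeneous_part_def mem_Collect_eq
  by (blast, blast, simp_all add: words_of_length_def)

lemma homogeneous_part_mult:
  assumes "p \<in> homogeneous_part S r" "q \<in> homogeneous_part S r'"
  shows "p * q \<in> homogeneous_part S (r + r')"
proof -
  have "w \<in> words_of_length S (r + r')" if w: "w \<in> Poly_Mapping.keys (p * q)" for w
  proof -
    obtain u v where "w = u + v" "u \<in> Poly_Mapping.keys p" "v \<in> Poly_Mapping.keys q"
      using w keys_mult[of p q] by blast
    then show ?thesis
      using assms by (fastforce simp: homogeneous_part_def words_of_length_def words_def)
  qed
  then show ?thesis by (auto simp: homogeneous_part_def)
qed

lemma homogeneous_part_sum: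
  "(\<And>x. x \<in> A \<Longrightarrow> f x \<in> homogeneous_part S r) \<Longrightarrow> sum f A \<in> homogeneous_part S r"
  by (induction A rule: infinite_finite_induct) (auto intro: homogeneous_part_closed)

lemma homogeneous_part_letter: "x \<in> S \<Longrightarrow> letter x \<in> homogeneous_part S 1"
  by (auto simp: homogeneous_part_def words_of_length_def words_def letter_def)

lemma homogeneous_part_subset: "homogeneous_part S r \<subseteq> carrier (free_algebra S)"
  by (auto simp: homogeneous_part_def words_of_length_def carrier_free_algebra)

lemma evaluate_homogeneous:
  assumes "\<And>x. x \<in> S \<Longrightarrow> f x \<in> homogeneous_part S' 1" "p \<in> homogeneous_part S r"
  shows "evaluate f p \<in> homogeneous_part S' r"
proof -
  have *: "set xs \<subseteq> S \<Longrightarrow> prod_list (map f xs) \<in> homogeneous_part S' (length xs)" for xs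
  proof (induction xs)
    case (Cons x xs)
    then show ?case using homogeneous_part_mult[of "f x" S' 1] assms(1) by auto
  qed (simp add: homogeneous_part_closed)
  show ?thesis
    using assms(2) unfolding homogeneous_part_def mem_Collect_eq
  proof (induction p rule: poly_mapping_keys_induct)
    case (single w c)
    then have "prod_list (map f (letters w)) \<in> homogeneous_part S' r"
      using *[of "letters w"] by (auto simp: words_of_length_def words_def)
    then have "scalar c * prod_list (map f (letters w)) \<in> homogeneous_part S' r"
      by (rule homogeneous_part_closed)
    then show ?case by (simp add: homogeneous_part_def evaluate_single)
  next
    case (add p q)
    then show ?case
      using homogeneous_part_closed(1)[of "evaluate f p" S' r]
          by (simp add: homogeneous_part_def evaluate_add)
  qed simp
qed

lemma evaluate_closed:
  assumes "\<And>x. x \<in> S \<Longrightarrow> f x \<in> carrier (free_algebra S')" "p \<in> carrier (free_algebra S)"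
  shows "evaluate f p \<in> carrier (free_algebra S')"
  using assms(2)
  by (induction p rule: free_algebra_induct)
    (auto simp: evaluate_mult evaluate_add assms(1) intro: free_algebra_closed)

text \<open>A space \<open>S\<close> with finite basis \<open>e\<close> and coordinate functions
  \<open>r\<close>. The index type is separate from the ambient type: pairs of basis vectors index
  the matrix units of \<open>gl\<close>, and the vectors in \<open>B\<close> index the coordinate
  functionals of the dual.\<close>

locale coordinates =
  fixes s :: "complex \<Rightarrow> 'w::ab_group_add \<Rightarrow> 'w" and S :: "'w set"
    and C :: "'i set" and e :: "'i \<Rightarrow> 'w" and r :: "'w \<Rightarrow> 'i \<Rightarrow> complex"
  assumes finite_C: "finite C"
    and zero_S: "0 \<in> S"
    and add_S: "x \<in> S \<Longrightarrow> y \<in> S \<Longrightarrow> x + y \<in> S"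
    and scale_S: "x \<in> S \<Longrightarrow> s c x \<in> S"
    and scale_zero: "s 0 x = 0"
    and e_S: "i \<in> C \<Longrightarrow> e i \<in> S"
    and expansion: "x \<in> S \<Longrightarrow> x = (\<Sum>i\<in>C. s (r x i) (e i))"
    and r_add: "x \<in> S \<Longrightarrow> y \<in> S \<Longrightarrow> r (x + y) i = r x i + r y i"
    and r_scale: "x \<in> S \<Longrightarrow> r (s c x) i = c * r x i"
    and r_basis: "i \<in> C \<Longrightarrow> i' \<in> C \<Longrightarrow> r (e i) i' = (if i = i' then 1 else 0)"
begin

abbreviation "I \<equiv> tensor_ideal s S"
abbreviation "T \<equiv> tensor_algebra s S"
abbreviation "cls p \<equiv> I +>\<^bsub>free_algebra S\<^esub> p"
abbreviation "j \<equiv> tensor_incl s S"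

definition gens where
  "gens = {letter (x + y) - letter x - letter y | x y. x \<in> S \<and> y \<in> S} \<union>
     {letter (s c x) - scalar c * letter x | c x. x \<in> S}"

lemma I_eq: "I = Idl\<^bsub>free_algebra S\<^esub> gens"
  by (simp add: tensor_ideal_def gens_def)

lemma gens_subset: "gens \<subseteq> carrier (free_algebra S)"
  by (auto simp: gens_def add_S scale_S intro!: free_algebra_closed)

sublocale free: complex_algebra "free_algebra S"
  by (rule complex_algebra_free_algebra)

lemma ideal_I: "ideal I (free_algebra S)"
  unfolding I_eq using gens_subset by (rule free.genideal_ideal)

sublocale T: algebra_quotient "free_algebra S" I
  rewrites "quot_algebra (free_algebra S) I \<equiv> T"
  by (simp_all add: algebra_quotient_def ideal_I complex_algebra_free_algebra tensor_algebra_def)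

lemma gens_in_I: "x \<in> gens \<Longrightarrow> x \<in> I"
  using free.genideal_self[OF gens_subset] by (auto simp: I_eq)

lemma letter_add_in_I: "x \<in> S \<Longrightarrow> y \<in> S \<Longrightarrow> letter (x + y) - letter x - letter y \<in> I"
  by (rule gens_in_I) (auto simp: gens_def)

lemma letter_scale_in_I: "x \<in> S \<Longrightarrow> letter (s c x) - scalar c * letter x \<in> I"
  unfolding gens_def by (rule gens_in_I) (auto simp: gens_def)

lemma I_minimal: "ideal J (free_algebra S) \<Longrightarrow> gens \<subseteq> J \<Longrightarrow> I \<subseteq> J"
  unfolding I_eq by (rule free.genideal_minimal)

lemma I_add: "x \<in> I \<Longrightarrow> y \<in> I \<Longrightarrow> x + y \<in> I"
  using T.a_closed by simp

lemma I_mult: "x \<in> I \<Longrightarrow> y \<in> carrier (free_algebra S) \<Longrightarrow> y * x \<in> I"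
   "x \<in> I \<Longrightarrow> y \<in> carrier (free_algebra S) \<Longrightarrow> x * y \<in> I"
  using T.I_l_closed[of x y] T.I_r_closed[of x y] by simp_all

definition linear_poly :: "'w \<Rightarrow> ('i word \<Rightarrow>\<^sub>0 complex)" where
  "linear_poly x = (\<Sum>i\<in>C. scalar (r x i) * letter i)"

definition normalize :: "('w word \<Rightarrow>\<^sub>0 complex) \<Rightarrow> ('i word \<Rightarrow>\<^sub>0 complex)" where
  "normalize = evaluate linear_poly"

definition realize :: "('i word \<Rightarrow>\<^sub>0 complex) \<Rightarrow> ('w word \<Rightarrow>\<^sub>0 complex)" where
  "realize = evaluate (\<lambda>i. letter (e i))"

lemma linear_poly_homogeneous: "linear_poly x \<in> homogeneous_part C 1"
  unfolding linear_poly_def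
  by (intro homogeneous_part_sum homogeneous_part_closed homogeneous_part_letter)

lemma linear_poly_closed [simp]: "linear_poly x \<in> carrier (free_algebra C)"
  using linear_poly_homogeneous homogeneous_part_subset by blast

lemma linear_poly_add: "x \<in> S \<Longrightarrow> y \<in> S \<Longrightarrow> linear_poly (x + y) = linear_poly x + linear_poly y"
  by (simp add: linear_poly_def r_add scalar_add distrib_right sum.distrib)

lemma linear_poly_scale: "x \<in> S \<Longrightarrow> linear_poly (s c x) = scalar c * linear_poly x"
  by (simp add: linear_poly_def r_scale scalar_mult sum_distrib_left mult.assoc)

lemma linear_poly_basis: "i \<in> C \<Longrightarrow> linear_poly (e i) = letter i"
proof -
  assume i: "i \<in> C"
  have "linear_poly (e i) = (\<Sum>i'\<in>C. if i' = i then letter i else 0)"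
    unfolding linear_poly_def by (rule sum.cong) (auto simp: r_basis i)
  then show ?thesis using i finite_C by simp
qed

lemma realize_letter: "realize (letter i) = letter (e i)"
  by (simp add: realize_def)

lemma normalize_closed [simp]: "normalize p \<in> carrier (free_algebra C)"
proof -
  have "p \<in> carrier (free_algebra UNIV)" by (simp add: carrier_free_algebra words_def)
  then show ?thesis unfolding normalize_def by (intro evaluate_closed[of UNIV]) auto
qed

lemma realize_closed: "q \<in> carrier (free_algebra C) \<Longrightarrow> realize q \<in> carrier (free_algebra S)"
  unfolding realize_def by (intro evaluate_closed[of C]) (auto simp: e_S)

lemma realize_simps [simp]:
  "realize (p + q) = realize p + realize q" "realize (p * q) = realize p * realize q"
  "realize (p - q) = realize p - realize q" "realize (scalar c) = scalar c" "realize 0 = 0"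
  by (simp_all add: realize_def evaluate_add evaluate_mult evaluate_diff)

lemma normalize_simps [simp]:
  "normalize (p + q) = normalize p + normalize q" "normalize (p * q) = normalize p * normalize q"
  "normalize (p - q) = normalize p - normalize q" "normalize (scalar c) = scalar c" "normalize 0 = 0"
  "normalize (letter x) = linear_poly x"
  by (simp_all add: normalize_def evaluate_add evaluate_mult evaluate_diff)

lemma normalize_realize: "q \<in> carrier (free_algebra C) \<Longrightarrow> normalize (realize q) = q"
  by (induction q rule: free_algebra_induct)
    (auto simp: linear_poly_basis realize_letter)

text \<open>The kernel of a homomorphism is an ideal, and it contains the generators because
  \<open>linear_poly\<close> is linear on \<open>S\<close>; minimality of the generated ideal does
  the rest.\<close>

lemma normalize_I: "p \<in> I \<Longrightarrow> normalize p = 0"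
proof -
  let ?K = "{p \<in> carrier (free_algebra S). normalize p = 0}"
  have "ideal ?K (free_algebra S)"
    by (rule free.ideal_if_closed)
      (auto simp: free_algebra_closed)
  moreover have "gens \<subseteq> ?K"
    using gens_subset
    by (auto simp: gens_def linear_poly_add linear_poly_scale)
  ultimately show "p \<in> I \<Longrightarrow> normalize p = 0"
    using I_minimal by blast
qed

lemma letter_sum:
  assumes "A \<subseteq> C"
  shows "letter (\<Sum>i\<in>A. s (k i) (e i)) - (\<Sum>i\<in>A. scalar (k i) * letter (e i)) \<in> I"
proof -
  have "finite A" using assms finite_C finite_subset by blast
  then have "(\<Sum>i\<in>A. s (k i) (e i)) \<in> S \<and>
    letter (\<Sum>i\<in>A. s (k i) (e i)) - (\<Sum>i\<in>A. scalar (k i) * letter (e i)) \<in> I"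
    using assms
  proof (induction A rule: finite_induct)
    case empty
    \<comment> \<open>The empty sum is 0 = s 0 0, and the scaling relation at the scalar 0 puts
      \<open>letter 0\<close> into the ideal.\<close>
    show ?case using letter_scale_in_I[OF zero_S, of 0] by (simp add: zero_S scale_zero)
  next
    case (insert i A)
    let ?x = "s (k i) (e i)" and ?y = "\<Sum>i\<in>A. s (k i) (e i)"
    have S: "?x \<in> S" "?y \<in> S" using insert by (auto intro: scale_S e_S)
    have "letter (?x + ?y) - letter ?x - letter ?y \<in> I"
      using S by (rule letter_add_in_I)
    moreover have "letter ?x - scalar (k i) * letter (e i) \<in> I"
      using e_S insert.prems by (intro letter_scale_in_I) auto
    \<comment> \<open>Telescoping: split off one summand by additivity, pull out its coefficient,
      and treat the remaining sum by the induction hypothesis.\<close>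
    ultimately have "(letter (?x + ?y) - letter ?x - letter ?y) + (letter ?x -
        scalar (k i) * letter (e i)) +
        (letter ?y - (\<Sum>i\<in>A. scalar (k i) * letter (e i))) \<in> I"
      using insert by (intro I_add) auto
    then show ?case using insert S by (simp add: algebra_simps add_S)
  qed
  then show ?thesis ..
qed

lemma realize_normalize: "p \<in> carrier (free_algebra S) \<Longrightarrow> p - realize (normalize p) \<in> I"
proof (induction p rule: free_algebra_induct)
  case (scalar c)
  then show ?case using T.zero_closed by simp
next
  case (letter x p)
  have "realize (linear_poly x) = (\<Sum>i\<in>C. scalar (r x i) * letter (e i))"
    by (simp add: realize_def linear_poly_def evaluate_sum evaluate_mult)
  then have "letter x - realize (linear_poly x) \<in> I"
    using letter_sum[of C "r x"] expansion[OF letter.hyps(1)] by simp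
  \<comment> \<open>With x' and p' for the rewritten factors, x p - x' p' = (x - x') p + x' (p -
    p'), and a two-sided ideal absorbs both terms.\<close>
  then have "(letter x - realize (linear_poly x)) * p +
      realize (linear_poly x) * (p - realize (normalize p)) \<in> I"
    using letter by (intro I_add I_mult) (auto intro: realize_closed)
  then show ?case
    by (simp add: algebra_simps)
next
  case (add p q)
  then have "(p - realize (normalize p)) + (q - realize (normalize q)) \<in> I"
    by (intro I_add)
  then show ?case by (simp add: algebra_simps)
qed

lemma a_minus_free: "p \<in> carrier (free_algebra S) \<Longrightarrow> q \<in> carrier (free_algebra S) \<Longrightarrow>
    p \<ominus>\<^bsub>free_algebra S\<^esub> q = p - q"
  by (simp add: a_minus_def a_inv_free_algebra)

lemma cls_eq_iff:
  assumes "p \<in> carrier (free_algebra S)" "q \<in> carrier (free_algebra S)"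
  shows "cls p = cls q \<longleftrightarrow> p - q \<in> I"
  using T.quot_eq_iff[OF assms] by (simp add: a_minus_free assms)

lemma cls_eq_iff_normalize:
  assumes "p \<in> carrier (free_algebra S)" "q \<in> carrier (free_algebra S)"
  shows "cls p = cls q \<longleftrightarrow> normalize p = normalize q"
proof -
  have "normalize p = normalize q" if "p - q \<in> I"
    using normalize_I[OF that] by simp
  moreover have "p - q \<in> I" if "normalize p = normalize q"
    using realize_normalize[of "p - q"] that assms
    by (simp add: free_algebra_closed)
  ultimately show ?thesis using cls_eq_iff[OF assms] by blast
qed

definition tensor_of :: "('i word \<Rightarrow>\<^sub>0 complex) \<Rightarrow> ('w word \<Rightarrow>\<^sub>0 complex) set" where
  "tensor_of q = cls (realize q)"

definition normal_form :: "('w word \<Rightarrow>\<^sub>0 complex) set \<Rightarrow> ('i word \<Rightarrow>\<^sub>0 complex)" where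
  "normal_form = the_inv_into (carrier (free_algebra C)) tensor_of"

lemma cls_eq_tensor_of: "p \<in> carrier (free_algebra S) \<Longrightarrow> cls p = tensor_of (normalize p)"
  by (simp add: tensor_of_def cls_eq_iff_normalize normalize_realize realize_closed)

lemma tensor_of_bij: "bij_betw tensor_of (carrier (free_algebra C)) (carrier T)"
proof -
  have "inj_on tensor_of (carrier (free_algebra C))"
  proof (rule inj_onI)
    fix p q assume pq: "p \<in> carrier (free_algebra C)" "q \<in> carrier (free_algebra C)" "tensor_of p =
        tensor_of q"
    then have "normalize (realize p) = normalize (realize q)"
      unfolding tensor_of_def by (subst (asm) cls_eq_iff_normalize) (simp_all add: realize_closed)
    then show "p = q" using pq by (simp add: normalize_realize)
  qed
  moreover have "tensor_of ` carrier (free_algebra C) = carrier T"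
  proof
    show "tensor_of ` carrier (free_algebra C) \<subseteq> carrier T"
      unfolding T.quot_carrier tensor_of_def using realize_closed by blast
    show "carrier T \<subseteq> tensor_of ` carrier (free_algebra C)"
      unfolding T.quot_carrier using cls_eq_tensor_of normalize_closed by blast
  qed
  ultimately show ?thesis by (simp add: bij_betw_def)
qed

lemma tensor_of_closed: "q \<in> carrier (free_algebra C) \<Longrightarrow> tensor_of q \<in> carrier T"
  using tensor_of_bij by (auto simp: bij_betw_def)

lemma normal_form_tensor_of: "q \<in> carrier (free_algebra C) \<Longrightarrow> normal_form (tensor_of q) = q"
  using tensor_of_bij by (simp add: normal_form_def the_inv_into_f_f bij_betw_def)

lemma tensor_of_normal_form: "t \<in> carrier T \<Longrightarrow> tensor_of (normal_form t) = t"
  using tensor_of_bij f_the_inv_into_f_bij_betw[of tensor_of] by (simp add: normal_form_def)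

lemma normal_form_closed: "t \<in> carrier T \<Longrightarrow> normal_form t \<in> carrier (free_algebra C)"
  using tensor_of_bij the_inv_into_into[of tensor_of _ t]
  unfolding normal_form_def bij_betw_def by simp

lemma tensor_of_add: "p \<in> carrier (free_algebra C) \<Longrightarrow> q \<in> carrier (free_algebra C) \<Longrightarrow>
    tensor_of (p + q) = tensor_of p \<oplus>\<^bsub>T\<^esub> tensor_of q"
  unfolding tensor_of_def by (subst T.quot_add) (auto simp: realize_closed)

lemma tensor_of_mult: "p \<in> carrier (free_algebra C) \<Longrightarrow> q \<in> carrier (free_algebra C) \<Longrightarrow>
    tensor_of (p * q) = tensor_of p \<otimes>\<^bsub>T\<^esub> tensor_of q"
  unfolding tensor_of_def by (subst T.quot_mult) (auto simp: realize_closed)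

lemma tensor_of_scale: "q \<in> carrier (free_algebra C) \<Longrightarrow>
    tensor_of (scalar c * q) = c \<odot>\<^bsub>T\<^esub> tensor_of q"
  unfolding tensor_of_def by (subst T.quot_smult) (auto simp: realize_closed)

lemma tensor_of_one: "tensor_of 1 = \<one>\<^bsub>T\<^esub>"
  unfolding tensor_of_def T.quot_one by (simp flip: single_one)

lemma tensor_of_zero: "tensor_of 0 = \<zero>\<^bsub>T\<^esub>"
  unfolding tensor_of_def T.quot_zero by simp

lemma tensor_of_linear_poly: "x \<in> S \<Longrightarrow> tensor_of (linear_poly x) = j x"
  using cls_eq_tensor_of[of "letter x"] by (simp add: tensor_incl_def)

text \<open>Both \<open>normalize\<close> and \<open>realize\<close> replace a letter by a linear
  combination of letters, so they preserve word length and match the components of equal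
  degree.\<close>

lemma tensor_power_carrier:
  "carrier (tensor_power s S n) = tensor_of ` homogeneous_part C n"
proof -
  have "cls p \<in> tensor_of ` homogeneous_part C n" if "p \<in> homogeneous_part S n" for p
    using cls_eq_tensor_of[of p] that homogeneous_part_subset[of S n]
      evaluate_homogeneous[of S linear_poly C p n] linear_poly_homogeneous
    by (auto simp: normalize_def)
  moreover have "tensor_of q \<in> cls ` homogeneous_part S n" if "q \<in> homogeneous_part C n" for q
  proof -
    have "realize q \<in> homogeneous_part S n"
      unfolding realize_def using that
      by (rule evaluate_homogeneous[rotated]) (rule homogeneous_part_letter, rule e_S)
    then show ?thesis unfolding tensor_of_def by (rule imageI)
  qed
  ultimately have "cls ` homogeneous_part S n = tensor_of ` homogeneous_part C n"
    by (intro equalityI image_subsetI)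
  moreover have "carrier (tensor_power s S n) = cls ` homogeneous_part S n"
    by (auto simp: tensor_power_def homogeneous_part_def carrier_free_algebra words_of_length_def)
  ultimately show ?thesis by simp
qed

lemma tensor_power_simps [simp]:
  "add (tensor_power s S n) = add T" "zero (tensor_power s S n) = zero T"
  "smult (tensor_power s S n) = smult T"
  by (simp_all add: tensor_power_def)

end

section \<open>Matrix coefficients and adjoints\<close>

lemma commutative_factor_simps:
  assumes "commutative_factor \<omega>"
  shows "\<omega> \<alpha> \<beta> \<noteq> 0" "\<omega> \<alpha> \<beta> * \<omega> \<beta> \<alpha> = 1" "\<omega> (\<alpha> + \<beta>) \<gamma> = \<omega> \<alpha> \<gamma> * \<omega> \<beta> \<gamma>"
    "\<omega> \<alpha> (\<beta> + \<gamma>) = \<omega> \<alpha> \<beta> * \<omega> \<alpha> \<gamma>" "\<omega> 0 \<alpha> = 1" "\<omega> \<alpha> 0 = 1"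
    "\<omega> (- \<alpha>) \<beta> = inverse (\<omega> \<alpha> \<beta>)" "\<omega> \<alpha> (- \<beta>) = inverse (\<omega> \<alpha> \<beta>)"
    "\<omega> \<alpha> \<alpha> * \<omega> \<alpha> \<alpha> = 1"
proof -
  show nz: "\<omega> \<alpha> \<beta> \<noteq> 0" for \<alpha> \<beta> using assms unfolding commutative_factor_def by blast
  have eq: "\<omega> \<alpha> \<beta> = inverse (\<omega> \<beta> \<alpha>)" for \<alpha> \<beta> using assms unfolding commutative_factor_def by blast
  show inv: "\<omega> \<alpha> \<beta> * \<omega> \<beta> \<alpha> = 1" for \<alpha> \<beta>
    using left_inverse[OF nz[of \<beta> \<alpha>]] eq[of \<alpha> \<beta>] by argo
  then show "\<omega> \<alpha> \<alpha> * \<omega> \<alpha> \<alpha> = 1" .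
  show l: "\<omega> (\<alpha> + \<beta>) \<gamma> = \<omega> \<alpha> \<gamma> * \<omega> \<beta> \<gamma>" for \<alpha> \<beta> \<gamma>
    using assms unfolding commutative_factor_def by blast
  show r: "\<omega> \<alpha> (\<beta> + \<gamma>) = \<omega> \<alpha> \<beta> * \<omega> \<alpha> \<gamma>" for \<alpha> \<beta> \<gamma>
    using assms unfolding commutative_factor_def by blast
  show l0: "\<omega> 0 \<alpha> = 1" for \<alpha> using l[of 0 0 \<alpha>] nz by simp
  show r0: "\<omega> \<alpha> 0 = 1" for \<alpha> using r[of \<alpha> 0 0] nz by simp
  show "\<omega> (- \<alpha>) \<beta> = inverse (\<omega> \<alpha> \<beta>)"
    using l[of "\<alpha>" "- \<alpha>" \<beta>] by (simp add: l0 inverse_unique)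
  show "\<omega> \<alpha> (- \<beta>) = inverse (\<omega> \<alpha> \<beta>)"
    using r[of \<alpha> \<beta> "- \<beta>"] by (simp add: r0 inverse_unique)
qed

lemma ex1_unique: "\<exists>!x. P x \<Longrightarrow> P x \<Longrightarrow> P y \<Longrightarrow> x = y"
  by blast

context graded_space
begin

lemmas factor_simps = commutative_factor_simps[OF factor]

abbreviation rep :: "'v \<Rightarrow> 'v \<Rightarrow> complex" where
  "rep \<equiv> representation B"

lemma rep_add: "rep (u + v) b = rep u b + rep v b"
  by (simp add: representation_add independent_Basis span_Basis)

lemma rep_scale: "rep (c *s v) b = c * rep v b"
  by (simp add: representation_scale independent_Basis span_Basis)

lemma rep_zero [simp]: "rep 0 b = 0"
  using rep_scale[of 0 0] by simp

lemma rep_diff: "rep (u - v) b = rep u b - rep v b"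
  using rep_add[of "u - v" v] by simp

lemma rep_sum: "rep (sum f A) b = (\<Sum>x\<in>A. rep (f x) b)"
  by (induction A rule: infinite_finite_induct) (auto simp: rep_add)

lemma rep_basis: "a \<in> B \<Longrightarrow> rep a b = (if a = b then 1 else 0)"
  by (auto simp: representation_basis independent_Basis)

lemma rep_expansion: "(\<Sum>b\<in>B. rep v b *s b) = v"
  by (rule sum_representation_eq) (auto simp: independent_Basis span_Basis finite_Basis)

lemma rep_combination: "b \<in> B \<Longrightarrow> rep (\<Sum>a\<in>B. k a *s a) b = k b"
  by (simp add: rep_sum rep_scale rep_basis finite_Basis if_distrib[of "(*) _"] cong: if_cong)

lemma rep_eqI: "(\<And>b. b \<in> B \<Longrightarrow> rep u b = rep v b) \<Longrightarrow> u = v"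
  by (metis (no_types, lifting) rep_expansion sum.cong)

text \<open>Otherwise v would have two decompositions in the sense of \<open>direct_sum\<close>, one
  concentrated in degree \<alpha> and one in degree \<beta>.\<close>

lemma part_unique:
  assumes "v \<in> V \<alpha>" "v \<in> V \<beta>" "v \<noteq> 0"
  shows "\<alpha> = \<beta>"
proof -
  have *: "finite {\<gamma>. f \<gamma> \<noteq> 0} \<and> (\<forall>\<gamma>. f \<gamma> \<in> V \<gamma>) \<and> v = (\<Sum>\<gamma> | f \<gamma> \<noteq> 0. f \<gamma>)"
    if "v \<in> V \<delta>" "f = (\<lambda>\<gamma>. if \<gamma> = \<delta> then v else 0)" for \<delta> f
    using that assms(3) subspace_0[OF subspace_part] by auto
  have "(\<lambda>\<gamma>. if \<gamma> = \<alpha> then v else 0) = (\<lambda>\<gamma>. if \<gamma> = \<beta> then v else 0)"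
    using *[OF assms(1) refl] *[OF assms(2) refl] by (rule ex1_unique[OF direct_sum])
  then show ?thesis using assms(3) by (metis (full_types))
qed

lemma basis_nonzero: "b \<in> B \<Longrightarrow> b \<noteq> 0"
  using independent_Basis dependent_zero by blast

lemma basis_in_part: "b \<in> B \<Longrightarrow> b \<in> V (degree b)"
  unfolding degree_def
  by (rule theI') (use homogeneous_basis part_unique basis_nonzero in blast)

text \<open>Grouping the basis expansion of v by degree gives one homogeneous decomposition
  (\<open>g\<close>), v alone in degree \<alpha> gives another (\<open>h\<close>), and
  \<open>direct_sum\<close> forces them to agree. Questions about the grading thereby become
  conditions on coefficients.\<close>

lemma part_iff: "v \<in> V \<alpha> \<longleftrightarrow> (\<forall>b\<in>B. rep v b \<noteq> 0 \<longrightarrow> degree b = \<alpha>)"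
proof
  assume *: "\<forall>b\<in>B. rep v b \<noteq> 0 \<longrightarrow> degree b = \<alpha>"
  have "(\<Sum>b\<in>B. rep v b *s b) \<in> V \<alpha>"
  proof (rule subspace_sum[OF subspace_part])
    fix b assume "b \<in> B"
    then show "rep v b *s b \<in> V \<alpha>"
      using * basis_in_part[of b] subspace_scale[OF subspace_part] subspace_0[OF subspace_part]
      by (cases "rep v b = 0") auto
  qed
  then show "v \<in> V \<alpha>" by (simp add: rep_expansion)
next
  assume v: "v \<in> V \<alpha>"
  define g where "g \<gamma> = (\<Sum>b | b \<in> B \<and> degree b = \<gamma>. rep v b *s b)" for \<gamma>
  define h where "h \<gamma> = (if \<gamma> = \<alpha> then v else 0)" for \<gamma>
  have supp: "{\<gamma>. g \<gamma> \<noteq> 0} \<subseteq> degree ` B"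
  proof
    fix \<gamma> assume "\<gamma> \<in> {\<gamma>. g \<gamma> \<noteq> 0}"
    then obtain b where "b \<in> B" "degree b = \<gamma>"
      using sum.not_neutral_contains_not_neutral[of "\<lambda>b. rep v b *s b" "{b. b \<in> B \<and> degree b = \<gamma>}"]
      by (auto simp: g_def)
    then show "\<gamma> \<in> degree ` B" by blast
  qed
  have "v = (\<Sum>\<gamma>\<in>degree ` B. g \<gamma>)"
    unfolding g_def using sum.group[of B "degree ` B" degree "\<lambda>b. rep v b *s b"] finite_Basis
    by (simp add: rep_expansion)
  also have "\<dots> = (\<Sum>\<gamma> | g \<gamma> \<noteq> 0. g \<gamma>)"
    using supp finite_Basis by (intro sum.mono_neutral_right) auto
  finally have "finite {\<gamma>. g \<gamma> \<noteq> 0} \<and> (\<forall>\<gamma>. g \<gamma> \<in> V \<gamma>) \<and> v = (\<Sum>\<gamma> | g \<gamma> \<noteq> 0. g \<gamma>)"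
    using supp finite_Basis finite_subset basis_in_part unfolding g_def
    by (auto intro!: subspace_sum[OF subspace_part] subspace_scale[OF subspace_part])
  moreover have "finite {\<gamma>. h \<gamma> \<noteq> 0} \<and> (\<forall>\<gamma>. h \<gamma> \<in> V \<gamma>) \<and> v = (\<Sum>\<gamma> | h \<gamma> \<noteq> 0. h \<gamma>)"
    using v subspace_0[OF subspace_part] by (cases "v = 0") (auto simp: h_def)
  ultimately have gh: "g = h" by (rule ex1_unique[OF direct_sum])
  show "\<forall>b\<in>B. rep v b \<noteq> 0 \<longrightarrow> degree b = \<alpha>"
  proof (intro ballI impI, rule ccontr)
    fix b assume b: "b \<in> B" "rep v b \<noteq> 0" "degree b \<noteq> \<alpha>"
    have "rep (g (degree b)) b = (\<Sum>a | a \<in> B \<and> degree a = degree b. if a = b then rep v b else 0)"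
      unfolding g_def rep_sum by (rule sum.cong) (auto simp: rep_scale rep_basis)
    also have "\<dots> = rep v b" using b finite_Basis by (simp add: sum.delta)
    finally show False using b gh by (simp add: h_def)
  qed
qed

section \<open>Matrix coefficients and the grading of \<open>gl\<close>\<close>

definition mat :: "('v \<Rightarrow> 'v) \<Rightarrow> 'v \<Rightarrow> 'v \<Rightarrow> complex" where
  "mat X a b = rep (X b) a"

lemma glI:
  "(\<And>u v. X (u + v) = X u + X v) \<Longrightarrow> (\<And>c v. X (c *s v) = c *s X v) \<Longrightarrow> X \<in> gl"
  by (simp add: gl_def Vector_Spaces.linear_iff vector_space_axioms)

lemma gl_add: "X \<in> gl \<Longrightarrow> X (u + v) = X u + X v"
  and gl_scale: "X \<in> gl \<Longrightarrow> X (c *s v) = c *s X v"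
  by (simp_all add: gl_def Vector_Spaces.linear_iff)

lemma gl_sum: "X \<in> gl \<Longrightarrow> X (sum f A) = (\<Sum>x\<in>A. X (f x))"
  using gl_scale[of X 0 0] by (induction A rule: infinite_finite_induct) (auto simp: gl_add)

lemma gl_closed:
  shows "X \<in> gl \<Longrightarrow> Y \<in> gl \<Longrightarrow> X + Y \<in> gl"
    and "X \<in> gl \<Longrightarrow> fun_scale scale c X \<in> gl"
    and "X \<in> gl \<Longrightarrow> Y \<in> gl \<Longrightarrow> X \<circ> Y \<in> gl"
    and "X \<in> gl \<Longrightarrow> Y \<in> gl \<Longrightarrow> bracket \<alpha> \<beta> X Y \<in> gl"
    and "0 \<in> gl"
  by (auto intro!: glI simp: fun_scale_def bracket_def gl_add gl_scale scale_right_distrib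
      scale_right_diff_distrib mult.commute algebra_simps)

lemma gl_sum_closed: "(\<And>x. x \<in> A \<Longrightarrow> f x \<in> gl) \<Longrightarrow> sum f A \<in> gl"
  by (induction A rule: infinite_finite_induct) (auto simp: gl_closed)

lemma gl_apply: "X \<in> gl \<Longrightarrow> rep (X v) a = (\<Sum>b\<in>B. mat X a b * rep v b)"
  unfolding mat_def
  by (subst rep_expansion[of v, symmetric]) (simp add: gl_sum gl_scale rep_sum rep_scale mult.commute)

lemma gl_eqI:
  assumes "X \<in> gl" "Y \<in> gl" "\<And>a b. a \<in> B \<Longrightarrow> b \<in> B \<Longrightarrow> mat X a b = mat Y a b"
  shows "X = Y"
  using assms by (intro ext rep_eqI) (simp add: gl_apply)

lemma mat_simps:
  "mat (X + Y) a b = mat X a b + mat Y a b"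
  "mat (fun_scale scale c X) a b = c * mat X a b"
  "X \<in> gl \<Longrightarrow> mat (X \<circ> Y) a b = (\<Sum>c\<in>B. mat X a c * mat Y c b)"
  "mat (bracket \<alpha> \<beta> X Y) a b = mat (X \<circ> Y) a b - \<omega> \<alpha> \<beta> * mat (Y \<circ> X) a b"
  "b \<in> B \<Longrightarrow> a' \<in> B \<Longrightarrow> mat (E a' b') a b = (if a = a' \<and> b = b' then 1 else 0)"
  "mat 0 a b = 0"
  by (simp_all add: mat_def fun_scale_def rep_add rep_scale rep_diff bracket_def gl_apply[unfolded
      mat_def]
      E_def rep_basis)

lemma mat_sum: "mat (sum f A) a b = (\<Sum>x\<in>A. mat (f x) a b)"
proof -
  have "sum f A b = (\<Sum>x\<in>A. f x b)"
    by (induction A rule: infinite_finite_induct) auto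
  then show ?thesis by (simp add: mat_def rep_sum)
qed

lemma E_gl [simp]: "E a b \<in> gl"
  by (rule glI) (simp_all add: E_def rep_add rep_scale scale_left_distrib)

text \<open>For the backward direction, a nonzero coordinate of X v requires a nonzero matrix entry
  times a nonzero coordinate of v, and the degrees of these two add up.\<close>

lemma gl_part_iff:
  "X \<in> gl_part \<alpha> \<longleftrightarrow> X \<in> gl \<and> (\<forall>a\<in>B. \<forall>b\<in>B. mat X a b \<noteq> 0 \<longrightarrow> degree a = \<alpha> + degree b)"
proof (intro iffI conjI)
  assume X: "X \<in> gl_part \<alpha>"
  then show "X \<in> gl" by (simp add: gl_part_def)
  show "\<forall>a\<in>B. \<forall>b\<in>B. mat X a b \<noteq> 0 \<longrightarrow> degree a = \<alpha> + degree b"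
  proof (intro ballI impI)
    fix a b assume "a \<in> B" "b \<in> B" "mat X a b \<noteq> 0"
    moreover have "X b \<in> V (\<alpha> + degree b)"
      using X basis_in_part[OF \<open>b \<in> B\<close>] by (auto simp: gl_part_def)
    ultimately show "degree a = \<alpha> + degree b"
      by (auto simp: part_iff mat_def)
  qed
next
  assume *: "X \<in> gl \<and> (\<forall>a\<in>B. \<forall>b\<in>B. mat X a b \<noteq> 0 \<longrightarrow> degree a = \<alpha> + degree b)"
  have "X v \<in> V (\<alpha> + \<beta>)" if v: "v \<in> V \<beta>" for \<beta> v
    unfolding part_iff
  proof (intro ballI impI)
    fix a assume a: "a \<in> B" "rep (X v) a \<noteq> 0"
    then have "(\<Sum>b\<in>B. mat X a b * rep v b) \<noteq> 0" using * by (simp add: gl_apply)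
    then obtain b where "b \<in> B" "mat X a b * rep v b \<noteq> 0"
      by (rule sum.not_neutral_contains_not_neutral)
    then show "degree a = \<alpha> + \<beta>" using * v a by (auto simp: part_iff)
  qed
  then show "X \<in> gl_part \<alpha>" using * by (auto simp: gl_part_def)
qed

lemma gl_part_gl: "X \<in> gl_part \<alpha> \<Longrightarrow> X \<in> gl"
  by (simp add: gl_part_def)

lemma E_part: "a \<in> B \<Longrightarrow> b \<in> B \<Longrightarrow> E a b \<in> gl_part (degree a - degree b)"
  by (auto simp: gl_part_iff mat_simps)

lemma bracket_part: "X \<in> gl_part \<alpha> \<Longrightarrow> Y \<in> gl_part \<beta> \<Longrightarrow> bracket \<alpha> \<beta> X Y \<in> gl_part (\<alpha> + \<beta>)"
proof -
  assume X: "X \<in> gl_part \<alpha>" and Y: "Y \<in> gl_part \<beta>"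
  have "degree a = \<alpha> + \<beta> + degree b"
    if ab: "a \<in> B" "b \<in> B" and nz: "mat (X \<circ> Y) a b \<noteq> 0 \<or> mat (Y \<circ> X) a b \<noteq> 0" for a b
  proof -
    have "\<exists>c\<in>B. (mat X a c \<noteq> 0 \<and> mat Y c b \<noteq> 0) \<or> (mat Y a c \<noteq> 0 \<and> mat X c b \<noteq> 0)"
      using nz X Y by (auto simp: mat_simps gl_part_gl elim!: sum.not_neutral_contains_not_neutral)
    then show ?thesis using X Y ab by (auto simp: gl_part_iff add_ac)
  qed
  moreover have "mat (X \<circ> Y) a b \<noteq> 0 \<or> mat (Y \<circ> X) a b \<noteq> 0" if "mat (bracket \<alpha> \<beta> X Y) a b \<noteq> 0" for a b
    using that by (auto simp: mat_simps(4))
  ultimately show ?thesis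
    using X Y unfolding gl_part_iff by (auto simp: gl_closed)
qed

lemma gl_expansion:
  assumes "X \<in> gl"
  shows "X = (\<Sum>(a, b)\<in>B \<times> B. fun_scale scale (mat X a b) (E a b))"
proof (rule gl_eqI[OF assms])
  show "(\<Sum>(a, b)\<in>B \<times> B. fun_scale scale (mat X a b) (E a b)) \<in> gl"
    by (rule gl_sum_closed) (auto simp: gl_closed)
  fix a b assume ab: "a \<in> B" "b \<in> B"
  have "mat (\<Sum>(a, b)\<in>B \<times> B. fun_scale scale (mat X a b) (E a b)) a b =
      (\<Sum>x\<in>B \<times> B. if x = (a, b) then mat X a b else 0)"
    unfolding mat_sum using ab
    by (intro sum.cong) (auto simp: mat_simps split: if_splits)
  then show "mat X a b = mat (\<Sum>(a, b)\<in>B \<times> B. fun_scale scale (mat X a b) (E a b)) a b"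
    using ab finite_Basis by simp
qed

lemma gl_induct [consumes 1, case_names zero unit add]:
  assumes X: "X \<in> gl" and "P 0"
    and "\<And>a b c. a \<in> B \<Longrightarrow> b \<in> B \<Longrightarrow> P (fun_scale scale c (E a b))"
    and "\<And>X Y. X \<in> gl \<Longrightarrow> Y \<in> gl \<Longrightarrow> P X \<Longrightarrow> P Y \<Longrightarrow> P (X + Y)"
  shows "P X"
proof -
  have "finite A \<Longrightarrow> A \<subseteq> B \<times> B \<Longrightarrow>
      (\<Sum>(a, b)\<in>A. fun_scale scale (mat X a b) (E a b)) \<in> gl \<and>
      P (\<Sum>(a, b)\<in>A. fun_scale scale (mat X a b) (E a b))" for A
    by (induction A rule: finite_induct) (auto simp: assms gl_closed)
  from this[of "B \<times> B"] show ?thesis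
    using finite_Basis gl_expansion[OF X] by simp
qed

lemma gl_part_scale: "X \<in> gl_part \<alpha> \<Longrightarrow> fun_scale scale c X \<in> gl_part \<alpha>"
  by (auto simp: gl_part_iff mat_simps gl_closed)

text \<open>Every matrix is a sum of multiples of homogeneous matrix units. This is why a formula
  given for homogeneous X pins down an additive extension to all of \<open>gl\<close>.\<close>

lemma gl_part_induct [consumes 1, case_names part add]:
  assumes "X \<in> gl"
    and part: "\<And>\<alpha> X. X \<in> gl_part \<alpha> \<Longrightarrow> P X"
    and "\<And>X Y. X \<in> gl \<Longrightarrow> Y \<in> gl \<Longrightarrow> P X \<Longrightarrow> P Y \<Longrightarrow> P (X + Y)"
  shows "P X"
  using assms(1)
proof (induction X rule: gl_induct)
  case zero
  have "(0 :: 'v \<Rightarrow> 'v) \<in> gl_part 0" by (auto simp: gl_part_iff gl_closed(5) mat_simps(6))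
  then have "P 0" by (rule part)
  then show ?case .
next
  case (unit a b c)
  then have "fun_scale scale c (E a b) \<in> gl_part (degree a - degree b)"
    by (intro gl_part_scale E_part)
  then have "P (fun_scale scale c (E a b))" by (rule part)
  then show ?case .
next
  case (add X Y)
  then have "P (X + Y)" by (intro assms(3))
  then show ?case .
qed

text \<open>The signs \<open>s\<close> are all 1 for the type I star structure and \<open>\<omega> \<gamma>\<^sub>a \<gamma>\<^sub>a\<close> for type II.\<close>

definition adj :: "('v \<Rightarrow> complex) \<Rightarrow> ('v \<Rightarrow> 'v) \<Rightarrow> ('v \<Rightarrow> 'v)" where
  "adj s X = (\<lambda>v. \<Sum>b\<in>B. (\<Sum>a\<in>B. s a * s b * cnj (mat X a b) * rep v a) *s b)"

text \<open>With D = diag(s), \<open>adj s X\<close> is the conjugate transpose of X conjugated by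
  D. Values 1 and -1 make D a real matrix with D D = 1, hence \<open>adj s\<close> an involution
  that reverses products.\<close>

definition sign_function :: "('v \<Rightarrow> complex) \<Rightarrow> bool" where
  "sign_function s \<longleftrightarrow> (\<forall>b. s b * s b = 1 \<and> cnj (s b) = s b)"

lemma adj_gl [simp]: "adj s X \<in> gl"
  by (rule glI)
    (simp_all add: adj_def rep_add rep_scale distrib_left sum.distrib scale_left_distrib
      scale_sum_right sum_distrib_left mult_ac)

lemma mat_adj: "a \<in> B \<Longrightarrow> b \<in> B \<Longrightarrow> mat (adj s X) b a = s a * s b * cnj (mat X a b)"
proof -
  assume ab: "a \<in> B" "b \<in> B"
  then have "rep (adj s X a) b = (\<Sum>a'\<in>B. if a' = a then s a * s b * cnj (mat X a b) else 0)"
    unfolding adj_def rep_combination[OF ab(2)] by (intro sum.cong) (auto simp: rep_basis)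
  then show ?thesis using ab finite_Basis by (simp add: mat_def)
qed

lemma adj_add: "adj s (X + Y) = adj s X + adj s Y"
  by (rule gl_eqI) (auto simp: gl_closed mat_adj mat_simps algebra_simps)

lemma adj_scale: "adj s (fun_scale scale c X) = fun_scale scale (cnj c) (adj s X)"
  by (rule gl_eqI) (auto simp: gl_closed mat_adj mat_simps algebra_simps)

lemma adj_E: "a \<in> B \<Longrightarrow> b \<in> B \<Longrightarrow> adj s (E a b) = fun_scale scale (s a * s b) (E b a)"
  by (rule gl_eqI) (auto simp: gl_closed mat_adj mat_simps algebra_simps)

lemma adj_part:
  assumes "X \<in> gl_part \<alpha>"
  shows "adj s X \<in> gl_part (- \<alpha>)"
  using assms by (auto simp: gl_part_iff mat_adj)

lemma adj_adj:
  assumes "sign_function s" "X \<in> gl"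
  shows "adj s (adj s X) = X"
proof (rule gl_eqI)
  fix a b assume "a \<in> B" "b \<in> B"
  then have "mat (adj s (adj s X)) a b = s b * s a * (s a * s b * mat X a b)"
    using assms by (simp add: mat_adj sign_function_def)
  also have "\<dots> = (s a * s a) * (s b * s b) * mat X a b"
    by (simp only: mult_ac)
  finally show "mat (adj s (adj s X)) a b = mat X a b"
    using assms by (simp add: sign_function_def)
qed (use assms in auto)

text \<open>The summation index c carries a sign from each factor, and s c * s c = 1.\<close>

lemma mat_adj_comp:
  assumes "sign_function s" "X \<in> gl" "Y \<in> gl" "a \<in> B" "b \<in> B"
  shows "mat (adj s Y \<circ> adj s X) b a = s a * s b * cnj (mat (X \<circ> Y) a b)"
proof -
  have "mat (adj s Y \<circ> adj s X) b a = (\<Sum>c\<in>B. (s c * s c) * (s a * s b * cnj (mat X a c * mat Y c b)))"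
    using assms by (simp add: mat_simps mat_adj mult_ac)
  also have "\<dots> = s a * s b * cnj (mat (X \<circ> Y) a b)"
    using assms by (simp add: sign_function_def mat_simps sum_distrib_left)
  finally show ?thesis .
qed

text \<open>On the unit circle conjugation is inversion, and inverting \<omega> swaps its arguments.
  The two minus signs cancel each other; they are written because adjoints of homogeneous maps of
  degrees \<alpha> and \<beta> have degrees - \<alpha> and - \<beta>.\<close>

lemma cnj_factor:
  assumes "cmod (\<omega> \<alpha> \<beta>) = 1"
  shows "cnj (\<omega> \<alpha> \<beta>) = \<omega> (- \<beta>) (- \<alpha>)"
proof -
  have "\<omega> \<alpha> \<beta> * cnj (\<omega> \<alpha> \<beta>) = 1"
    using assms complex_norm_square[of "\<omega> \<alpha> \<beta>"] by simp
  then have "inverse (\<omega> \<alpha> \<beta>) = cnj (\<omega> \<alpha> \<beta>)" by (rule inverse_unique)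
  then show ?thesis
    using inverse_unique[OF factor_simps(2)[of \<beta> \<alpha>]] by (simp add: factor_simps)
qed

text \<open>The adjoint turns X Y into the product of the adjoints of Y and X, and by
  \<open>cnj_factor\<close> the conjugated coefficient of the other product is exactly the factor of
  the reversed bracket.\<close>

lemma adj_bracket:
  assumes "sign_function s" "X \<in> gl" "Y \<in> gl" "\<And>\<alpha> \<beta>. cmod (\<omega> \<alpha> \<beta>) = 1"
  shows "adj s (bracket \<alpha> \<beta> X Y) = bracket (- \<beta>) (- \<alpha>) (adj s Y) (adj s X)"
  using assms
  by (intro gl_eqI) (auto simp: gl_closed mat_adj mat_simps(4) mat_adj_comp cnj_factor algebra_simps)

end

section \<open>The enveloping algebra\<close>

text \<open>The lift of a star structure to the free algebra: conjugate-linear, product-reversing,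
  and given by \<open>f\<close> on letters.\<close>

definition star_poly :: "('x \<Rightarrow> 'x) \<Rightarrow> ('x word \<Rightarrow>\<^sub>0 complex) \<Rightarrow> ('x word \<Rightarrow>\<^sub>0 complex)" where
  "star_poly f = linear_extension (\<lambda>w c. Poly_Mapping.single (Word (rev (map f (letters w)))) (cnj c))"

lemma star_poly_single:
  "star_poly f (Poly_Mapping.single w c) = Poly_Mapping.single (Word (rev (map f (letters w)))) (cnj c)"
  by (simp add: star_poly_def)

lemma star_poly_add: "star_poly f (p + q) = star_poly f p + star_poly f q"
  unfolding star_poly_def by (rule linear_extension_add) (auto simp: single_add)

lemma star_poly_0 [simp]: "star_poly f 0 = 0"
  by (simp add: star_poly_def)

lemma star_poly_uminus: "star_poly f (- p) = - star_poly f p"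
  using star_poly_add[of f p "- p"] by (simp add: eq_neg_iff_add_eq_0 add.commute)

lemma star_poly_diff: "star_poly f (p - q) = star_poly f p - star_poly f q"
  using star_poly_add[of f p "- q"] by (simp add: star_poly_uminus)

lemma star_poly_mult: "star_poly f (p * q) = star_poly f q * star_poly f p"
proof -
  have "star_poly f (Poly_Mapping.single w c * q) =
      star_poly f q * star_poly f (Poly_Mapping.single w c)" for w c
  proof -
    have "Poly_Mapping.keys q \<subseteq> UNIV" by simp
    then show ?thesis
      by (induction q rule: poly_mapping_keys_induct)
        (auto simp: distrib_left distrib_right star_poly_add mult_single star_poly_single plus_word_def
          mult.commute)
  qed
  moreover have "Poly_Mapping.keys p \<subseteq> UNIV" by simp
  then show ?thesis
    by (induction p rule: poly_mapping_keys_induct)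
      (auto simp: distrib_left distrib_right star_poly_add calculation)
qed

lemma star_poly_scalar [simp]: "star_poly f (scalar c) = scalar (cnj c)"
  by (simp add: star_poly_single Word_Nil)

lemma star_poly_letter [simp]: "star_poly f (letter x) = letter (f x)"
  by (simp add: star_poly_single letter_def)

lemma star_poly_closed:
  assumes "\<And>x. x \<in> S \<Longrightarrow> f x \<in> S" "p \<in> carrier (free_algebra S)"
  shows "star_poly f p \<in> carrier (free_algebra S)"
  using assms(2)
  by (induction p rule: free_algebra_induct)
    (auto simp: star_poly_mult star_poly_add assms(1) intro: free_algebra_closed)

lemma star_poly_star_poly:
  assumes "\<And>x. x \<in> S \<Longrightarrow> f (f x) = x" "p \<in> carrier (free_algebra S)"
  shows "star_poly f (star_poly f p) = p"
  using assms(2)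
  by (induction p rule: free_algebra_induct)
    (auto simp: star_poly_mult star_poly_add assms(1))

context graded_space
begin

sublocale GL: coordinates "fun_scale scale" gl "B \<times> B" "\<lambda>(a, b). E a b" "\<lambda>X (a, b). mat X a b"
proof
  fix X :: "'v \<Rightarrow> 'v" assume "X \<in> gl"
  then show "X = (\<Sum>i\<in>B \<times> B. fun_scale scale (case i of (a, b) \<Rightarrow> mat X a b) (case i of (a, b) \<Rightarrow> E a b))"
    using gl_expansion by (simp add: case_prod_beta)
next
  show "fun_scale scale 0 X = 0" for X :: "'v \<Rightarrow> 'v"
    by (simp add: fun_scale_def fun_eq_iff)
qed (auto simp: finite_Basis gl_closed mat_simps split: if_splits)

abbreviation "F \<equiv> free_algebra gl"

definition "U_gens = {((\<iota> X \<otimes>\<^bsub>TA\<^esub> \<iota> Y) \<ominus>\<^bsub>TA\<^esub> (\<omega> \<alpha> \<beta> \<odot>\<^bsub>TA\<^esub> (\<iota> Y \<otimes>\<^bsub>TA\<^esub> \<iota> X))) \<ominus>\<^bsub>TA\<^esub> \<iota> (bracket \<alpha> \<beta> X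
    Y) | X Y \<alpha> \<beta>.
       X \<in> gl_part \<alpha> \<and> Y \<in> gl_part \<beta>}"

text \<open>The defining relation of the enveloping algebra, lifted to the free algebra so that the
  relations of both quotients can be checked on the same level.\<close>

definition relator :: "'g \<Rightarrow> 'g \<Rightarrow> ('v \<Rightarrow> 'v) \<Rightarrow> ('v \<Rightarrow> 'v) \<Rightarrow> (('v \<Rightarrow> 'v) word \<Rightarrow>\<^sub>0 complex)" where
  "relator \<alpha> \<beta> X Y =
      letter X * letter Y - scalar (\<omega> \<alpha> \<beta>) * (letter Y * letter X) - letter (bracket \<alpha> \<beta> X Y)"

lemma U_ideal_eq: "U_ideal = Idl\<^bsub>TA\<^esub> U_gens"
  by (simp add: U_ideal_def U_gens_def)

lemma relator_closed: "X \<in> gl \<Longrightarrow> Y \<in> gl \<Longrightarrow> relator \<alpha> \<beta> X Y \<in> carrier F"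
  by (auto simp: relator_def gl_closed intro!: free_algebra_closed)

lemma cls_relator:
  assumes "X \<in> gl" "Y \<in> gl"
  shows "((\<iota> X \<otimes>\<^bsub>TA\<^esub> \<iota> Y) \<ominus>\<^bsub>TA\<^esub> (\<omega> \<alpha> \<beta> \<odot>\<^bsub>TA\<^esub> (\<iota> Y \<otimes>\<^bsub>TA\<^esub> \<iota> X))) \<ominus>\<^bsub>TA\<^esub> \<iota> (bracket \<alpha> \<beta> X Y) =
    GL.cls (relator \<alpha> \<beta> X Y)"
proof -
  have [simp]: "letter X * letter Y \<in> carrier F" "letter Y * letter X \<in> carrier F"
      "scalar (\<omega> \<alpha> \<beta>) * (letter Y * letter X) \<in> carrier F" "letter X \<in> carrier F" "letter Y \<in> carrier F"
      "letter (bracket \<alpha> \<beta> X Y) \<in> carrier F"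
      "letter X * letter Y - scalar (\<omega> \<alpha> \<beta>) * (letter Y * letter X) \<in> carrier F"
    using assms by (auto intro!: free_algebra_closed simp: gl_closed)
  show ?thesis
    unfolding tensor_incl_def relator_def
    by (simp add: GL.T.quot_mult GL.T.quot_smult GL.T.quot_minus GL.a_minus_free)
qed

lemma U_gens_eq: "U_gens = {GL.cls (relator \<alpha> \<beta> X Y) | X Y \<alpha> \<beta>. X \<in> gl_part \<alpha> \<and> Y \<in> gl_part \<beta>}"
  unfolding U_gens_def
  by (intro Collect_cong ex_cong1) (auto simp: cls_relator[OF gl_part_gl gl_part_gl])

sublocale TA: complex_algebra TA
  by (rule GL.T.quot_complex_algebra)

lemma U_gens_subset: "U_gens \<subseteq> carrier TA"
  unfolding U_gens_eq GL.T.quot_carrier using relator_closed gl_part_gl by blast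

lemma ideal_U: "ideal U_ideal TA"
  unfolding U_ideal_eq using U_gens_subset by (rule TA.genideal_ideal)

sublocale UQ: algebra_quotient TA U_ideal
  rewrites "quot_algebra TA U_ideal \<equiv> U"
  by (simp_all add: algebra_quotient_def ideal_U GL.T.quot_complex_algebra U_def)

section \<open>The composite projection of the free algebra onto \<open>U\<close>\<close>

definition proj :: "(('v \<Rightarrow> 'v) word \<Rightarrow>\<^sub>0 complex) \<Rightarrow> (('v \<Rightarrow> 'v) word \<Rightarrow>\<^sub>0 complex) set set" where
  "proj p = U_ideal +>\<^bsub>TA\<^esub> GL.cls p"

lemma cls_closed: "p \<in> carrier F \<Longrightarrow> GL.cls p \<in> carrier TA"
  unfolding GL.T.quot_carrier by blast

lemma carrier_U: "carrier U = proj ` carrier F"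
  unfolding UQ.quot_carrier GL.T.quot_carrier proj_def image_image ..

lemma proj_closed: "p \<in> carrier F \<Longrightarrow> proj p \<in> carrier U"
  unfolding carrier_U by blast

lemma proj_add: "p \<in> carrier F \<Longrightarrow> q \<in> carrier F \<Longrightarrow> proj (p + q) = proj p \<oplus>\<^bsub>U\<^esub> proj q"
  unfolding proj_def by (subst UQ.quot_add) (simp_all add: cls_closed GL.T.quot_add)

lemma proj_mult: "p \<in> carrier F \<Longrightarrow> q \<in> carrier F \<Longrightarrow> proj (p * q) = proj p \<otimes>\<^bsub>U\<^esub> proj q"
  unfolding proj_def by (subst UQ.quot_mult) (simp_all add: cls_closed GL.T.quot_mult)

lemma proj_scale: "p \<in> carrier F \<Longrightarrow> proj (scalar c * p) = c \<odot>\<^bsub>U\<^esub> proj p"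
  unfolding proj_def by (subst UQ.quot_smult) (simp_all add: cls_closed GL.T.quot_smult)

lemma proj_one: "proj 1 = \<one>\<^bsub>U\<^esub>"
  unfolding proj_def UQ.quot_one GL.T.quot_one by simp

lemma proj_zero: "proj 0 = \<zero>\<^bsub>U\<^esub>"
  unfolding proj_def UQ.quot_zero GL.T.quot_zero by simp

lemma proj_letter: "proj (letter X) = U_incl X"
  by (simp add: proj_def U_incl_def tensor_incl_def)

lemma proj_eq_iff_diff:
  assumes "p \<in> carrier F" "q \<in> carrier F"
  shows "proj p = proj q \<longleftrightarrow> GL.cls (p - q) \<in> U_ideal"
  unfolding proj_def
  by (subst UQ.quot_eq_iff) (simp_all add: assms cls_closed GL.T.quot_minus GL.a_minus_free)

lemma proj_relator:
  assumes "X \<in> gl_part \<alpha>" "Y \<in> gl_part \<beta>"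
  shows "proj (relator \<alpha> \<beta> X Y) = proj 0"
proof -
  have "GL.cls (relator \<alpha> \<beta> X Y) \<in> U_gens" unfolding U_gens_eq using assms by blast
  then have "GL.cls (relator \<alpha> \<beta> X Y) \<in> U_ideal"
    unfolding U_ideal_eq using TA.genideal_self[OF U_gens_subset] by blast
  then show ?thesis
    using assms by (subst proj_eq_iff_diff) (auto simp: relator_closed gl_part_gl)
qed

lemma proj_gens: "g \<in> GL.gens \<Longrightarrow> proj g = proj 0"
proof -
  assume "g \<in> GL.gens"
  then have "GL.cls g = GL.cls 0"
    using GL.gens_in_I[of g] GL.gens_subset by (subst GL.cls_eq_iff) auto
  then show ?thesis by (simp add: proj_def)
qed

text \<open>Maps out of \<open>U\<close> are defined on words of letters in \<open>gl\<close>; the following says what has to be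
  checked for them to descend.\<close>

lemma proj_kernel_least:
  assumes J: "ideal J F" and "GL.gens \<subseteq> J"
    and rel: "\<And>\<alpha> \<beta> X Y. X \<in> gl_part \<alpha> \<Longrightarrow> Y \<in> gl_part \<beta> \<Longrightarrow> relator \<alpha> \<beta> X Y \<in> J"
    and pq: "p \<in> carrier F" "q \<in> carrier F" "proj p = proj q"
  shows "p - q \<in> J"
proof -
  interpret J: ideal J F by fact
  have IJ: "GL.I \<subseteq> J" using assms(1,2) by (rule GL.I_minimal)
  \<comment> \<open>\<open>U_ideal\<close> lies in the image of \<open>J\<close>, so p - q agrees
    with some k in \<open>J\<close> up to an element of the tensor ideal, which itself lies in
    \<open>J\<close>.\<close>
  have "U_gens \<subseteq> GL.cls ` J" unfolding U_gens_eq using rel by blast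
  then have "U_ideal \<subseteq> GL.cls ` J"
    unfolding U_ideal_eq by (rule TA.genideal_minimal[OF GL.T.quot_ideal[OF J]])
  moreover have "GL.cls (p - q) \<in> U_ideal"
    using pq proj_eq_iff_diff by blast
  ultimately obtain k where k: "k \<in> J" "GL.cls (p - q) = GL.cls k" by blast
  have kF: "k \<in> carrier F" using k(1) by (rule J.Icarr)
  have "p - q - k \<in> J"
    using k(2) IJ GL.cls_eq_iff[OF free_algebra_closed(4)[OF pq(1,2)] kF] by blast
  then have "p - q - k + k \<in> J" using J.a_closed[of "p - q - k" k] k(1) by simp
  then show ?thesis by simp
qed

lemma U_induct [consumes 1, case_names scalar letter add]:
  assumes "x \<in> carrier U"
    and "\<And>c. P (c \<odot>\<^bsub>U\<^esub> \<one>\<^bsub>U\<^esub>)"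
    and "\<And>X x. X \<in> gl \<Longrightarrow> x \<in> carrier U \<Longrightarrow> P x \<Longrightarrow> P (U_incl X \<otimes>\<^bsub>U\<^esub> x)"
    and "\<And>x y. x \<in> carrier U \<Longrightarrow> y \<in> carrier U \<Longrightarrow> P x \<Longrightarrow> P y \<Longrightarrow> P (x \<oplus>\<^bsub>U\<^esub> y)"
  shows "P x"
proof -
  obtain p where p: "p \<in> carrier F" "x = proj p" using assms(1) by (auto simp: carrier_U)
  from p(1) have "P (proj p)"
  proof (induction p rule: free_algebra_induct)
    case (scalar c)
    then show ?case using assms(2)[of c] proj_scale[of 1 c] by (simp add: proj_one)
  next
    case (letter X p)
    then show ?case using assms(3)[of X "proj p"] by (simp add: proj_mult proj_letter proj_closed)
  next
    case (add p q)
    then show ?case using assms(4)[of "proj p" "proj q"] by (simp add: proj_add proj_closed)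
  qed
  then show ?thesis using p by simp
qed

lemma U_scale_zero: "x \<in> carrier U \<Longrightarrow> 0 \<odot>\<^bsub>U\<^esub> x = \<zero>\<^bsub>U\<^esub>"
  using proj_scale[of _ 0] by (auto simp: carrier_U proj_zero)

lemma U_incl_closed: "X \<in> gl \<Longrightarrow> U_incl X \<in> carrier U"
  using proj_closed[of "letter X"] by (simp add: proj_letter)

lemma U_incl_add: "X \<in> gl \<Longrightarrow> Y \<in> gl \<Longrightarrow> U_incl (X + Y) = U_incl X \<oplus>\<^bsub>U\<^esub> U_incl Y"
proof -
  assume X: "X \<in> gl" and Y: "Y \<in> gl"
  have "GL.cls (letter (X + Y)) = GL.cls (letter X + letter Y)"
    using GL.letter_add_in_I[OF X Y] X Y
    by (subst GL.cls_eq_iff) (auto simp: gl_closed diff_diff_add intro: free_algebra_closed)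
  then have "proj (letter (X + Y)) = proj (letter X + letter Y)" by (simp add: proj_def)
  then show ?thesis using X Y by (simp add: proj_add proj_letter)
qed

lemma U_incl_scale: "X \<in> gl \<Longrightarrow> U_incl (fun_scale scale c X) = c \<odot>\<^bsub>U\<^esub> U_incl X"
proof -
  assume X: "X \<in> gl"
  have "GL.cls (letter (fun_scale scale c X)) = GL.cls (scalar c * letter X)"
    using GL.letter_scale_in_I[OF X] X
    by (subst GL.cls_eq_iff) (auto simp: gl_closed intro: free_algebra_closed)
  then have "proj (letter (fun_scale scale c X)) = proj (scalar c * letter X)" by (simp add: proj_def)
  then show ?thesis using X by (simp add: proj_scale proj_letter)
qed

subsection \<open>The star structures\<close>

text \<open>An arbitrary lift to the free algebra; \<open>proj_star_cong\<close> and
  \<open>A_cong\<close> show that the maps built from it do not depend on the choice.\<close>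

definition representative where
  "representative x = (SOME p. p \<in> carrier F \<and> proj p = x)"

lemma representative: "x \<in> carrier U \<Longrightarrow> representative x \<in> carrier F \<and> proj (representative x) = x"
  unfolding representative_def by (rule someI_ex) (auto simp: carrier_U)

text \<open>Restricted to the carrier because \<open>star_structure\<close> asks for an extensional
  function, without which the description of the star could not be unique.\<close>

definition star :: "('v \<Rightarrow> complex) \<Rightarrow> (('v \<Rightarrow> 'v) word \<Rightarrow>\<^sub>0 complex) set set \<Rightarrow> (('v \<Rightarrow>
    'v) word \<Rightarrow>\<^sub>0 complex) set set" where
  "star s = restrict (\<lambda>x. proj (star_poly (adj s) (representative x))) (carrier U)"

lemma star_closed_poly: "p \<in> carrier F \<Longrightarrow> star_poly (adj s) p \<in> carrier F"
  by (rule star_poly_closed) auto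

lemma ideal_proj_star: "ideal {p \<in> carrier F. proj (star_poly (adj s) p) = proj 0} F"
proof (rule GL.free.ideal_if_closed)
  note z = proj_zero
  interpret U: complex_algebra U by (rule UQ.quot_complex_algebra)
  let ?K = "{p \<in> carrier F. proj (star_poly (adj s) p) = proj 0}"
  show "?K \<subseteq> carrier F" by blast
  show "\<zero>\<^bsub>F\<^esub> \<in> ?K" by simp
  fix p q
  show "p \<in> ?K \<Longrightarrow> q \<in> ?K \<Longrightarrow> p \<oplus>\<^bsub>F\<^esub> q \<in> ?K"
    by (auto simp: star_poly_add proj_add z star_closed_poly free_algebra_closed)
  show "p \<in> ?K \<Longrightarrow> q \<in> carrier F \<Longrightarrow> q \<otimes>\<^bsub>F\<^esub> p \<in> ?K"
    "p \<in> ?K \<Longrightarrow> q \<in> carrier F \<Longrightarrow> p \<otimes>\<^bsub>F\<^esub> q \<in> ?K"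
    by (auto simp: star_poly_mult proj_mult z star_closed_poly free_algebra_closed proj_closed)
qed

end

locale unitary_graded_space = graded_space scale B \<omega> V
  for scale :: "complex \<Rightarrow> 'v::ab_group_add \<Rightarrow> 'v" (infixr \<open>*s\<close> 75)
    and B :: "'v set" and \<omega> :: "'g::ab_group_add \<Rightarrow> 'g \<Rightarrow> complex" and V :: "'g \<Rightarrow> 'v set" +
  fixes sg :: "'v \<Rightarrow> complex"
  assumes unimodular: "cmod (\<omega> \<alpha> \<beta>) = 1"
    and sign: "sign_function sg"
begin

text \<open>By \<open>proj_kernel_least\<close> it is enough to look at generators.
  Conjugate-linearity of \<open>adj\<close> sends linear relations to linear relations, and
  \<open>adj_bracket\<close> sends the relator of X, Y to the relator of the adjoints in the
  opposite order.\<close>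

lemma proj_star_cong:
  assumes "p \<in> carrier F" "q \<in> carrier F" "proj p = proj q"
  shows "proj (star_poly (adj sg) p) = proj (star_poly (adj sg) q)"
proof -
  let ?J = "{p \<in> carrier F. proj (star_poly (adj sg) p) = proj 0}"
  have "p - q \<in> ?J"
  proof (rule proj_kernel_least[OF ideal_proj_star _ _ assms])
    show "GL.gens \<subseteq> ?J"
    proof
      fix g assume g: "g \<in> GL.gens"
      then consider x y where "x \<in> gl" "y \<in> gl" "g = letter (x + y) - letter x - letter y"
        | c x where "x \<in> gl" "g = letter (fun_scale scale c x) - scalar c * letter x"
        unfolding GL.gens_def by blast
      then have "star_poly (adj sg) g \<in> GL.gens"
      proof cases
        case 1
        then have "star_poly (adj sg) g =
            letter (adj sg x + adj sg y) - letter (adj sg x) - letter (adj sg y)"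
          by (simp add: star_poly_diff adj_add)
        then show ?thesis unfolding GL.gens_def using adj_gl by blast
      next
        case 2
        then have "star_poly (adj sg) g =
            letter (fun_scale scale (cnj c) (adj sg x)) - scalar (cnj c) * letter (adj sg x)"
          by (simp add: star_poly_diff star_poly_mult adj_scale scalar_commute)
        then show ?thesis unfolding GL.gens_def using adj_gl by blast
      qed
      then show "g \<in> ?J" using g GL.gens_subset proj_gens by auto
    qed
    fix \<alpha> \<beta> X Y assume XY: "X \<in> gl_part \<alpha>" "Y \<in> gl_part \<beta>"
    then have "star_poly (adj sg) (relator \<alpha> \<beta> X Y) = relator (- \<beta>) (- \<alpha>) (adj sg Y) (adj sg X)"
      using sign unimodular
      by (simp add: relator_def star_poly_diff star_poly_mult adj_bracket gl_part_gl
          scalar_commute cnj_factor)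
    then show "relator \<alpha> \<beta> X Y \<in> ?J"
      using XY proj_relator[OF adj_part adj_part] by (auto simp: relator_closed gl_part_gl)
  qed
  then have "GL.cls (star_poly (adj sg) (p - q)) \<in> U_ideal"
    using proj_eq_iff_diff[of "star_poly (adj sg) (p - q)" 0] by (simp add: star_closed_poly)
  then show ?thesis
    using assms by (subst proj_eq_iff_diff) (auto simp: star_closed_poly star_poly_diff)
qed

lemma star_proj: "p \<in> carrier F \<Longrightarrow> star sg (proj p) = proj (star_poly (adj sg) p)"
proof -
  assume p: "p \<in> carrier F"
  then have "proj (star_poly (adj sg) (representative (proj p))) = proj (star_poly (adj sg) p)"
    using representative[OF proj_closed[OF p]] by (intro proj_star_cong) simp_all
  then show ?thesis unfolding star_def using p by (simp add: proj_closed)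
qed

lemma star_structure_star: "star_structure U (star sg)"
  unfolding star_structure_def
proof (intro conjI allI ballI)
  show "star sg \<in> carrier U \<rightarrow>\<^sub>E carrier U"
  proof (rule PiE_I)
    show "star sg x \<in> carrier U" if "x \<in> carrier U" for x
      using that by (auto simp: carrier_U star_proj star_closed_poly)
    show "star sg x = undefined" if "x \<notin> carrier U" for x
      using that by (simp add: star_def)
  qed
qed (auto simp: carrier_U star_proj star_closed_poly free_algebra_closed star_poly_add star_poly_mult
    star_poly_star_poly[of gl] adj_adj sign scalar_commute
    simp flip: proj_add proj_mult proj_scale)

lemma star_E: "a \<in> B \<Longrightarrow> b \<in> B \<Longrightarrow> star sg (U_incl (E a b)) = (sg a * sg b) \<odot>\<^bsub>U\<^esub> U_incl (E b a)"
  using star_proj[of "letter (E a b)"] by (simp add: proj_letter adj_E U_incl_scale)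

text \<open>The matrix units determine \<tau> on \<open>U_incl X\<close> by conjugate-linearity;
  since \<open>U\<close> is generated by these elements and 1, the product rule determines it
  everywhere.\<close>

lemma star_structure_unique:
  assumes t: "star_structure U \<tau>"
    and "\<And>a b. a \<in> B \<Longrightarrow> b \<in> B \<Longrightarrow> \<tau> (U_incl (E a b)) = (sg a * sg b) \<odot>\<^bsub>U\<^esub> U_incl (E b a)"
  shows "\<tau> = star sg"
proof -
  note s = star_structure_star
  have gl: "\<tau> (U_incl X) = star sg (U_incl X)" if "X \<in> gl" for X
    using that
  proof (induction X rule: gl_induct)
    case zero
    \<comment> \<open>\<open>star_structure\<close> says nothing about zero; its image is found from
      conjugate-linearity at the scalar 0.\<close>
    have "fun_scale scale 0 0 = (0 :: 'v \<Rightarrow> 'v)"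
      by (simp add: fun_scale_def fun_eq_iff)
    then have 0: "U_incl 0 = 0 \<odot>\<^bsub>U\<^esub> U_incl 0"
      using U_incl_scale[of 0 0] gl_closed(5) by simp
    have "\<sigma> (U_incl 0) = \<zero>\<^bsub>U\<^esub>" if s: "star_structure U \<sigma>" for \<sigma>
    proof -
      have "\<sigma> (0 \<odot>\<^bsub>U\<^esub> U_incl 0) = cnj 0 \<odot>\<^bsub>U\<^esub> \<sigma> (U_incl 0)" "\<sigma> (U_incl 0) \<in> carrier U"
        using s U_incl_closed[OF gl_closed(5)] unfolding star_structure_def by (simp, auto)
      then show ?thesis using 0 by (simp add: U_scale_zero)
    qed
    from trans[OF this[OF t] this[OF s, symmetric]] show ?case .
  next
    case (unit a b c)
    then show ?case
      using t s by (simp add: U_incl_scale star_structure_def U_incl_closed assms(2) star_E)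
  next
    case (add X Y)
    then have "\<tau> (U_incl (X + Y)) = star sg (U_incl (X + Y))"
      using t s by (simp add: U_incl_add star_structure_def U_incl_closed)
    then show ?case .
  qed
  interpret U: complex_algebra U by (rule UQ.quot_complex_algebra)
  have one: "\<sigma> \<one>\<^bsub>U\<^esub> = \<one>\<^bsub>U\<^esub>" if "star_structure U \<sigma>" for \<sigma>
  proof -
    have c: "\<sigma> \<one>\<^bsub>U\<^esub> \<in> carrier U" using that by (auto simp: star_structure_def)
    \<comment> \<open>The left side is \<sigma> (\<sigma> 1) = 1 and the right side is 1 times
      \<sigma> 1, so involutivity forces \<sigma> to fix the unit.\<close>
    have "\<sigma> (\<one>\<^bsub>U\<^esub> \<otimes>\<^bsub>U\<^esub> \<sigma> \<one>\<^bsub>U\<^esub>) = \<sigma> (\<sigma> \<one>\<^bsub>U\<^esub>) \<otimes>\<^bsub>U\<^esub> \<sigma> \<one>\<^bsub>U\<^esub>"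
      using that c unfolding star_structure_def by blast
    moreover have "\<sigma> (\<sigma> \<one>\<^bsub>U\<^esub>) = \<one>\<^bsub>U\<^esub>" using that by (auto simp: star_structure_def)
    ultimately show ?thesis using c by simp
  qed
  have "\<tau> x = star sg x" if "x \<in> carrier U" for x
    using that
  proof (induction x rule: U_induct)
    case (scalar c)
    then show ?case
      using t s one[OF t] one[OF s] by (simp add: star_structure_def)
  next
    case (letter X x)
    then show ?case
      using t s gl[of X] by (simp add: star_structure_def U_incl_closed)
  next
    case (add x y)
    then show ?case
      using t s by (simp add: star_structure_def)
  qed
  moreover have "\<tau> \<in> extensional (carrier U)" "star sg \<in> extensional (carrier U)"
    using t s by (auto simp: star_structure_def PiE_def)
  ultimately show ?thesis by (intro extensionalityI)
qed

end

section \<open>Hermitian form on the free algebra\<close>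

definition word_form :: "('x word \<Rightarrow>\<^sub>0 complex) \<Rightarrow> ('x word \<Rightarrow>\<^sub>0 complex) \<Rightarrow> complex" where
  "word_form p q = (\<Sum>w\<in>Poly_Mapping.keys p. cnj (Poly_Mapping.lookup p w) * Poly_Mapping.lookup q w)"

lemma word_form_single: "word_form (Poly_Mapping.single w c) q = cnj c * Poly_Mapping.lookup q w"
  by (auto simp: word_form_def)

lemma word_form_add_left: "word_form (p + q) u = word_form p u + word_form q u"
  using linear_extension_add[of "\<lambda>w c. cnj c * Poly_Mapping.lookup u w" p q]
  by (simp add: word_form_def linear_extension_def algebra_simps)

lemma word_form_add_right: "word_form u (p + q) = word_form u p + word_form u q"
  by (simp add: word_form_def lookup_add algebra_simps sum.distrib)

lemma word_form_scale_right: "word_form u (scalar c * p) = c * word_form u p"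
  by (simp add: word_form_def sum_distrib_left mult_ac)

lemma word_form_zero [simp]: "word_form 0 p = 0" "word_form p 0 = 0"
  by (simp_all add: word_form_def)

text \<open>\<open>word_form\<close> sums over the support of its first argument; extending the sum
  to the union of both supports makes it Hermitian at sight.\<close>

lemma word_form_cnj: "word_form p q = cnj (word_form q p)"
proof -
  have "word_form p q = (\<Sum>w\<in>Poly_Mapping.keys p \<union> Poly_Mapping.keys q.
      cnj (Poly_Mapping.lookup p w) * Poly_Mapping.lookup q w)" for p q :: "'a word \<Rightarrow>\<^sub>0 complex"
    unfolding word_form_def by (intro sum.mono_neutral_left) (auto simp: in_keys_iff)
  from this[of p q] this[of q p] show ?thesis by (simp add: Un_commute mult.commute)
qed

lemma word_form_scale_left: "word_form (scalar c * p) u = cnj c * word_form p u"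
  using word_form_scale_right[of u c p] word_form_cnj[of "scalar c * p" u] word_form_cnj[of p u] by simp

lemma word_form_positive:
  assumes "p \<noteq> 0"
  shows "word_form p p \<in> \<real>" "0 < Re (word_form p p)"
proof -
  have eq: "word_form p p = of_real (\<Sum>w\<in>Poly_Mapping.keys p. (cmod (Poly_Mapping.lookup p w))\<^sup>2)"
    by (simp add: word_form_def complex_norm_square mult.commute del: of_real_power)
  then show "word_form p p \<in> \<real>" by simp
  have "Poly_Mapping.keys p \<noteq> {}" using assms by (auto simp: poly_mapping_eq_iff fun_eq_iff in_keys_iff)
  then have "0 < (\<Sum>w\<in>Poly_Mapping.keys p. (cmod (Poly_Mapping.lookup p w))\<^sup>2)"
    by (intro sum_pos) (auto simp: in_keys_iff)
  then show "0 < Re (word_form p p)" using eq by simp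
qed

text \<open>Reads off coefficients by first letter, which gives the matrix coefficients of operators
  on words a recursion in both words.\<close>

lemma lookup_letter_mult:
  "Poly_Mapping.lookup (letter x * p) (Word (y # ys)) = (if x =
      y then Poly_Mapping.lookup p (Word ys) else 0)"
  "Poly_Mapping.lookup (letter x * p) (Word []) = 0"
proof -
  have "Poly_Mapping.keys p \<subseteq> UNIV" by simp
  then have "Poly_Mapping.lookup (letter x * p) (Word (y # ys)) = (if x =
      y then Poly_Mapping.lookup p (Word ys) else 0)
    \<and> Poly_Mapping.lookup (letter x * p) (Word []) = 0"
  proof (induction p rule: poly_mapping_keys_induct)
    case (single w c)
    obtain xs where "w = Word xs" by (cases w)
    then show ?case by (auto simp: lookup_single when_def simp flip: single_Cons)
  qed (auto simp: distrib_left lookup_add)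
  then show "Poly_Mapping.lookup (letter x * p) (Word (y # ys)) = (if x =
      y then Poly_Mapping.lookup p (Word ys) else 0)"
    "Poly_Mapping.lookup (letter x * p) (Word []) = 0" by auto
qed

section \<open>Tensor powers of a graded module\<close>

context graded_space
begin

text \<open>For \<open>X\<close> of degree \<open>\<alpha>\<close> this is \<open>\<omega> \<alpha> \<gamma>\<close> times \<open>X\<close>, the factor picked up by moving \<open>X\<close> past an
  element of degree \<open>\<gamma>\<close>.\<close>

definition twist :: "'g \<Rightarrow> ('v \<Rightarrow> 'v) \<Rightarrow> ('v \<Rightarrow> 'v)" where
  "twist \<gamma> X = (\<lambda>v. \<Sum>a\<in>B. (\<Sum>b\<in>B. \<omega> (degree a - degree b) \<gamma> * mat X a b * rep v b) *s a)"

lemma twist_gl [simp]: "twist \<gamma> X \<in> gl"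
  by (rule glI)
    (simp_all add: twist_def rep_add rep_scale distrib_left sum.distrib scale_left_distrib
      scale_sum_right sum_distrib_left mult_ac)

lemma mat_twist: "a \<in> B \<Longrightarrow> b \<in> B \<Longrightarrow> mat (twist \<gamma> X) a b = \<omega> (degree a - degree b) \<gamma> * mat X a b"
proof -
  assume ab: "a \<in> B" "b \<in> B"
  then have "rep (twist \<gamma> X b) a = (\<Sum>b'\<in>B. if b' = b then \<omega> (degree a - degree b) \<gamma> * mat X a b else 0)"
    unfolding twist_def rep_combination[OF ab(1)] by (intro sum.cong) (auto simp: rep_basis)
  then show ?thesis using ab finite_Basis by (simp add: mat_def)
qed

lemma twist_add: "twist \<gamma> (X + Y) = twist \<gamma> X + twist \<gamma> Y"
  by (rule gl_eqI) (auto simp: gl_closed mat_twist mat_simps algebra_simps)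

lemma twist_scale: "twist \<gamma> (fun_scale scale c X) = fun_scale scale c (twist \<gamma> X)"
  by (rule gl_eqI) (auto simp: gl_closed mat_twist mat_simps algebra_simps)

lemma twist_part: "X \<in> gl_part \<alpha> \<Longrightarrow> twist \<gamma> X = fun_scale scale (\<omega> \<alpha> \<gamma>) X"
proof (rule gl_eqI)
  fix a b assume "X \<in> gl_part \<alpha>" "a \<in> B" "b \<in> B"
  then show "mat (twist \<gamma> X) a b = mat (fun_scale scale (\<omega> \<alpha> \<gamma>) X) a b"
    by (cases "mat X a b = 0") (auto simp: gl_part_iff mat_twist mat_simps)
qed (auto simp: gl_closed gl_part_gl)

end

context unitary_graded_space
begin

lemma cnj_factor_left: "cnj (\<omega> \<alpha> \<beta>) = \<omega> (- \<alpha>) \<beta>"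
  using cnj_factor[OF unimodular, of \<alpha> \<beta>] inverse_unique[OF factor_simps(2)[of \<alpha> \<beta>]]
  by (simp add: factor_simps)

text \<open>Conjugating \<omega> (x - y) \<gamma> gives \<omega> (y - x) \<gamma>, which is the
  twist factor of the transposed entry.\<close>

lemma adj_twist: "adj sg (twist \<gamma> X) = twist \<gamma> (adj sg X)"
proof (rule gl_eqI)
  fix a b assume "a \<in> B" "b \<in> B"
  then show "mat (adj sg (twist \<gamma> X)) a b = mat (twist \<gamma> (adj sg X)) a b"
    using cnj_factor_left[of "degree b - degree a" \<gamma>] by (simp add: mat_adj mat_twist)
qed auto

end

text \<open>\<open>B\<close> indexes a basis \<open>e\<close> of the module as well, with \<delta> b
  the degree of \<open>e b\<close>. \<open>act_adj\<close> says that \<open>adj sg X\<close> acts as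
  the adjoint of X for the form in which \<open>e\<close> is orthonormal. \<open>act_bracket\<close>
  is stated on basis vectors, which is where the induction on words in \<open>D_bracket\<close> uses
  it.\<close>

locale graded_module = unitary_graded_space scale B \<omega> V sg +
  M: coordinates sM S B e r
  for scale :: "complex \<Rightarrow> 'v::ab_group_add \<Rightarrow> 'v" (infixr \<open>*s\<close> 75)
    and B :: "'v set" and \<omega> :: "'g::ab_group_add \<Rightarrow> 'g \<Rightarrow> complex" and V :: "'g \<Rightarrow> 'v set"
    and sg :: "'v \<Rightarrow> complex"
    and sM :: "complex \<Rightarrow> 'w::ab_group_add \<Rightarrow> 'w" and S :: "'w set"
    and e :: "'v \<Rightarrow> 'w" and r :: "'w \<Rightarrow> 'v \<Rightarrow> complex" +
  fixes P :: "'g \<Rightarrow> 'w set" and act :: "('v \<Rightarrow> 'v) \<Rightarrow> 'w \<Rightarrow> 'w" and \<delta> :: "'v \<Rightarrow> 'g"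
  assumes act_S: "X \<in> gl \<Longrightarrow> x \<in> S \<Longrightarrow> act X x \<in> S"
    and act_add_left: "X \<in> gl \<Longrightarrow> Y \<in> gl \<Longrightarrow> x \<in> S \<Longrightarrow> act (X + Y) x = act X x + act Y x"
    and act_scale_left: "X \<in> gl \<Longrightarrow> x \<in> S \<Longrightarrow> act (fun_scale scale c X) x = sM c (act X x)"
    and act_add_right: "X \<in> gl \<Longrightarrow> x \<in> S \<Longrightarrow> y \<in> S \<Longrightarrow> act X (x + y) = act X x + act X y"
    and act_scale_right: "X \<in> gl \<Longrightarrow> x \<in> S \<Longrightarrow> act X (sM c x) = sM c (act X x)"
    and e_P: "b \<in> B \<Longrightarrow> e b \<in> P (\<delta> b)"
    and P_S: "x \<in> P \<beta> \<Longrightarrow> x \<in> S"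
    and P_coordinates: "x \<in> P \<beta> \<Longrightarrow> b \<in> B \<Longrightarrow> r x b \<noteq> 0 \<Longrightarrow> \<delta> b = \<beta>"
    and act_P: "X \<in> gl_part \<alpha> \<Longrightarrow> x \<in> P \<beta> \<Longrightarrow> act X x \<in> P (\<alpha> + \<beta>)"
    and act_bracket: "X \<in> gl_part \<alpha> \<Longrightarrow> Y \<in> gl_part \<beta> \<Longrightarrow> b \<in> B \<Longrightarrow>
      act X (act Y (e b)) = act (bracket \<alpha> \<beta> X Y) (e b) + sM (\<omega> \<alpha> \<beta>) (act Y (act X (e b)))"
    and act_adj: "X \<in> gl \<Longrightarrow> b \<in> B \<Longrightarrow> b' \<in> B \<Longrightarrow>
      cnj (r (act X (e b)) b') = r (act (adj sg X) (e b')) b"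
begin

abbreviation "N \<equiv> free_algebra B"
abbreviation "lin \<equiv> M.linear_poly"

section \<open>The colour derivation \<open>D X\<close> on words in the basis\<close>

primrec act_word :: "'v list \<Rightarrow> ('v \<Rightarrow> 'v) \<Rightarrow> ('v word \<Rightarrow>\<^sub>0 complex)" where
  "act_word [] X = 0"
| "act_word (b # bs) X =
    lin (act X (e b)) * Poly_Mapping.single (Word bs) 1 + letter b * act_word bs (twist (\<delta> b) X)"

definition D :: "('v \<Rightarrow> 'v) \<Rightarrow> ('v word \<Rightarrow>\<^sub>0 complex) \<Rightarrow> ('v word \<Rightarrow>\<^sub>0 complex)" where
  "D X = linear_extension (\<lambda>w c. scalar c * act_word (letters w) X)"

lemma D_single: "D X (Poly_Mapping.single w c) = scalar c * act_word (letters w) X"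
  by (simp add: D_def)

lemma D_add: "D X (p + q) = D X p + D X q"
  unfolding D_def by (rule linear_extension_add) (auto simp: scalar_add distrib_right)

lemma D_0 [simp]: "D X 0 = 0"
  by (simp add: D_def)

lemma D_scalar [simp]: "D X (scalar c) = 0"
  by (simp add: D_single)

lemma D_scale: "D X (scalar c * p) = scalar c * D X p"
proof -
  have "Poly_Mapping.keys p \<subseteq> UNIV" by simp
  then show ?thesis
  proof (induction p rule: poly_mapping_keys_induct)
    case (single w d)
    have "scalar c * Poly_Mapping.single w d = Poly_Mapping.single w (c * d)"
      by (simp add: mult_single)
    then show ?case by (simp add: D_single scalar_mult mult.assoc)
  qed (auto simp: D_add distrib_left)
qed

lemma D_sum: "D X (sum f A) = (\<Sum>x\<in>A. D X (f x))"
  by (induction A rule: infinite_finite_induct) (auto simp: D_add)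

lemma D_letter: "D X (letter b * p) = lin (act X (e b)) * p + letter b * D (twist (\<delta> b) X) p"
proof -
  have "Poly_Mapping.keys p \<subseteq> UNIV" by simp
  then show ?thesis
  proof (induction p rule: poly_mapping_keys_induct)
    case (single w c)
    obtain bs where w: "w = Word bs" by (cases w)
    have c: "Poly_Mapping.single (Word bs) c = scalar c * Poly_Mapping.single (Word bs) 1"
      by (simp add: mult_single)
    have "D X (letter b * Poly_Mapping.single w c) = scalar c * act_word (b # bs) X"
      by (simp add: w D_single flip: single_Cons)
    also have "\<dots> = lin (act X (e b)) * (scalar c * Poly_Mapping.single (Word bs) 1)
        + letter b * (scalar c * act_word bs (twist (\<delta> b) X))"
      by (simp add: distrib_left scalar_left_commute[of _ c])
    also have "\<dots> = lin (act X (e b)) * Poly_Mapping.single w c +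
        letter b * D (twist (\<delta> b) X) (Poly_Mapping.single w c)"
      by (simp add: w D_single flip: c)
    finally show ?case .
  qed (auto simp: D_add distrib_left)
qed

lemma D_closed: "p \<in> carrier N \<Longrightarrow> D X p \<in> carrier N"
proof (induction p arbitrary: X rule: free_algebra_induct)
  case (letter b p)
  then show ?case unfolding D_letter
    by (intro free_algebra_closed) (auto intro: free_algebra_closed)
qed (auto simp: D_add intro: free_algebra_closed)

lemma act_word_homogeneous: "set bs \<subseteq> B \<Longrightarrow> act_word bs X \<in> homogeneous_part B (length bs)"
proof (induction bs arbitrary: X)
  case (Cons b bs)
  have "Poly_Mapping.single (Word bs) 1 \<in> homogeneous_part B (length bs)"
    using Cons.prems by (simp add: homogeneous_part_def words_of_length_def words_def)
  then have "lin (act X (e b)) * Poly_Mapping.single (Word bs) 1 + letter b * act_word bs (twist (\<delta> b) X)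
      \<in> homogeneous_part B (1 + length bs)"
    using Cons by (intro homogeneous_part_closed(1) homogeneous_part_mult M.linear_poly_homogeneous
        homogeneous_part_letter) auto
  then show ?case by simp
qed (simp add: homogeneous_part_closed)

lemma D_homogeneous: "p \<in> homogeneous_part B n \<Longrightarrow> D X p \<in> homogeneous_part B n"
  unfolding homogeneous_part_def[of B n] mem_Collect_eq
proof (induction p rule: poly_mapping_keys_induct)
  case (single w c)
  then have "scalar c * act_word (letters w) X \<in> homogeneous_part B n"
    using act_word_homogeneous[of "letters w" X]
    by (intro homogeneous_part_closed(2)) (auto simp: words_of_length_def words_def)
  then show ?case by (simp add: D_single homogeneous_part_def)
next
  case (add p q)
  then show ?case
    using homogeneous_part_closed(1)[of "D X p" B n "D X q"] by (simp add: D_add homogeneous_part_def)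
qed simp

text \<open>X and Y stay arbitrary in the induction because behind the first letter the hypothesis
  is needed for their twists.\<close>

lemma D_add_left: "p \<in> carrier N \<Longrightarrow> X \<in> gl \<Longrightarrow> Y \<in> gl \<Longrightarrow> D (X + Y) p = D X p + D Y p"
  by (induction p arbitrary: X Y rule: free_algebra_induct)
    (auto simp: D_add D_letter twist_add act_add_left act_S M.e_S M.linear_poly_add distrib_left
        distrib_right)

lemma D_scale_left: "p \<in> carrier N \<Longrightarrow> X \<in> gl \<Longrightarrow> D (fun_scale scale c X) p = scalar c * D X p"
  by (induction p arbitrary: X rule: free_algebra_induct)
    (auto simp: D_add D_letter twist_scale act_scale_left act_S M.e_S M.linear_poly_scale distrib_left
      scalar_left_commute[of _ c] mult.assoc)

lemma D_letter_part:
  assumes "p \<in> carrier N" "X \<in> gl_part \<alpha>"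
  shows "D X (letter b * p) = lin (act X (e b)) * p + scalar (\<omega> \<alpha> (\<delta> b)) * (letter b * D X p)"
  using assms by (simp add: D_letter twist_part D_scale_left gl_part_gl scalar_left_commute[of _
      "\<omega> \<alpha> (\<delta> b)"])

lemma lin_act:
  assumes X: "X \<in> gl" and x: "x \<in> S"
  shows "lin (act X x) = (\<Sum>b\<in>B. scalar (r x b) * lin (act X (e b)))"
proof -
  have 0: "act X 0 = 0"
    using act_scale_right[OF X M.zero_S, of 0] by (simp add: M.scale_zero)
  have lin0: "lin 0 = 0"
    using M.linear_poly_scale[OF M.zero_S, of 0] by (simp add: M.scale_zero)
  \<comment> \<open>\<open>act X\<close> is linear on \<open>S\<close> only, so membership of the
    partial sums in \<open>S\<close> is part of the induction.\<close>
  have "finite A \<Longrightarrow> A \<subseteq> B \<Longrightarrow> (\<Sum>b\<in>A. sM (r x b) (e b)) \<in> S \<and>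
    lin (act X (\<Sum>b\<in>A. sM (r x b) (e b))) = (\<Sum>b\<in>A. scalar (r x b) * lin (act X (e b)))" for A
  proof (induction A rule: finite_induct)
    case empty
    show ?case by (simp add: 0 lin0 M.zero_S)
  next
    case (insert b A)
    then show ?case
      using X by (simp add: M.add_S M.scale_S M.e_S act_add_right act_scale_right act_S
          M.linear_poly_add M.linear_poly_scale)
  qed
  from this[of B] show ?thesis using M.expansion[OF x] finite_Basis by simp
qed

text \<open>\<open>tensor_action\<close> demands the Leibniz rule for every homogeneous vector,
  while \<open>D\<close> is built from basis letters. All letters that occur in x have degree
  \<beta>, so the factor is the same for each of them and leaves the sum.\<close>

lemma D_lin:
  assumes p: "p \<in> carrier N" and X: "X \<in> gl_part \<alpha>" and x: "x \<in> P \<beta>"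
  shows "D X (lin x * p) = lin (act X x) * p + scalar (\<omega> \<alpha> \<beta>) * (lin x * D X p)"
proof -
  have "D X (lin x * p) = (\<Sum>b\<in>B. scalar (r x b) * D X (letter b * p))"
    by (simp add: M.linear_poly_def sum_distrib_right D_sum mult.assoc D_scale)
  also have "\<dots> = (\<Sum>b\<in>B. scalar (r x b) * lin (act X (e b)) * p +
      scalar (\<omega> \<alpha> \<beta>) * (scalar (r x b) * letter b * D X p))"
  proof (rule sum.cong[OF refl])
    fix b assume b: "b \<in> B"
    show "scalar (r x b) * D X (letter b * p) = scalar (r x b) * lin (act X (e b)) * p +
      scalar (\<omega> \<alpha> \<beta>) * (scalar (r x b) * letter b * D X p)"
      using P_coordinates[OF x b]
      by (cases "r x b = 0")
        (auto simp: D_letter_part[OF p X] distrib_left mult.assoc scalar_left_commute[of "scalar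
            (r x b)"])
  qed
  also have "\<dots> = lin (act X x) * p + scalar (\<omega> \<alpha> \<beta>) * (lin x * D X p)"
    using lin_act[OF gl_part_gl[OF X] P_S[OF x]]
    by (simp add: sum.distrib sum_distrib_right sum_distrib_left M.linear_poly_def)
  finally show ?thesis .
qed

text \<open>Induction on the first letter. The terms in which X and Y hit different places cancel
  between the two orders; those with both in the first letter are \<open>act_bracket\<close>, those
  with both in the rest are the induction hypothesis.\<close>

lemma D_bracket:
  assumes X: "X \<in> gl_part \<alpha>" and Y: "Y \<in> gl_part \<beta>"
  shows "p \<in> carrier N \<Longrightarrow> D X (D Y p) = D (bracket \<alpha> \<beta> X Y) p + scalar (\<omega> \<alpha> \<beta>) * D Y (D X p)"
proof (induction p rule: free_algebra_induct)
  case (letter b p)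
  note p = letter.hyps(2) and b = letter.hyps(1)
  note XY = bracket_part[OF X Y]
  let ?d = "\<delta> b" and ?b = "letter b"
  have gl: "X \<in> gl" "Y \<in> gl" using X Y gl_part_gl by auto
  \<comment> \<open>Stated for arbitrary X', Y' so that it expands both orders. The factor with
    \<beta>' + ?d arises because X' has to pass the image of the letter under Y'.\<close>
  have DD: "D X' (D Y' (?b * p)) = lin (act X' (act Y' (e b))) * p
      + scalar (\<omega> \<alpha>' (\<beta>' + ?d)) * (lin (act Y' (e b)) * D X' p)
      + scalar (\<omega> \<beta>' ?d) * (lin (act X' (e b)) * D Y' p)
      + scalar (\<omega> \<alpha>' ?d * \<omega> \<beta>' ?d) * (?b * D X' (D Y' p))"
    if X': "X' \<in> gl_part \<alpha>'" and Y': "Y' \<in> gl_part \<beta>'" for X' Y' \<alpha>' \<beta>'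
    by (simp add: D_letter_part[OF p Y'] D_add D_scale D_lin[OF p X' act_P[OF Y' e_P[OF b]]]
        D_letter_part[OF D_closed[OF p] X'] distrib_left scalar_mult mult.assoc
            scalar_left_commute[of "scalar (\<omega> \<beta>' ?d)"])
  \<comment> \<open>The first two identities match the coefficients of the mixed terms; the first
    rests on \<omega> \<alpha> \<beta> * \<omega> \<beta> \<alpha> = 1.\<close>
  have w: "\<omega> \<alpha> \<beta> * \<omega> \<beta> (\<alpha> + ?d) = \<omega> \<beta> ?d" "\<omega> \<alpha> (\<beta> + ?d) = \<omega> \<alpha> \<beta> * \<omega> \<alpha> ?d"
      "\<omega> (\<alpha> + \<beta>) ?d = \<omega> \<alpha> ?d * \<omega> \<beta> ?d"
    using factor_simps(2)[of \<alpha> \<beta>] by (simp_all add: factor_simps flip: mult.assoc)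
  have br: "lin (act X (act Y (e b))) =
      lin (act (bracket \<alpha> \<beta> X Y) (e b)) + scalar (\<omega> \<alpha> \<beta>) * lin (act Y (act X (e b)))"
    unfolding act_bracket[OF X Y b]
    using gl b by (simp add: M.linear_poly_add M.linear_poly_scale M.scale_S act_S M.e_S gl_closed)
  have "D (bracket \<alpha> \<beta> X Y) (?b * p) = lin (act (bracket \<alpha> \<beta> X Y) (e b)) * p
      + scalar (\<omega> \<alpha> ?d * \<omega> \<beta> ?d) * (?b * D (bracket \<alpha> \<beta> X Y) p)"
    by (simp add: D_letter_part[OF p XY] w)
  moreover have "scalar (\<omega> \<alpha> \<beta>) * D Y (D X (?b * p)) = scalar (\<omega> \<alpha> \<beta>) * (lin (act Y (act X (e b))) * p)
      + scalar (\<omega> \<beta> ?d) * (lin (act X (e b)) * D Y p)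
      + scalar (\<omega> \<alpha> (\<beta> + ?d)) * (lin (act Y (e b)) * D X p)
      + scalar (\<omega> \<alpha> ?d * \<omega> \<beta> ?d) * (?b * (scalar (\<omega> \<alpha> \<beta>) * D Y (D X p)))"
  proof -
    have "scalar (\<omega> \<alpha> \<beta>) * (scalar (\<omega> \<beta> (\<alpha> + ?d)) * u) = scalar (\<omega> \<beta> ?d) * u"
      "scalar (\<omega> \<alpha> \<beta>) * (scalar (\<omega> \<alpha> ?d) * u) = scalar (\<omega> \<alpha> (\<beta> + ?d)) * u"
      "scalar (\<omega> \<alpha> \<beta>) * (scalar (\<omega> \<beta> ?d * \<omega> \<alpha> ?d) * (?b * u)) =
       scalar (\<omega> \<alpha> ?d * \<omega> \<beta> ?d) * (?b * (scalar (\<omega> \<alpha> \<beta>) * u))" for u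
      unfolding scalar_left_commute[of ?b] scalar_scalar w by (simp_all add: mult_ac)
    then show ?thesis unfolding DD[OF Y X] by (simp add: distrib_left)
  qed
  moreover have "D X (D Y (?b * p)) =
      (lin (act (bracket \<alpha> \<beta> X Y) (e b)) * p + scalar (\<omega> \<alpha> \<beta>) * (lin (act Y (act X (e b))) * p))
      + scalar (\<omega> \<alpha> (\<beta> + ?d)) * (lin (act Y (e b)) * D X p)
      + scalar (\<omega> \<beta> ?d) * (lin (act X (e b)) * D Y p)
      + (scalar (\<omega> \<alpha> ?d * \<omega> \<beta> ?d) * (?b * D (bracket \<alpha> \<beta> X Y) p) +
         scalar (\<omega> \<alpha> ?d * \<omega> \<beta> ?d) * (?b * (scalar (\<omega> \<alpha> \<beta>) * D Y (D X p))))"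
    unfolding DD[OF X Y] br letter.IH by (simp add: distrib_left distrib_right mult.assoc)
  ultimately show ?case by (simp add: algebra_simps)
qed (auto simp: D_add distrib_left)

lemma lookup_lin_mult:
  assumes "c \<in> B"
  shows "Poly_Mapping.lookup (lin x * Poly_Mapping.single (Word bs) 1) (Word (c # cs)) = (if bs =
      cs then r x c else 0)"
    and "Poly_Mapping.lookup (lin x * Poly_Mapping.single (Word bs) 1) (Word []) = 0"
proof -
  have *: "lin x * Poly_Mapping.single (Word bs) 1 =
      (\<Sum>b\<in>B. scalar (r x b) * (letter b * Poly_Mapping.single (Word bs) 1))"
    by (simp add: M.linear_poly_def sum_distrib_right mult.assoc)
  have "Poly_Mapping.lookup (lin x * Poly_Mapping.single (Word bs) 1) (Word (c # cs)) =
      (\<Sum>b\<in>B. if b = c then if bs = cs then r x c else 0 else 0)"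
    unfolding * lookup_sum by (intro sum.cong) (auto simp: lookup_letter_mult lookup_single when_def)
  then show "Poly_Mapping.lookup (lin x * Poly_Mapping.single (Word bs) 1) (Word (c # cs)) =
      (if bs = cs then r x c else 0)"
    using assms finite_Basis by simp
  show "Poly_Mapping.lookup (lin x * Poly_Mapping.single (Word bs) 1) (Word []) = 0"
    unfolding * lookup_sum by (intro sum.neutral) (auto simp: lookup_letter_mult)
qed

text \<open>A coefficient has two contributions. If the tails agree, the first letter is changed,
  and \<open>act_adj\<close> applies. If the first letters agree, both tails are twisted by the same
  degree, and \<open>adj_twist\<close> with the induction hypothesis applies. The empty word meets
  only zero coefficients.\<close>

lemma act_word_adj:
  assumes "X \<in> gl" "set bs \<subseteq> B" "set cs \<subseteq> B"
  shows "cnj (Poly_Mapping.lookup (act_word bs X) (Word cs)) =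
    Poly_Mapping.lookup (act_word cs (adj sg X)) (Word bs)"
  using assms
proof (induction bs arbitrary: cs X)
  case Nil
  then show ?case
    by (cases cs) (auto simp: lookup_add lookup_lin_mult lookup_letter_mult)
next
  case (Cons b bs)
  show ?case
  proof (cases cs)
    case Nil
    then show ?thesis
      using Cons.prems by (auto simp: lookup_add lookup_lin_mult lookup_letter_mult)
  next
    case (Cons c cs')
    then show ?thesis
      using Cons.prems Cons.IH[of "twist (\<delta> b) X" cs']
      by (auto simp: lookup_add lookup_lin_mult lookup_letter_mult act_adj adj_twist)
  qed
qed

lemma word_form_D:
  assumes X: "X \<in> gl" and "p \<in> carrier N" "q \<in> carrier N"
  shows "word_form (D X p) q = word_form p (D (adj sg X) q)"
  using assms(2) unfolding carrier_free_algebra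
proof (induction p rule: poly_mapping_keys_induct)
  case (single w c)
  show ?case
    using assms(3) unfolding carrier_free_algebra
  proof (induction q rule: poly_mapping_keys_induct)
    case (single v d)
    obtain bs cs where "w = Word bs" "v = Word cs" by (metis word.exhaust)
    then show ?case
      using single \<open>w \<in> words B\<close> act_word_adj[OF X, of bs cs]
        word_form_cnj[of "scalar c * act_word bs X" "Poly_Mapping.single (Word cs) d"]
      by (simp add: D_single word_form_single words_def)
  qed (auto simp: D_add word_form_add_right)
qed (auto simp: D_add word_form_add_left)

section \<open>Identification of \<open>tensor_action\<close> with the transported
  derivation\<close>

definition tensor_act where
  "tensor_act = restrict (\<lambda>X. restrict (\<lambda>t. M.tensor_of (D X (M.normal_form t))) (carrier M.T)) gl"

lemma tensor_act_tensor_of: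
  "X \<in> gl \<Longrightarrow> q \<in> carrier N \<Longrightarrow> tensor_act X (M.tensor_of q) = M.tensor_of (D X q)"
  by (simp add: tensor_act_def M.tensor_of_closed M.normal_form_tensor_of)

lemma tensor_cases:
  assumes "t \<in> carrier M.T"
  obtains q where "q \<in> carrier N" "t = M.tensor_of q"
  using assms M.normal_form_closed M.tensor_of_normal_form by metis

lemma tensor_of_letter_mult:
  "b \<in> B \<Longrightarrow> q \<in> carrier N \<Longrightarrow> M.tensor_of (letter b * q) = M.j (e b) \<otimes>\<^bsub>M.T\<^esub> M.tensor_of q"
  by (simp add: M.tensor_of_mult M.e_S flip: M.tensor_of_linear_poly M.linear_poly_basis)

text \<open>Uniqueness: the Leibniz rule reduces the value on a word to its tail, down to multiples
  of 1, which are killed. That rule is available for homogeneous X only, so a decomposition of X is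
  nested inside the induction on tensors.\<close>

lemma tensor_action_eq: "tensor_action sM S P act = tensor_act"
  unfolding tensor_action_def Let_def
proof (rule the_equality, intro conjI allI ballI)
  show "tensor_act \<in> gl \<rightarrow>\<^sub>E carrier M.T \<rightarrow>\<^sub>E carrier M.T"
    unfolding tensor_act_def
    unfolding restrict_PiE_iff by (intro ballI M.tensor_of_closed D_closed M.normal_form_closed)
next
  fix X Y t assume "X \<in> gl" "Y \<in> gl" "t \<in> carrier M.T"
  then show "tensor_act (X + Y) t = tensor_act X t \<oplus>\<^bsub>M.T\<^esub> tensor_act Y t"
    by (auto elim!: tensor_cases simp: tensor_act_tensor_of gl_closed D_add_left D_closed
        simp flip: M.tensor_of_add)
next
  fix X t t' assume "X \<in> gl" "t \<in> carrier M.T" "t' \<in> carrier M.T"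
  then show "tensor_act X (t \<oplus>\<^bsub>M.T\<^esub> t') = tensor_act X t \<oplus>\<^bsub>M.T\<^esub> tensor_act X t'"
    by (auto elim!: tensor_cases simp: tensor_act_tensor_of free_algebra_closed D_add D_closed
        simp flip: M.tensor_of_add)
next
  fix c X t assume *: "X \<in> gl" "t \<in> carrier M.T"
  then show "tensor_act (fun_scale scale c X) t = c \<odot>\<^bsub>M.T\<^esub> tensor_act X t"
    by (auto elim!: tensor_cases simp: tensor_act_tensor_of gl_closed D_scale_left D_closed
        simp flip: M.tensor_of_scale)
  show "tensor_act X (c \<odot>\<^bsub>M.T\<^esub> t) = c \<odot>\<^bsub>M.T\<^esub> tensor_act X t"
    using * by (auto elim!: tensor_cases simp: tensor_act_tensor_of free_algebra_closed D_scale
        D_closed simp flip: M.tensor_of_scale)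
next
  fix X assume "X \<in> gl"
  then show "tensor_act X \<one>\<^bsub>M.T\<^esub> = \<zero>\<^bsub>M.T\<^esub>"
    using D_scalar[of X 1] by (simp add: tensor_act_tensor_of flip: M.tensor_of_one M.tensor_of_zero)
next
  fix \<alpha> \<beta> X v t assume "X \<in> gl_part \<alpha>" "v \<in> P \<beta>" "t \<in> carrier M.T"
  then show "tensor_act X (M.j v \<otimes>\<^bsub>M.T\<^esub> t) =
      (M.j (act X v) \<otimes>\<^bsub>M.T\<^esub> t) \<oplus>\<^bsub>M.T\<^esub> (\<omega> \<alpha> \<beta> \<odot>\<^bsub>M.T\<^esub> (M.j v \<otimes>\<^bsub>M.T\<^esub> tensor_act X t))"
    by (elim tensor_cases) (simp add: tensor_act_tensor_of free_algebra_closed D_lin D_closed P_S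
        gl_part_gl act_S
      flip: M.tensor_of_scale M.tensor_of_mult M.tensor_of_add M.tensor_of_linear_poly)
next
  fix \<rho> :: "('v \<Rightarrow> 'v) \<Rightarrow> _"
  assume \<rho>: "\<rho> \<in> gl \<rightarrow>\<^sub>E (carrier M.T \<rightarrow>\<^sub>E carrier M.T) \<and>
      (\<forall>X\<in>gl. \<forall>Y\<in>gl. \<forall>t\<in>carrier M.T. \<rho> (X + Y) t = \<rho> X t \<oplus>\<^bsub>M.T\<^esub> \<rho> Y t) \<and>
      (\<forall>X\<in>gl. \<forall>t\<in>carrier M.T. \<forall>t'\<in>carrier M.T. \<rho> X (t \<oplus>\<^bsub>M.T\<^esub> t') = \<rho> X t \<oplus>\<^bsub>M.T\<^esub> \<rho> X t') \<and>
      (\<forall>c. \<forall>X\<in>gl. \<forall>t\<in>carrier M.T.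
         \<rho> (fun_scale scale c X) t = c \<odot>\<^bsub>M.T\<^esub> \<rho> X t \<and>
         \<rho> X (c \<odot>\<^bsub>M.T\<^esub> t) = c \<odot>\<^bsub>M.T\<^esub> \<rho> X t) \<and>
      (\<forall>X\<in>gl. \<rho> X \<one>\<^bsub>M.T\<^esub> = \<zero>\<^bsub>M.T\<^esub>) \<and>
      (\<forall>\<alpha> \<beta>. \<forall>X\<in>gl_part \<alpha>. \<forall>v\<in>P \<beta>. \<forall>t\<in>carrier M.T.
         \<rho> X (M.j v \<otimes>\<^bsub>M.T\<^esub> t) = (M.j (act X v) \<otimes>\<^bsub>M.T\<^esub> t) \<oplus>\<^bsub>M.T\<^esub> (\<omega> \<alpha> \<beta> \<odot>\<^bsub>M.T\<^esub> (M.j v \<otimes>\<^bsub>M.T\<^esub> \<rho> X t)))"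
  from \<rho> have leibniz: "\<forall>\<alpha> \<beta>. \<forall>X\<in>gl_part \<alpha>. \<forall>v\<in>P \<beta>. \<forall>t\<in>carrier M.T.
      \<rho> X (M.j v \<otimes>\<^bsub>M.T\<^esub> t) = (M.j (act X v) \<otimes>\<^bsub>M.T\<^esub> t) \<oplus>\<^bsub>M.T\<^esub> (\<omega> \<alpha> \<beta> \<odot>\<^bsub>M.T\<^esub> (M.j v \<otimes>\<^bsub>M.T\<^esub> \<rho> X t))"
    by (elim conjE)
  have closed: "\<rho> X t \<in> carrier M.T" if "X \<in> gl" "t \<in> carrier M.T" for X t
    using \<rho> that by (auto simp: PiE_iff)
  \<comment> \<open>X is arbitrary here: the inner induction over \<open>gl\<close> replaces it by
    homogeneous pieces, and each piece needs the outer hypothesis for q.\<close>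
  have *: "\<rho> X (M.tensor_of q) = M.tensor_of (D X q)" if "q \<in> carrier N" "X \<in> gl" for q X
    using that
  proof (induction q arbitrary: X rule: free_algebra_induct)
    case (scalar c)
    have "M.tensor_of (scalar c) = c \<odot>\<^bsub>M.T\<^esub> \<one>\<^bsub>M.T\<^esub>"
      using M.tensor_of_scale[of 1 c] by (simp add: M.tensor_of_one)
    then have "\<rho> X (M.tensor_of (scalar c)) = c \<odot>\<^bsub>M.T\<^esub> \<zero>\<^bsub>M.T\<^esub>"
      using \<rho> scalar M.tensor_of_closed[of 1] by (simp add: M.tensor_of_one)
    also have "\<dots> = M.tensor_of 0"
      using M.tensor_of_scale[of 0 c] by (simp add: M.tensor_of_zero)
    finally show ?case by simp
  next
    case (letter b q)
    let ?t = "M.tensor_of (letter b * q)"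
    have t: "?t \<in> carrier M.T" using letter by (intro M.tensor_of_closed free_algebra_closed) auto
    note bq = free_algebra_closed(2)[OF free_algebra_closed'(4)[OF letter.hyps(1)] letter.hyps(2)]
    from letter.prems show ?case
    proof (induction X rule: gl_part_induct)
      case (part \<alpha> Z)
      have "\<rho> Z ?t = (M.j (act Z (e b)) \<otimes>\<^bsub>M.T\<^esub> M.tensor_of q) \<oplus>\<^bsub>M.T\<^esub>
          (\<omega> \<alpha> (\<delta> b) \<odot>\<^bsub>M.T\<^esub> (M.j (e b) \<otimes>\<^bsub>M.T\<^esub> \<rho> Z (M.tensor_of q)))"
        unfolding tensor_of_letter_mult[OF letter.hyps]
        using leibniz part e_P[OF letter.hyps(1)] M.tensor_of_closed[OF letter.hyps(2)] by blast
      also have "\<dots> = M.tensor_of (D Z (letter b * q))"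
        using letter.hyps letter.IH[OF gl_part_gl[OF part]] part
        by (simp add: D_letter_part M.e_S act_S gl_part_gl free_algebra_closed D_closed
            tensor_of_letter_mult
            M.tensor_of_add M.tensor_of_mult[of "lin _"] M.tensor_of_scale M.tensor_of_linear_poly)
      finally show ?case .
    next
      case (add X Y)
      then have "\<rho> (X + Y) ?t = M.tensor_of (D (X + Y) (letter b * q))"
        using \<rho> t bq by (simp add: D_add_left M.tensor_of_add D_closed)
      then show ?case .
    qed
  next
    case (add p q)
    then show ?case using \<rho> by (simp add: M.tensor_of_add D_add D_closed M.tensor_of_closed)
  qed
  show "\<rho> = tensor_act"
  proof (rule extensionalityI[of _ gl])
    show "\<rho> \<in> extensional gl" "tensor_act \<in> extensional gl"
      using \<rho> by (auto simp: PiE_def tensor_act_def)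
    fix X assume X: "X \<in> gl"
    show "\<rho> X = tensor_act X"
    proof (rule extensionalityI[of _ "carrier M.T"])
      show "\<rho> X \<in> extensional (carrier M.T)" "tensor_act X \<in> extensional (carrier M.T)"
        using \<rho> X by (auto simp: PiE_iff tensor_act_def)
      fix t assume "t \<in> carrier M.T"
      then show "\<rho> X t = tensor_act X t"
        by (elim tensor_cases) (simp add: * X tensor_act_tensor_of)
    qed
  qed
qed


section \<open>Extension of \<open>D\<close> to the free algebra on \<open>gl\<close> and descent to
  \<open>U\<close>\<close>

primrec iterate_D :: "('v \<Rightarrow> 'v) list \<Rightarrow> ('v word \<Rightarrow>\<^sub>0 complex) \<Rightarrow> ('v word \<Rightarrow>\<^sub>0 complex)" where
  "iterate_D [] u = u"
| "iterate_D (X # Xs) u = D X (iterate_D Xs u)"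

definition A :: "(('v \<Rightarrow> 'v) word \<Rightarrow>\<^sub>0 complex) \<Rightarrow> ('v word \<Rightarrow>\<^sub>0 complex) \<Rightarrow> ('v word \<Rightarrow>\<^sub>0 complex)" where
  "A p u = linear_extension (\<lambda>w c. scalar c * iterate_D (letters w) u) p"

lemma A_single: "A (Poly_Mapping.single w c) u = scalar c * iterate_D (letters w) u"
  by (simp add: A_def)

lemma A_add: "A (p + q) u = A p u + A q u"
  unfolding A_def by (rule linear_extension_add) (auto simp: scalar_add distrib_right)

lemma A_0 [simp]: "A 0 u = 0"
  by (simp add: A_def)

lemma A_uminus: "A (- p) u = - A p u"
  using A_add[of p "- p" u] by (simp add: eq_neg_iff_add_eq_0 add.commute)

lemma A_diff: "A (p - q) u = A p u - A q u"
  using A_add[of p "- q" u] by (simp add: A_uminus)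

lemma A_scalar [simp]: "A (scalar c) u = scalar c * u"
  by (simp add: A_single)

lemma A_one [simp]: "A 1 u = u"
  using A_scalar[of 1 u] by simp

lemma A_scale: "A (scalar c * p) u = scalar c * A p u"
proof -
  have "Poly_Mapping.keys p \<subseteq> UNIV" by simp
  then show ?thesis
  proof (induction p rule: poly_mapping_keys_induct)
    case (single w d)
    have "scalar c * Poly_Mapping.single w d = Poly_Mapping.single w (c * d)"
      by (simp add: mult_single)
    then show ?case by (simp add: A_single scalar_mult mult.assoc)
  qed (auto simp: A_add distrib_left)
qed

lemma A_letter_mult: "A (letter X * p) u = D X (A p u)"
proof -
  have "Poly_Mapping.keys p \<subseteq> UNIV" by simp
  then show ?thesis
  proof (induction p rule: poly_mapping_keys_induct)
    case (single w c)
    obtain xs where "w = Word xs" by (cases w)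
    then show ?case by (simp add: A_single D_scale flip: single_Cons)
  qed (auto simp: distrib_left A_add D_add)
qed

lemma A_letter [simp]: "A (letter X) u = D X u"
  using A_letter_mult[of X 1 u] by simp

lemma A_mult: "p \<in> carrier F \<Longrightarrow> A (p * q) u = A p (A q u)"
  by (induction p rule: free_algebra_induct)
    (auto simp: A_scale A_add A_letter_mult distrib_right mult.assoc)

lemma A_add_right: "p \<in> carrier F \<Longrightarrow> A p (u + v) = A p u + A p v"
  by (induction p rule: free_algebra_induct)
    (auto simp: A_add A_letter_mult D_add distrib_left)

lemma A_scale_right: "p \<in> carrier F \<Longrightarrow> A p (scalar c * u) = scalar c * A p u"
  by (induction p rule: free_algebra_induct)
    (auto simp: A_add A_letter_mult D_scale distrib_left scalar_left_commute[of _ c])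

lemma A_0_right: "p \<in> carrier F \<Longrightarrow> A p 0 = 0"
  using A_scale_right[of p 0 0] by simp

lemma A_homogeneous: "p \<in> carrier F \<Longrightarrow> u \<in> homogeneous_part B n \<Longrightarrow> A p u \<in> homogeneous_part B n"
  by (induction p rule: free_algebra_induct)
    (auto simp: A_add A_letter_mult D_homogeneous intro: homogeneous_part_closed)

lemma A_closed: "p \<in> carrier F \<Longrightarrow> u \<in> carrier N \<Longrightarrow> A p u \<in> carrier N"
  by (induction p rule: free_algebra_induct)
    (auto simp: A_add A_letter_mult D_closed intro: free_algebra_closed)

text \<open>v is arbitrary because the outermost operator \<open>D X\<close> moves across first and
  its adjoint then sits innermost on the right; this is the order reversal in
  \<open>star_poly\<close>.\<close>

lemma word_form_A:
  assumes "p \<in> carrier F" "u \<in> carrier N" "v \<in> carrier N"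
  shows "word_form (A p u) v = word_form u (A (star_poly (adj sg) p) v)"
  using assms
proof (induction p arbitrary: v rule: free_algebra_induct)
  case (scalar c)
  then show ?case by (simp add: word_form_scale_left word_form_scale_right)
next
  case (letter X p)
  then have "word_form (A (letter X * p) u) v = word_form (A p u) (D (adj sg X) v)"
    by (simp add: A_letter_mult word_form_D A_closed)
  also have "\<dots> = word_form u (A (star_poly (adj sg) p) (D (adj sg X) v))"
    using letter by (simp add: D_closed)
  also have "\<dots> = word_form u (A (star_poly (adj sg) (letter X * p)) v)"
    using letter by (simp add: star_poly_mult A_mult star_closed_poly)
  finally show ?case .
qed (auto simp: A_add star_poly_add word_form_add_left word_form_add_right)

text \<open>The polynomials acting as zero on the whole free algebra \<open>N\<close> form an ideal.
  It contains the linear relations since \<open>D\<close> is linear in X, and the relators by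
  \<open>D_bracket\<close>.\<close>

lemma A_cong:
  assumes "p \<in> carrier F" "q \<in> carrier F" "proj p = proj q" "u \<in> carrier N"
  shows "A p u = A q u"
proof -
  let ?J = "{p \<in> carrier F. \<forall>u\<in>carrier N. A p u = 0}"
  have "ideal ?J F"
    by (rule GL.free.ideal_if_closed)
      (auto simp: A_add A_mult A_closed A_0_right free_algebra_closed)
  moreover have "GL.gens \<subseteq> ?J"
  proof
    fix g assume g: "g \<in> GL.gens"
    then consider x y where "x \<in> gl" "y \<in> gl" "g = letter (x + y) - letter x - letter y"
      | c x where "x \<in> gl" "g = letter (fun_scale scale c x) - scalar c * letter x"
      unfolding GL.gens_def by blast
    then have "\<forall>u\<in>carrier N. A g u = 0"
      by cases (simp_all add: A_diff A_scale D_add_left D_scale_left)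
    then show "g \<in> ?J" using g GL.gens_subset by auto
  qed
  moreover have "relator \<alpha> \<beta> X Y \<in> ?J" if XY: "X \<in> gl_part \<alpha>" "Y \<in> gl_part \<beta>" for \<alpha> \<beta> X Y
    using relator_closed[of X Y \<alpha> \<beta>] XY
    by (auto simp: relator_def A_diff A_scale A_letter_mult D_bracket[OF XY] gl_part_gl)
  ultimately have "p - q \<in> ?J"
    using assms(1-3) by (rule proj_kernel_least)
  then show ?thesis using assms(4) by (simp add: A_diff)
qed

definition power_act where
  "power_act n = restrict (\<lambda>x. restrict (\<lambda>t. M.tensor_of (A (representative x) (M.normal_form t)))
    (carrier (tensor_power sM S n))) (carrier U)"

lemma power_cases:
  assumes "t \<in> carrier (tensor_power sM S n)"
  obtains q where "q \<in> homogeneous_part B n" "q \<in> carrier N" "t = M.tensor_of q"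
  using assms homogeneous_part_subset[of B n] unfolding M.tensor_power_carrier by auto

lemma power_act_eq:
  assumes "p \<in> carrier F" "q \<in> homogeneous_part B n"
  shows "power_act n (proj p) (M.tensor_of q) = M.tensor_of (A p q)"
proof -
  have q: "q \<in> carrier N" using assms(2) homogeneous_part_subset by blast
  have "M.tensor_of q \<in> carrier (tensor_power sM S n)"
    unfolding M.tensor_power_carrier using assms(2) by (rule imageI)
  moreover have "A (representative (proj p)) q = A p q"
    using representative[OF proj_closed[OF assms(1)]] assms(1) q by (intro A_cong) auto
  ultimately show ?thesis
    using assms(1) q by (simp add: power_act_def proj_closed M.normal_form_tensor_of)
qed

lemma U_cases:
  assumes "x \<in> carrier U"
  obtains p where "p \<in> carrier F" "x = proj p"
  using assms by (auto simp: carrier_U)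

lemma algebra_action_power_act: "algebra_action U (tensor_power sM S n) (power_act n)"
  unfolding algebra_action_def
proof (intro conjI allI ballI)
  let ?M = "tensor_power sM S n"
  have closed: "power_act n x t \<in> carrier ?M" if "x \<in> carrier U" "t \<in> carrier ?M" for x t
    using that by (elim U_cases power_cases)
      (auto simp: power_act_eq M.tensor_power_carrier A_homogeneous)
  show "power_act n \<in> carrier U \<rightarrow>\<^sub>E carrier ?M \<rightarrow>\<^sub>E carrier ?M"
    unfolding power_act_def restrict_PiE_iff
    using closed by (auto simp: power_act_def)
  fix x y v v' c assume x: "x \<in> carrier U"
  { assume "v \<in> carrier ?M" "v' \<in> carrier ?M"
    then show "power_act n x (v \<oplus>\<^bsub>?M\<^esub> v') = power_act n x v \<oplus>\<^bsub>?M\<^esub> power_act n x v'"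
      using x by (elim U_cases power_cases)
        (simp add: power_act_eq homogeneous_part_closed A_add_right A_closed flip: M.tensor_of_add) }
  { assume "v \<in> carrier ?M"
    then show "power_act n (c \<odot>\<^bsub>U\<^esub> x) v = c \<odot>\<^bsub>?M\<^esub> power_act n x v"
       "power_act n x (c \<odot>\<^bsub>?M\<^esub> v) = c \<odot>\<^bsub>?M\<^esub> power_act n x v"
      using x by (elim U_cases power_cases;
        simp add: power_act_eq homogeneous_part_closed A_scale A_scale_right A_closed free_algebra_closed
          flip: M.tensor_of_scale proj_scale)+ }
  { assume "y \<in> carrier U" "v \<in> carrier ?M"
    then show "power_act n (x \<oplus>\<^bsub>U\<^esub> y) v = power_act n x v \<oplus>\<^bsub>?M\<^esub> power_act n y v"
       "power_act n (x \<otimes>\<^bsub>U\<^esub> y) v = power_act n x (power_act n y v)"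
      using x by (elim U_cases power_cases;
        simp add: power_act_eq A_homogeneous A_add A_mult A_closed free_algebra_closed
          flip: M.tensor_of_add proj_add proj_mult)+ }
next
  fix v assume "v \<in> carrier (tensor_power sM S n)"
  then show "power_act n \<one>\<^bsub>U\<^esub> v = v"
    by (elim power_cases) (simp add: power_act_eq flip: proj_one)
qed

text \<open>Uniqueness: an algebra action is determined by the generators \<open>U_incl X\<close>,
  because c 1 must act as multiplication by c. Both levels of extensionality then turn pointwise
  agreement into equality.\<close>

lemma U_action_eq: "U_action (tensor_power sM S n) tensor_act = power_act n"
  unfolding U_action_def
proof (rule the_equality, intro conjI ballI)
  let ?M = "tensor_power sM S n"
  note pa = algebra_action_power_act[of n]
  show "algebra_action U ?M (power_act n)" by (rule pa)
  have incl: "power_act n (U_incl X) v = tensor_act X v" if "X \<in> gl" "v \<in> carrier ?M" for X v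
    using that by (elim power_cases) (simp add: tensor_act_tensor_of power_act_eq flip: proj_letter)
  then show "\<And>X v. X \<in> gl \<Longrightarrow> v \<in> carrier ?M \<Longrightarrow> power_act n (U_incl X) v = tensor_act X v" .
  fix \<sigma> assume \<sigma>: "algebra_action U ?M \<sigma> \<and> (\<forall>X\<in>gl. \<forall>v\<in>carrier ?M. \<sigma> (U_incl X) v = tensor_act X v)"
  interpret U: complex_algebra U by (rule UQ.quot_complex_algebra)
  have PiE: "power_act n \<in> carrier U \<rightarrow>\<^sub>E carrier ?M \<rightarrow>\<^sub>E carrier ?M"
      "\<sigma> \<in> carrier U \<rightarrow>\<^sub>E carrier ?M \<rightarrow>\<^sub>E carrier ?M"
    using pa \<sigma> by (simp_all add: algebra_action_def)
  have closed: "power_act n x v \<in> carrier ?M" if "x \<in> carrier U" "v \<in> carrier ?M" for x v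
    using PiE_mem[OF PiE_mem[OF PiE(1)]] that by simp
  have eq: "\<sigma> x v = power_act n x v" if "x \<in> carrier U" "v \<in> carrier ?M" for x v
    using that
  proof (induction x arbitrary: v rule: U_induct)
    case (scalar c)
    have "\<sigma>' (c \<odot>\<^bsub>U\<^esub> \<one>\<^bsub>U\<^esub>) v = c \<odot>\<^bsub>?M\<^esub> v" if "algebra_action U ?M \<sigma>'" for \<sigma>'
      using that scalar U.one_closed unfolding algebra_action_def by simp
    from this[OF pa] this[OF conjunct1[OF \<sigma>]] show ?case by simp
  next
    case (letter X x)
    have "\<sigma> (U_incl X \<otimes>\<^bsub>U\<^esub> x) v = \<sigma> (U_incl X) (\<sigma> x v)"
      using conjunct1[OF \<sigma>] letter by (simp add: algebra_action_def U_incl_closed)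
    also have "\<dots> = power_act n (U_incl X) (power_act n x v)"
      using \<sigma> letter closed by (simp add: incl)
    also have "\<dots> = power_act n (U_incl X \<otimes>\<^bsub>U\<^esub> x) v"
      using pa letter U_incl_closed unfolding algebra_action_def by simp
    finally show ?case .
  next
    case (add x y)
    then show ?case using \<sigma> pa unfolding algebra_action_def by simp
  qed
  show "\<sigma> = power_act n"
  proof (rule extensionalityI[of _ "carrier U"])
    show "\<sigma> \<in> extensional (carrier U)" "power_act n \<in> extensional (carrier U)"
      using PiE by (simp_all add: PiE_def)
    fix x assume x: "x \<in> carrier U"
    show "\<sigma> x = power_act n x"
    proof (rule extensionalityI[of _ "carrier ?M"])
      show "\<sigma> x \<in> extensional (carrier ?M)" "power_act n x \<in> extensional (carrier ?M)"
        using PiE_mem[OF PiE(1) x] PiE_mem[OF PiE(2) x] by (simp_all add: PiE_def)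
    qed (rule eq[OF x])
  qed
qed

text \<open>The form is \<open>word_form\<close> pulled back along \<open>normal_form\<close>, one
  formula for all n. Definiteness holds because a nonzero tensor has a nonzero normal form;
  \<open>word_form_A\<close> with \<open>star_proj\<close> moves x to the other side.\<close>

theorem unitarisable_tensor_power:
  "unitarisable U (star sg) (tensor_power sM S n)
    (U_action (tensor_power sM S n) (tensor_action sM S P act))"
proof -
  let ?M = "tensor_power sM S n"
  let ?f = "\<lambda>t t'. word_form (M.normal_form t) (M.normal_form t')"
  have "sesquilinear_form ?M ?f"
    unfolding sesquilinear_form_def
    by (intro conjI allI ballI; elim power_cases)
      (simp_all add: M.normal_form_tensor_of free_algebra_closed word_form_add_left word_form_add_right
        word_form_scale_left word_form_scale_right flip: M.tensor_of_add M.tensor_of_scale)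
  moreover have "positive_definite ?M ?f"
    unfolding positive_definite_def
  proof (intro ballI impI)
    fix x assume x: "x \<in> carrier ?M" "x \<noteq> \<zero>\<^bsub>?M\<^esub>"
    obtain q where q: "q \<in> carrier N" "x = M.tensor_of q"
      using x(1) by (rule power_cases)
    moreover have "q \<noteq> 0"
      using x(2) q by (metis M.tensor_of_zero M.tensor_power_simps(2))
    ultimately show "?f x x \<in> \<real> \<and> 0 < Re (?f x x)"
      using word_form_positive[of q] by (simp add: M.normal_form_tensor_of)
  qed
  moreover have "?f (power_act n x v) v' = ?f v (power_act n (star sg x) v')"
    if "x \<in> carrier U" "v \<in> carrier ?M" "v' \<in> carrier ?M" for x v v'
    using that by (elim U_cases power_cases)
      (simp add: power_act_eq star_proj star_closed_poly M.normal_form_tensor_of A_closed word_form_A)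
  ultimately show ?thesis
    unfolding unitarisable_def tensor_action_eq U_action_eq by blast
qed

end

section \<open>The natural module and its dual\<close>

lemma vector_space_complex: "vector_space ((*) :: complex \<Rightarrow> complex \<Rightarrow> complex)"
  by unfold_locales (auto simp: algebra_simps)

context graded_space
begin

lemma U_scale_one: "x \<in> carrier U \<Longrightarrow> 1 \<odot>\<^bsub>U\<^esub> x = x"
  using proj_scale[of _ 1] by (auto simp: carrier_U)

lemma natural_unitarisable:
  assumes "\<And>\<alpha> \<beta>. cmod (\<omega> \<alpha> \<beta>) = 1"
  shows "unitarisable U star_I (natural_power n) (natural_power_action n)"
proof -
  interpret N: graded_module scale B \<omega> V "\<lambda>_. 1" scale UNIV "\<lambda>b. b" rep V "\<lambda>X v. X v" degree
  proof
    \<comment> \<open>For the natural module this is just the conjugate transpose in the basis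
      \<open>B\<close>.\<close>
    show "cnj (rep (X b) b') = rep (adj (\<lambda>_. 1) X b') b" if "X \<in> gl" "b \<in> B" "b' \<in> B" for X b b'
      using mat_adj[of b' b "\<lambda>_. 1" X] that by (simp add: mat_def)
    show "X x \<in> V (\<alpha> + \<beta>)" if "X \<in> gl_part \<alpha>" "x \<in> V \<beta>" for X \<alpha> x \<beta>
      using that by (auto simp: gl_part_def)
    show "degree b = \<beta>" if "x \<in> V \<beta>" "b \<in> B" "rep x b \<noteq> 0" for x \<beta> b
      using that by (auto simp: part_iff)
  qed (auto simp: assms sign_function_def finite_Basis rep_expansion rep_add rep_scale rep_basis
      gl_add gl_scale fun_scale_def bracket_def basis_in_part)
  have "star_I = star (\<lambda>_. 1)"
    unfolding star_I_def
  proof (rule the_equality)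
    \<comment> \<open>\<open>star_E\<close> puts the scalar 1 in front of
      \<open>U_incl (E b a)\<close>, and \<open>star_I\<close> has none; \<open>U_scale_one\<close>
      removes it.\<close>
    show "star_structure U (star (\<lambda>_. 1)) \<and> (\<forall>a\<in>B. \<forall>b\<in>B. star (\<lambda>_. 1) (U_incl (E a b)) = U_incl (E b a))"
      using N.star_structure_star N.star_E by (simp add: U_scale_one U_incl_closed)
    fix \<tau> assume "star_structure U \<tau> \<and> (\<forall>a\<in>B. \<forall>b\<in>B. \<tau> (U_incl (E a b)) = U_incl (E b a))"
    then show "\<tau> = star (\<lambda>_. 1)"
      by (intro N.star_structure_unique) (simp_all add: U_scale_one U_incl_closed)
  qed
  then show ?thesis
    using N.unitarisable_tensor_power[of n] by (simp add: natural_power_def natural_power_action_def)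
qed

section \<open>The dual module and its coordinate functionals\<close>

lemma dualI:
  "(\<And>u v. f (u + v) = f u + f v) \<Longrightarrow> (\<And>c v. f (c *s v) = c * f v) \<Longrightarrow> f \<in> dual"
  by (simp add: dual_def Vector_Spaces.linear_iff vector_space_axioms vector_space_complex)

lemma dual_add: "f \<in> dual \<Longrightarrow> f (u + v) = f u + f v"
  and dual_scale: "f \<in> dual \<Longrightarrow> f (c *s v) = c * f v"
  by (simp_all add: dual_def Vector_Spaces.linear_iff)

lemma dual_apply: "f \<in> dual \<Longrightarrow> f v = (\<Sum>b\<in>B. f b * rep v b)"
proof -
  assume f: "f \<in> dual"
  have "f (\<Sum>b\<in>A. rep v b *s b) = (\<Sum>b\<in>A. f b * rep v b)" for A
    using dual_scale[OF f, of 0 0]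
    by (induction A rule: infinite_finite_induct) (auto simp: f dual_add dual_scale)
  from this[of B] show ?thesis by (simp add: rep_expansion)
qed

lemma dual_closed:
  shows "f \<in> dual \<Longrightarrow> g \<in> dual \<Longrightarrow> f + g \<in> dual"
    and "f \<in> dual \<Longrightarrow> fun_scale (*) c f \<in> dual"
    and "0 \<in> dual"
  by (auto intro!: dualI simp: fun_scale_def dual_add dual_scale algebra_simps)

abbreviation coordinate :: "'v \<Rightarrow> 'v \<Rightarrow> complex" where
  "coordinate b \<equiv> \<lambda>v. rep v b"

lemma coordinate_dual: "coordinate b \<in> dual"
  by (rule dualI) (simp_all add: rep_add rep_scale)

lemma dual_expansion: "f \<in> dual \<Longrightarrow> f = (\<Sum>b\<in>B. fun_scale (*) (f b) (coordinate b))"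
proof
  fix v assume "f \<in> dual"
  have "(\<Sum>b\<in>A. fun_scale (*) (f b) (coordinate b)) v = (\<Sum>b\<in>A. f b * rep v b)" for A
    by (induction A rule: infinite_finite_induct) (auto simp: fun_scale_def)
  then show "f v = (\<Sum>b\<in>B. fun_scale (*) (f b) (coordinate b)) v"
    using dual_apply[OF \<open>f \<in> dual\<close>, of v] by simp
qed

lemma dual_part_dual: "f \<in> dual_part \<beta> \<Longrightarrow> f \<in> dual"
  by (simp add: dual_part_def)

lemma dual_part_basis: "f \<in> dual_part \<beta> \<Longrightarrow> b \<in> B \<Longrightarrow> f b \<noteq> 0 \<Longrightarrow> - degree b = \<beta>"
proof (rule ccontr)
  assume f: "f \<in> dual_part \<beta>" "b \<in> B" "f b \<noteq> 0" "- degree b \<noteq> \<beta>"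
  then have "degree b \<noteq> - \<beta>" by auto
  then show False using f basis_in_part[of b] unfolding dual_part_def by simp
qed

lemma coordinate_part: "b \<in> B \<Longrightarrow> coordinate b \<in> dual_part (- degree b)"
  using coordinate_dual by (auto simp: dual_part_def part_iff)

lemma dual_part_scale: "f \<in> dual_part \<beta> \<Longrightarrow> fun_scale (*) c f \<in> dual_part \<beta>"
  unfolding dual_part_def using dual_closed(2)[of f c] by (simp add: fun_scale_def)

lemma dual_induct [consumes 1, case_names part add]:
  assumes f: "f \<in> dual"
    and part: "\<And>\<beta> f. f \<in> dual_part \<beta> \<Longrightarrow> P f"
    and add: "\<And>f g. f \<in> dual \<Longrightarrow> g \<in> dual \<Longrightarrow> P f \<Longrightarrow> P g \<Longrightarrow> P (f + g)"
  shows "P f"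
proof -
  have "finite A \<Longrightarrow> A \<subseteq> B \<Longrightarrow> (\<Sum>b\<in>A. fun_scale (*) (f b) (coordinate b)) \<in> dual \<and>
    P (\<Sum>b\<in>A. fun_scale (*) (f b) (coordinate b))" for A
  proof (induction A rule: finite_induct)
    case empty
    have "(0 :: 'v \<Rightarrow> complex) \<in> dual_part 0" by (auto simp: dual_part_def dual_closed)
    then have "0 \<in> dual \<and> P 0" using part dual_closed(3) by blast
    then show ?case unfolding sum.empty .
  next
    case (insert b A)
    have "fun_scale (*) (f b) (coordinate b) \<in> dual_part (- degree b)"
      using insert.prems by (intro dual_part_scale coordinate_part) auto
    then have "fun_scale (*) (f b) (coordinate b) \<in> dual \<and> P (fun_scale (*) (f b) (coordinate b))"
      using part dual_part_dual by blast
    moreover have "(\<Sum>b\<in>A. fun_scale (*) (f b) (coordinate b)) \<in> dual \<and>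
        P (\<Sum>b\<in>A. fun_scale (*) (f b) (coordinate b))"
      using insert by blast
    ultimately show ?case
      unfolding sum.insert[OF insert.hyps] by (elim conjE) (intro conjI dual_closed(1) add)
  qed
  from this[of B] show ?thesis using dual_expansion[OF f] finite_Basis by simp
qed

text \<open>The linear extension of the homogeneous formula: the coordinate functional of a has
  degree - degree a, and \<open>twist (- degree a) X\<close> absorbs the factor \<omega> (d X) (-
  degree a) also for inhomogeneous X.\<close>

definition dual_act :: "('v \<Rightarrow> 'v) \<Rightarrow> ('v \<Rightarrow> complex) \<Rightarrow> ('v \<Rightarrow> complex)" where
  "dual_act = restrict (\<lambda>X. restrict (\<lambda>f v. - (\<Sum>a\<in>B. f a * rep (twist (- degree a) X v) a)) dual) gl"

lemma dual_act_eq: "X \<in> gl \<Longrightarrow> f \<in> dual \<Longrightarrow> dual_act X f =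
    (\<lambda>v. - (\<Sum>a\<in>B. f a * rep (twist (- degree a) X v) a))"
  by (simp add: dual_act_def)

text \<open>Only basis vectors with - degree a = \<beta> contribute to f, so all the twists that
  occur multiply X by the same factor.\<close>

lemma dual_act_part:
  assumes X: "X \<in> gl_part \<alpha>" and f: "f \<in> dual_part \<beta>"
  shows "dual_act X f = (\<lambda>v. - \<omega> \<alpha> \<beta> * f (X v))"
proof
  fix v
  have "f a * rep (twist (- degree a) X v) a = \<omega> \<alpha> \<beta> * (f a * rep (X v) a)" if "a \<in> B" for a
    using dual_part_basis[OF f that]
    by (cases "f a = 0") (auto simp: twist_part[OF X] fun_scale_def rep_scale)
  then have "(\<Sum>a\<in>B. f a * rep (twist (- degree a) X v) a) = \<omega> \<alpha> \<beta> * (\<Sum>a\<in>B. f a * rep (X v) a)"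
    unfolding sum_distrib_left by (rule sum.cong[OF refl])
  then show "dual_act X f v = - \<omega> \<alpha> \<beta> * f (X v)"
    using X f dual_apply[of f "X v"] by (simp add: dual_act_eq gl_part_gl dual_part_dual)
qed

lemma dual_act_dual: "X \<in> gl \<Longrightarrow> f \<in> dual \<Longrightarrow> dual_act X f \<in> dual"
  unfolding dual_act_eq
  by (rule dualI) (simp_all add: gl_add[OF twist_gl] gl_scale[OF twist_gl] rep_add rep_scale
      distrib_left sum.distrib sum_distrib_left mult_ac)

lemma dual_act_linear:
  assumes X: "X \<in> gl" and f: "f \<in> dual"
  shows "Y \<in> gl \<Longrightarrow> dual_act (X + Y) f = dual_act X f + dual_act Y f"
    and "g \<in> dual \<Longrightarrow> dual_act X (f + g) = dual_act X f + dual_act X g"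
    and "dual_act (fun_scale scale c X) f = fun_scale (*) c (dual_act X f)"
    and "dual_act X (fun_scale (*) c f) = fun_scale (*) c (dual_act X f)"
proof -
  note eqs = fun_eq_iff fun_scale_def rep_add rep_scale distrib_left distrib_right sum.distrib
    sum_distrib_left mult_ac
  show "dual_act (X + Y) f = dual_act X f + dual_act Y f" if "Y \<in> gl"
    unfolding dual_act_eq[OF gl_closed(1)[OF X that] f] dual_act_eq[OF X f] dual_act_eq[OF that f]
        twist_add
    by (simp add: eqs)
  show "dual_act X (f + g) = dual_act X f + dual_act X g" if "g \<in> dual"
    unfolding dual_act_eq[OF X dual_closed(1)[OF f that]] dual_act_eq[OF X f] dual_act_eq[OF X that]
    by (simp add: eqs)
  show "dual_act (fun_scale scale c X) f = fun_scale (*) c (dual_act X f)"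
    unfolding dual_act_eq[OF gl_closed(2)[OF X] f] dual_act_eq[OF X f] twist_scale
    by (simp add: eqs)
  show "dual_act X (fun_scale (*) c f) = fun_scale (*) c (dual_act X f)"
    unfolding dual_act_eq[OF X dual_closed(2)[OF f]] dual_act_eq[OF X f]
    by (simp add: eqs)
qed

text \<open>Uniqueness takes two inductions: first over f with X homogeneous, then over X with f
  arbitrary.\<close>

lemma dual_action_eq: "dual_action = dual_act"
  unfolding dual_action_def
proof (rule the_equality, intro conjI allI ballI)
  show "dual_act \<in> gl \<rightarrow>\<^sub>E dual \<rightarrow>\<^sub>E dual"
    using dual_act_dual unfolding dual_act_def restrict_PiE_iff by (simp add: dual_act_def)
next
  fix \<rho> :: "('v \<Rightarrow> 'v) \<Rightarrow> ('v \<Rightarrow> complex) \<Rightarrow> 'v \<Rightarrow> complex"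
  assume *: "\<rho> \<in> gl \<rightarrow>\<^sub>E (dual \<rightarrow>\<^sub>E dual) \<and>
     (\<forall>X\<in>gl. \<forall>Y\<in>gl. \<forall>f\<in>dual. \<rho> (X + Y) f = \<rho> X f + \<rho> Y f) \<and>
     (\<forall>X\<in>gl. \<forall>f\<in>dual. \<forall>g\<in>dual. \<rho> X (f + g) = \<rho> X f + \<rho> X g) \<and>
     (\<forall>c. \<forall>X\<in>gl. \<forall>f\<in>dual.
        \<rho> (fun_scale scale c X) f = fun_scale (*) c (\<rho> X f) \<and>
        \<rho> X (fun_scale (*) c f) = fun_scale (*) c (\<rho> X f)) \<and>
     (\<forall>\<alpha> \<beta>. \<forall>X\<in>gl_part \<alpha>. \<forall>f\<in>dual_part \<beta>. \<rho> X f = (\<lambda>v. - \<omega> \<alpha> \<beta> * f (X v)))"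
  from * have pie: "\<rho> \<in> gl \<rightarrow>\<^sub>E (dual \<rightarrow>\<^sub>E dual)" by (elim conjE)
  from * have add_left: "\<forall>X\<in>gl. \<forall>Y\<in>gl. \<forall>f\<in>dual. \<rho> (X + Y) f = \<rho> X f + \<rho> Y f" by (elim conjE)
  from * have add_right: "\<forall>X\<in>gl. \<forall>f\<in>dual. \<forall>g\<in>dual. \<rho> X (f + g) = \<rho> X f + \<rho> X g" by (elim conjE)
  from * have homogeneous: "\<forall>\<alpha> \<beta>. \<forall>X\<in>gl_part \<alpha>. \<forall>f\<in>dual_part \<beta>. \<rho> X f = (\<lambda>v. - \<omega> \<alpha> \<beta> * f (X v))"
    by (elim conjE)
  have 1: "\<rho> X f = dual_act X f" if X: "X \<in> gl_part \<alpha>" and "f \<in> dual" for X f \<alpha>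
    using that(2)
  proof (induction f rule: dual_induct)
    case (part \<beta> f)
    then have "\<rho> X f = dual_act X f"
      unfolding dual_act_part[OF X part] using homogeneous X part by blast
    then show ?case .
  next
    case (add f g)
    then have "\<rho> X (f + g) = dual_act X (f + g)"
      using add_right gl_part_gl[OF X] by (simp only: dual_act_linear)
    then show ?case .
  qed
  have 2: "\<rho> X f = dual_act X f" if "X \<in> gl" and f: "f \<in> dual" for X f
    using that(1)
  proof (induction X rule: gl_part_induct)
    case (part \<alpha> X)
    then have "\<rho> X f = dual_act X f" using 1 f by blast
    then show ?case .
  next
    case (add X Y)
    then have "\<rho> (X + Y) f = dual_act (X + Y) f"
      using add_left f by (simp only: dual_act_linear)
    then show ?case .
  qed
  show "\<rho> = dual_act"
  proof (rule extensionalityI[of _ gl])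
    show "\<rho> \<in> extensional gl" "dual_act \<in> extensional gl"
      using pie by (auto simp: PiE_def dual_act_def)
    fix X assume X: "X \<in> gl"
    show "\<rho> X = dual_act X"
    proof (rule extensionalityI[of _ dual])
      show "\<rho> X \<in> extensional dual" "dual_act X \<in> extensional dual"
        using PiE_mem[OF pie X] X by (auto simp: PiE_def dual_act_def)
    qed (rule 2[OF X])
  qed
qed (simp_all only: dual_act_linear dual_act_part)

text \<open>The square is 1 because \<omega> x x is its own inverse; it is real because
  \<open>cnj_factor\<close> turns its conjugate into \<omega> (- x) (- x), where the signs
  cancel.\<close>

lemma sign_function_factor:
  assumes "\<And>\<alpha> \<beta>. cmod (\<omega> \<alpha> \<beta>) = 1"
  shows "sign_function (\<lambda>b. \<omega> (degree b) (degree b))"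
  using factor_simps(9) cnj_factor[OF assms] by (simp add: sign_function_def factor_simps(7,8))

text \<open>The matrix of the dual action: the negative transpose, with a colour factor that depends
  on both indices.\<close>

lemma dual_act_coordinate:
  assumes "X \<in> gl" "a \<in> B" "b \<in> B"
  shows "dual_act X (coordinate b) a = - \<omega> (degree b - degree a) (- degree b) * mat X b a"
proof -
  have "(\<Sum>a'\<in>B. rep a' b * rep (twist (- degree a') X a) a') =
      (\<Sum>a'\<in>B. if a' = b then mat (twist (- degree b) X) b a else 0)"
    by (rule sum.cong) (auto simp: rep_basis mat_def)
  then show ?thesis
    using assms finite_Basis by (simp add: dual_act_eq coordinate_dual mat_twist)
qed

lemma dual_act_in_part:
  assumes X: "X \<in> gl_part \<alpha>" and f: "f \<in> dual_part \<beta>"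
  shows "dual_act X f \<in> dual_part (\<alpha> + \<beta>)"
proof -
  have "f (X v) = 0" if v: "v \<in> V \<gamma>" "\<gamma> \<noteq> - (\<alpha> + \<beta>)" for v \<gamma>
  proof -
    have "X v \<in> V (\<alpha> + \<gamma>)" using X v by (auto simp: gl_part_def)
    moreover have "\<alpha> + \<gamma> \<noteq> - \<beta>" using v(2)
        by (metis add.commute add_diff_cancel_left' minus_add uminus_add_conv_diff)
    ultimately show ?thesis using f by (auto simp: dual_part_def)
  qed
  then show ?thesis
    using X f dual_act_dual[of X f]
        by (auto simp: dual_part_def[of "\<alpha> + \<beta>"] gl_part_gl dual_part_dual dual_act_part)
qed

lemma dual_unitarisable:
  assumes "\<And>\<alpha> \<beta>. cmod (\<omega> \<alpha> \<beta>) = 1"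
  shows "unitarisable U star_II (dual_power n) (dual_power_action n)"
proof -
  let ?s = "\<lambda>b. \<omega> (degree b) (degree b)"
  interpret N: graded_module scale B \<omega> V ?s "fun_scale (*)" dual coordinate "\<lambda>f b. f b"
      dual_part dual_action "\<lambda>b. - degree b"
  proof
    show "sign_function ?s" using assms by (rule sign_function_factor)
    show "f = (\<Sum>b\<in>B. fun_scale (*) (f b) (coordinate b))" if "f \<in> dual" for f
      using that by (rule dual_expansion)
    show "fun_scale (*) c f b = c * f b" for c and f :: "'v \<Rightarrow> complex" and b
      by (simp add: fun_scale_def)
    show "fun_scale (*) 0 f = 0" for f :: "'v \<Rightarrow> complex"
      by (simp add: fun_scale_def fun_eq_iff)
    show "dual_action X (dual_action Y (coordinate b)) = dual_action (bracket \<alpha> \<beta> X Y) (coordinate b) +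
        fun_scale (*) (\<omega> \<alpha> \<beta>) (dual_action Y (dual_action X (coordinate b)))"
      if X: "X \<in> gl_part \<alpha>" and Y: "Y \<in> gl_part \<beta>" and b: "b \<in> B" for X Y \<alpha> \<beta> b
    proof
      fix v
      define d where "d = - degree b"
      let ?f = "coordinate b"
      have f: "?f \<in> dual_part d" unfolding d_def by (rule coordinate_part[OF b])
      \<comment> \<open>Functionals reverse composition: acting by X after Y evaluates the
        functional at Y (X v).\<close>
      have "dual_act X (dual_act Y ?f) v = \<omega> \<alpha> (\<beta> + d) * \<omega> \<beta> d * rep (Y (X v)) b"
        "dual_act Y (dual_act X ?f) v = \<omega> \<beta> (\<alpha> + d) * \<omega> \<alpha> d * rep (X (Y v)) b"
        using dual_act_part[OF X dual_act_in_part[OF Y f]] dual_act_part[OF Y f]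
          dual_act_part[OF Y dual_act_in_part[OF X f]] dual_act_part[OF X f] by simp_all
      moreover have "dual_act (bracket \<alpha> \<beta> X Y) ?f v =
          - \<omega> (\<alpha> + \<beta>) d * (rep (X (Y v)) b - \<omega> \<alpha> \<beta> * rep (Y (X v)) b)"
        unfolding dual_act_part[OF bracket_part[OF X Y] f] by (simp add: bracket_def rep_diff rep_scale)
      \<comment> \<open>With this identity the terms in X (Y v) cancel on the right-hand side, and
        those in Y (X v) agree with the left.\<close>
      moreover have "\<omega> \<alpha> \<beta> * \<omega> \<beta> (\<alpha> + d) = \<omega> \<beta> d"
        using factor_simps(2)[of \<alpha> \<beta>] by (simp add: factor_simps(4) flip: mult.assoc)
      ultimately show "dual_action X (dual_action Y ?f) v = (dual_action (bracket \<alpha> \<beta> X Y) ?f +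
        fun_scale (*) (\<omega> \<alpha> \<beta>) (dual_action Y (dual_action X ?f))) v"
        by (simp add: dual_action_eq fun_scale_def factor_simps(3) factor_simps(4)[of \<alpha>]
            right_diff_distrib mult_ac)
    qed
    show "cnj (dual_action X (coordinate b) b') = dual_action (adj ?s X) (coordinate b') b"
      if "X \<in> gl" "b \<in> B" "b' \<in> B" for X b b'
    proof -
      let ?x = "degree b" and ?y = "degree b'"
      have "cnj (\<omega> (?x - ?y) (- ?x)) = \<omega> ?x (?y + - ?x)"
        using cnj_factor[OF assms, of "?x - ?y" "- ?x"] by simp
      also have "\<dots> = \<omega> ?x ?y * inverse (\<omega> ?x ?x)"
        unfolding factor_simps(4,8) ..
      also have "\<dots> = \<omega> ?x ?y * \<omega> ?x ?x"
        using inverse_unique[OF factor_simps(9)[of ?x]] by simp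
      \<comment> \<open>\<omega> (y - x) (- y) equals \<omega> x y divided by \<omega> y y, so the
        sign of y restores \<omega> x y.\<close>
      also have "\<dots> = \<omega> (?y + - ?x) (- ?y) * (\<omega> ?x ?x * \<omega> ?y ?y)"
        unfolding factor_simps(3,7,8) using factor_simps(1) by simp
      finally have "cnj (\<omega> (?x - ?y) (- ?x)) = \<omega> (?y - ?x) (- ?y) * (\<omega> ?x ?x * \<omega> ?y ?y)"
        by simp
      then show ?thesis
        using that by (simp add: dual_action_eq dual_act_coordinate mat_adj)
    qed
  qed (auto simp: assms finite_Basis dual_closed coordinate_dual rep_basis dual_action_eq
      dual_act_dual dual_act_linear dual_act_in_part dual_part_dual dual_part_basis coordinate_part)
  have "star_II = star ?s"
    unfolding star_II_def
    by (rule the_equality) (auto simp: N.star_structure_star N.star_E intro: N.star_structure_unique)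
  then show ?thesis
    using N.unitarisable_tensor_power[of n] by (simp add: dual_power_def dual_power_action_def)
qed

end

theorem theorem5p19:
  fixes scale :: "complex \<Rightarrow> 'v::ab_group_add \<Rightarrow> 'v"
    and B :: "'v set"
    and \<omega> :: "'g::ab_group_add \<Rightarrow> 'g \<Rightarrow> complex"
    and V :: "'g \<Rightarrow> 'v set"
  assumes "graded_space scale B \<omega> V"
    and "\<And>\<alpha> \<beta>. cmod (\<omega> \<alpha> \<beta>) = 1"
  shows "(\<forall>r. unitarisable (graded_space.U scale \<omega> V) (graded_space.star_I scale B \<omega> V)
              (graded_space.natural_power scale r)
              (graded_space.natural_power_action scale \<omega> V r)) \<and>
         (\<forall>r. unitarisable (graded_space.U scale \<omega> V) (graded_space.star_II scale B \<omega> V)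
              (graded_space.dual_power scale r)
              (graded_space.dual_power_action scale \<omega> V r))"
  using graded_space.natural_unitarisable[OF assms] graded_space.dual_unitarisable[OF assms] by blast

end
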